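(* Let $(\mathcal G, \mathcal L)$ be a twisted Hausdorff étale groupoid with a $*$-representation $\pi \colon \Gamma_c(\mathcal G, \mathcal L) \to \mathcal B(\mathcal H)$ which weakly contains the regular representation $\lambda$, and let $a\in \mathrm{Ped}(C^*_\pi(\mathcal G, \mathcal L))_+$. Then there exists a positive element $f\in C_c(\mathcal G^0)$ such that $\tau_\mu(a) = \int_{\mathcal G^0} f\, \mathrm d\mu$ for every $\mathcal G$-invariant real Radon measure $\mu$ on $\mathcal G^0$.
   Context: An étale groupoid $\mathcal G$ is a topological groupoid whose range map $r$ (hence also source map $s$) is a local homeomorphism; its unit space $\mathcal G^0$ is assumed locally compact Hausdorff. Here $\mathcal G$ itself is Hausdorff. An open bisection is an open $U\subseteq\mathcal G$ on which $r$ and $s$ are injective. A twisted étale groupoid $(\mathcal G,\mathcal L)$ is an étale groupoid with a Fell line bundle $\mathcal L\to\mathcal G$ (a Fell bundle with one-dimensional fibres). $\Gamma_c(\mathcal G,\mathcal L)$ is, for $\mathcal G$ Hausdorff, the space of compactly supported continuous sections of $\mathcal L$; it is a $*$-algebra with $(f*h)(g)=\sum_{g=g_1g_2} f(g_1)h(g_2)$ and $f^*(g)=f(g^{-1})^*$. The restriction of $\mathcal L$ to $\mathcal G^0$ is the trivial bundle with fibres $\mathbb C$, so $\Gamma_c(\mathcal G^0,\mathcal L)=C_c(\mathcal G^0)$. The regular representation $\lambda$ is the representation of $\Gamma_c(\mathcal G,\mathcal L)$ on $\bigoplus_{x\in\mathcal G^0}\ell^2(\mathcal G_x,\mathcal L)$,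 $\mathcal G_x=s^{-1}(x)$, acting by the convolution formula. $\pi$ weakly contains $\lambda$ if $\|\lambda(f)\|\le\|\pi(f)\|$ for all $f$; $C^*_\pi(\mathcal G,\mathcal L)$ is the completion of $\Gamma_c(\mathcal G,\mathcal L)$ in the norm $\|f\|_\pi=\|\pi(f)\|$. $\mathrm{Ped}(A)$ denotes the Pedersen ideal of a $C^*$-algebra $A$ (the unique minimal norm-dense two-sided ideal), $\mathrm{Ped}(A)_+=\mathrm{Ped}(A)\cap A_+$; a linear functional on $\mathrm{Ped}(A)$ is called continuous if it is bounded on every $C^*$-subalgebra of $A$ contained in $\mathrm{Ped}(A)$. One has $\Gamma_c(\mathcal G,\mathcal L)\subseteq\mathrm{Ped}(C^*_\pi(\mathcal G,\mathcal L))$. A real Radon measure on $\mathcal G^0$ is a self-adjoint linear functional on $C_c(\mathcal G^0)$ continuous for the locally convex inductive limit topology (equivalently, a difference of positive Radon measures as functionals on $C_c(\mathcal G^0)$). It is $\mathcal G$-invariant if for every open bisection $U$ and $f\in C_c(r(U))$, $\int_{r(U)} f\,\mathrm d\mu=\int_{s(U)} f\circ\alpha_U\,\mathrm d\mu$, where $\alpha_U\colon s(U)\to r(U)$ is the homeomorphism $s(g)\mapsto r(g)$, $g\in U$. For such $\mu$, $\tau_\mu$ denotes the unique continuous self-adjoint tracial functional on $\mathrm{Ped}(C^*_\pi(\mathcal G,\mathcal L))$ satisfying $\tau_\mu(f)=\int_{\mathcal G^0}f|_{\mathcal G^0}\,\mathrm d\mu$ for all $f\in\Gamma_c(\mathcal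 G,\mathcal L)$ (such a functional exists and is unique). *)

theory Defs
  imports "HOL-Analysis.Analysis" "HOL-Algebra.FiniteProduct"
begin

section \<open>Complex Hilbert spaces and C*-algebras\<close>

class complex_normed_space = real_normed_vector +
  fixes scaleC :: "complex \<Rightarrow> 'a \<Rightarrow> 'a"
  assumes scaleR_eq_scaleC: "scaleR t x = scaleC (complex_of_real t) x"
    and scaleC_add_right: "scaleC c (x + y) = scaleC c x + scaleC c y"
    and scaleC_add_left: "scaleC (c + d) x = scaleC c x + scaleC d x"
    and scaleC_scaleC: "scaleC c (scaleC d x) = scaleC (c * d) x"
    and norm_scaleC: "norm (scaleC c x) = cmod c * norm x"

text \<open>The inner product is linear in the first variable.\<close>

class complex_hilbert_space = complex_normed_space + complete_space +
  fixes cinner :: "'a \<Rightarrow> 'a \<Rightarrow> complex"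
  assumes cinner_add_left: "cinner (x + y) z = cinner x z + cinner y z"
    and cinner_scaleC_left: "cinner (scaleC c x) y = c * cinner x y"
    and cinner_commute: "cinner x y = cnj (cinner y x)"
    and cinner_self: "cinner x x = complex_of_real ((norm x)\<^sup>2)"

text \<open>Submultiplicativity of the norm is part of \<open>real_normed_algebra\<close>;
  no unit is required.\<close>

class cstar_algebra = complex_normed_space + real_normed_algebra + complete_space +
  fixes star :: "'a \<Rightarrow> 'a"
  assumes scaleC_mult_left: "scaleC c x * y = scaleC c (x * y)"
    and scaleC_mult_right: "x * scaleC c y = scaleC c (x * y)"
    and star_add: "star (x + y) = star x + star y"
    and star_scaleC: "star (scaleC c x) = scaleC (cnj c) (star x)"
    and star_mult: "star (x * y) = star y * star x"
    and star_star: "star (star x) = x"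
    and cstar_identity: "norm (star x * x) = (norm x)\<^sup>2"

definition complex_subspace :: "'a::complex_normed_space set \<Rightarrow> bool" where
  "complex_subspace V \<longleftrightarrow>
     0 \<in> V \<and> (\<forall>x\<in>V. \<forall>y\<in>V. x + y \<in> V) \<and> (\<forall>c. \<forall>x\<in>V. scaleC c x \<in> V)"

definition two_sided_ideal :: "'a::cstar_algebra set \<Rightarrow> bool" where
  "two_sided_ideal I \<longleftrightarrow>
     complex_subspace I \<and> (\<forall>x\<in>I. \<forall>y. x * y \<in> I \<and> y * x \<in> I)"

definition cstar_subalgebra :: "'a::cstar_algebra set \<Rightarrow> bool" where
  "cstar_subalgebra B \<longleftrightarrow>
     complex_subspace B \<and> (\<forall>x\<in>B. \<forall>y\<in>B. x * y \<in> B) \<and> (\<forall>x\<in>B. star x \<in> B) \<and> closed B"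

definition cstar_positive :: "'a::cstar_algebra \<Rightarrow> bool" where
  "cstar_positive a \<longleftrightarrow> (\<exists>b. a = star b * b)"

text \<open>By Pedersen's theorem the intersection of all dense ideals is itself dense, so it is the
  unique minimal dense ideal.\<close>

definition Ped :: "'a::cstar_algebra set" where
  "Ped = \<Inter>{I. two_sided_ideal I \<and> closure I = UNIV}"

text \<open>Functionals on the Pedersen ideal are total functions of which only the values
  on \<^const>\<open>Ped\<close> matter.\<close>

definition ped_functional :: "('a::cstar_algebra \<Rightarrow> complex) \<Rightarrow> bool" where
  "ped_functional \<tau> \<longleftrightarrow>
     (\<forall>x\<in>Ped. \<forall>y\<in>Ped. \<tau> (x + y) = \<tau> x + \<tau> y) \<and> (\<forall>c. \<forall>x\<in>Ped. \<tau> (scaleC c x) = c * \<tau> x)"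

definition ped_continuous :: "('a::cstar_algebra \<Rightarrow> complex) \<Rightarrow> bool" where
  "ped_continuous \<tau> \<longleftrightarrow>
     (\<forall>B. cstar_subalgebra B \<and> B \<subseteq> Ped \<longrightarrow> (\<exists>C. \<forall>b\<in>B. cmod (\<tau> b) \<le> C * norm b))"

definition ped_self_adjoint :: "('a::cstar_algebra \<Rightarrow> complex) \<Rightarrow> bool" where
  "ped_self_adjoint \<tau> \<longleftrightarrow> (\<forall>x\<in>Ped. \<tau> (star x) = cnj (\<tau> x))"

definition ped_tracial :: "('a::cstar_algebra \<Rightarrow> complex) \<Rightarrow> bool" where
  "ped_tracial \<tau> \<longleftrightarrow> (\<forall>x\<in>Ped. \<forall>y\<in>Ped. \<tau> (x * y) = \<tau> (y * x))"


section \<open>Etale groupoids\<close>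

text \<open>The groupoid is the whole type \<open>'g\<close> of arrows, and units are identified with their
  identity arrows. The product \<open>gmul G g h\<close> is meaningful only if \<open>src G g = rng G h\<close>.\<close>

record 'g groupoid =
  src :: "'g \<Rightarrow> 'g"
  rng :: "'g \<Rightarrow> 'g"
  gmul :: "'g \<Rightarrow> 'g \<Rightarrow> 'g"
  ginv :: "'g \<Rightarrow> 'g"

definition unit_space :: "'g groupoid \<Rightarrow> 'g set" where
  "unit_space G = range (src G)"

locale groupoid =
  fixes G :: "'g groupoid"
  assumes src_src: "src G (src G g) = src G g"
    and rng_src: "rng G (src G g) = src G g"
    and src_rng: "src G (rng G g) = rng G g"
    and rng_rng: "rng G (rng G g) = rng G g"
    and src_gmul: "src G g = rng G h \<Longrightarrow> src G (gmul G g h) = src G h"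
    and rng_gmul: "src G g = rng G h \<Longrightarrow> rng G (gmul G g h) = rng G g"
    and gmul_assoc: "src G g = rng G h \<Longrightarrow> src G h = rng G k \<Longrightarrow>
      gmul G (gmul G g h) k = gmul G g (gmul G h k)"
    and gmul_rng: "gmul G (rng G g) g = g"
    and gmul_src: "gmul G g (src G g) = g"
    and src_ginv: "src G (ginv G g) = rng G g"
    and rng_ginv: "rng G (ginv G g) = src G g"
    and gmul_ginv_left: "gmul G (ginv G g) g = src G g"
    and gmul_ginv_right: "gmul G g (ginv G g) = rng G g"

text \<open>The Hausdorff assumption is in the sort of \<open>'g\<close>.\<close>

locale etale_groupoid = groupoid G for G :: "'g::t2_space groupoid" +
  assumes continuous_gmul:
      "continuous_on {(g, h). src G g = rng G h} (\<lambda>(g, h). gmul G g h)"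
    and continuous_ginv: "continuous_on UNIV (ginv G)"
    and rng_local_homeomorphism: "\<exists>U q. open U \<and> g \<in> U \<and>
      openin (top_of_set (unit_space G)) (rng G ` U) \<and> homeomorphism U (rng G ` U) (rng G) q"
    and locally_compact_unit_space: "locally_compact_space (top_of_set (unit_space G))"

definition open_bisection :: "'g::t2_space groupoid \<Rightarrow> 'g set \<Rightarrow> bool" where
  "open_bisection G U \<longleftrightarrow> open U \<and> inj_on (rng G) U \<and> inj_on (src G) U"

definition bisection_map :: "'g groupoid \<Rightarrow> 'g set \<Rightarrow> 'g \<Rightarrow> 'g" where
  "bisection_map G U x = rng G (the_inv_into U (src G) x)"


section \<open>Fell line bundles\<close>

text \<open>The total space is the whole type \<open>'l\<close>, the fibre over \<open>g\<close> is the preimage of \<open>g\<close>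
  under \<open>proj L\<close>, and \<open>lzero L g\<close> is its zero vector. Sums are meaningful only within a
  fibre, and \<open>lmul L a b\<close> only if \<open>proj L a\<close> and \<open>proj L b\<close> are composable.\<close>

record ('g, 'l) fell_bundle =
  proj :: "'l \<Rightarrow> 'g"
  ladd :: "'l \<Rightarrow> 'l \<Rightarrow> 'l"
  lzero :: "'g \<Rightarrow> 'l"
  lscale :: "complex \<Rightarrow> 'l \<Rightarrow> 'l"
  lnorm :: "'l \<Rightarrow> real"
  lmul :: "'l \<Rightarrow> 'l \<Rightarrow> 'l"
  lstar :: "'l \<Rightarrow> 'l"

text \<open>The axioms of a (continuous) Banach bundle in the sense of Fell and Doran, with
  one-dimensional fibres; completeness of the fibres is then automatic. The last assumption
  says that \<open>a\<^sub>i \<longlonglongrightarrow> lzero L g\<close> for every net with \<open>proj L a\<^sub>i \<longlonglongrightarrow> g\<close> and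
  \<open>lnorm L a\<^sub>i \<longlonglongrightarrow> 0\<close>.\<close>

locale banach_line_bundle =
  fixes L :: "('g::topological_space, 'l::topological_space) fell_bundle"
  assumes proj_lzero: "proj L (lzero L g) = g"
    and proj_ladd: "proj L a = proj L b \<Longrightarrow> proj L (ladd L a b) = proj L a"
    and proj_lscale: "proj L (lscale L c a) = proj L a"
    and ladd_commute: "proj L a = proj L b \<Longrightarrow> ladd L a b = ladd L b a"
    and ladd_assoc: "proj L a = proj L b \<Longrightarrow> proj L b = proj L d \<Longrightarrow>
      ladd L (ladd L a b) d = ladd L a (ladd L b d)"
    and ladd_lzero: "ladd L a (lzero L (proj L a)) = a"
    and ladd_inverse: "ladd L a (lscale L (- 1) a) = lzero L (proj L a)"
    and lscale_one: "lscale L 1 a = a"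
    and lscale_lscale: "lscale L c (lscale L c' a) = lscale L (c * c') a"
    and lscale_ladd_right: "proj L a = proj L b \<Longrightarrow>
      lscale L c (ladd L a b) = ladd L (lscale L c a) (lscale L c b)"
    and lscale_ladd_left: "lscale L (c + c') a = ladd L (lscale L c a) (lscale L c' a)"
    and one_dimensional: "\<exists>e. proj L e = g \<and> e \<noteq> lzero L g \<and>
      (\<forall>a. proj L a = g \<longrightarrow> (\<exists>c. a = lscale L c e))"
    and lnorm_eq_0: "lnorm L a = 0 \<longleftrightarrow> a = lzero L (proj L a)"
    and lnorm_lscale: "lnorm L (lscale L c a) = cmod c * lnorm L a"
    and lnorm_ladd: "proj L a = proj L b \<Longrightarrow> lnorm L (ladd L a b) \<le> lnorm L a + lnorm L b"
    and continuous_proj: "continuous_on UNIV (proj L)"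
    and open_proj: "open W \<Longrightarrow> open (proj L ` W)"
    and continuous_ladd: "continuous_on {(a, b). proj L a = proj L b} (\<lambda>(a, b). ladd L a b)"
    and continuous_lscale: "continuous_on UNIV (\<lambda>(c, a). lscale L c a)"
    and continuous_lnorm: "continuous_on UNIV (lnorm L)"
    and lzero_neighbourhood: "open W \<Longrightarrow> lzero L g \<in> W \<Longrightarrow>
      \<exists>V \<epsilon>. open V \<and> g \<in> V \<and> 0 < \<epsilon> \<and> {a. proj L a \<in> V \<and> lnorm L a < \<epsilon>} \<subseteq> W"

text \<open>The last assumption says that \<open>lmul L (lstar L a) a\<close> is positive in the C*-algebra
  given by the fibre over \<open>src G (proj L a)\<close>.\<close>

locale twisted_etale_groupoid =
  etale_groupoid G + banach_line_bundle L
  for G :: "'g::t2_space groupoid" and L :: "('g, 'l::topological_space) fell_bundle" +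
  assumes proj_lmul: "src G (proj L a) = rng G (proj L b) \<Longrightarrow>
      proj L (lmul L a b) = gmul G (proj L a) (proj L b)"
    and lmul_ladd_left: "proj L a = proj L a' \<Longrightarrow> src G (proj L a) = rng G (proj L b) \<Longrightarrow>
      lmul L (ladd L a a') b = ladd L (lmul L a b) (lmul L a' b)"
    and lmul_ladd_right: "proj L b = proj L b' \<Longrightarrow> src G (proj L a) = rng G (proj L b) \<Longrightarrow>
      lmul L a (ladd L b b') = ladd L (lmul L a b) (lmul L a b')"
    and lmul_lscale_left: "src G (proj L a) = rng G (proj L b) \<Longrightarrow>
      lmul L (lscale L c a) b = lscale L c (lmul L a b)"
    and lmul_lscale_right: "src G (proj L a) = rng G (proj L b) \<Longrightarrow>
      lmul L a (lscale L c b) = lscale L c (lmul L a b)"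
    and lmul_assoc: "src G (proj L a) = rng G (proj L b) \<Longrightarrow>
      src G (proj L b) = rng G (proj L d) \<Longrightarrow> lmul L (lmul L a b) d = lmul L a (lmul L b d)"
    and lnorm_lmul: "src G (proj L a) = rng G (proj L b) \<Longrightarrow>
      lnorm L (lmul L a b) \<le> lnorm L a * lnorm L b"
    and continuous_lmul: "continuous_on {(a, b). src G (proj L a) = rng G (proj L b)}
      (\<lambda>(a, b). lmul L a b)"
    and proj_lstar: "proj L (lstar L a) = ginv G (proj L a)"
    and lstar_ladd: "proj L a = proj L b \<Longrightarrow>
      lstar L (ladd L a b) = ladd L (lstar L a) (lstar L b)"
    and lstar_lscale: "lstar L (lscale L c a) = lscale L (cnj c) (lstar L a)"
    and lstar_lstar: "lstar L (lstar L a) = a"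
    and lstar_lmul: "src G (proj L a) = rng G (proj L b) \<Longrightarrow>
      lstar L (lmul L a b) = lmul L (lstar L b) (lstar L a)"
    and continuous_lstar: "continuous_on UNIV (lstar L)"
    and lnorm_lstar_lmul: "lnorm L (lmul L (lstar L a) a) = (lnorm L a)\<^sup>2"
    and lstar_lmul_positive:
      "\<exists>b. proj L b = src G (proj L a) \<and> lmul L (lstar L a) a = lmul L (lstar L b) b"

text \<open>The fibre over a unit \<open>x\<close> is a one-dimensional C*-algebra, hence it has a unit element
  \<open>fibre_one L x\<close> and is identified with the complex numbers via \<open>c \<mapsto> lscale L c (fibre_one L x)\<close>;
  \<open>fibre_coord L\<close> is the inverse of this identification.\<close>

definition fibre_one :: "('g, 'l) fell_bundle \<Rightarrow> 'g \<Rightarrow> 'l" where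
  "fibre_one L x = (THE e. proj L e = x \<and>
     (\<forall>a. proj L a = x \<longrightarrow> lmul L e a = a \<and> lmul L a e = a))"

definition fibre_coord :: "('g, 'l) fell_bundle \<Rightarrow> 'l \<Rightarrow> complex" where
  "fibre_coord L a = (THE c. a = lscale L c (fibre_one L (proj L a)))"


section \<open>The convolution algebra and its representations\<close>

definition Gamma_c :: "('g::topological_space, 'l::topological_space) fell_bundle \<Rightarrow> ('g \<Rightarrow> 'l) set"
  where "Gamma_c L = {f. (\<forall>g. proj L (f g) = g) \<and> continuous_on UNIV f \<and>
     compact (closure {g. f g \<noteq> lzero L g})}"

definition section_add :: "('g, 'l) fell_bundle \<Rightarrow> ('g \<Rightarrow> 'l) \<Rightarrow> ('g \<Rightarrow> 'l) \<Rightarrow> 'g \<Rightarrow> 'l" where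
  "section_add L f h g = ladd L (f g) (h g)"

definition section_scale :: "('g, 'l) fell_bundle \<Rightarrow> complex \<Rightarrow> ('g \<Rightarrow> 'l) \<Rightarrow> 'g \<Rightarrow> 'l" where
  "section_scale L c f g = lscale L c (f g)"

text \<open>The additive group of a fibre, in multiplicative notation, so that \<^const>\<open>finprod\<close> is the
  sum of finitely many vectors of the fibre.\<close>

definition fibre_group :: "('g, 'l) fell_bundle \<Rightarrow> 'g \<Rightarrow> 'l monoid" where
  "fibre_group L g = \<lparr>carrier = {a. proj L a = g}, monoid.mult = ladd L, one = lzero L g\<rparr>"

text \<open>The sum over all factorizations \<open>g = g\<^sub>1g\<^sub>2\<close>. Vanishing summands are left out to
  make the index set finite: if \<open>f\<close> is in \<open>Gamma_c L\<close>, only finitely many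
  summands are non-zero, for an arbitrary (not necessarily continuous) section \<open>h\<close>.\<close>

definition convolution ::
  "'g groupoid \<Rightarrow> ('g, 'l) fell_bundle \<Rightarrow> ('g \<Rightarrow> 'l) \<Rightarrow> ('g \<Rightarrow> 'l) \<Rightarrow> 'g \<Rightarrow> 'l" where
  "convolution G L f h g = finprod (fibre_group L g) (\<lambda>(g1, g2). lmul L (f g1) (h g2))
     {(g1, g2). src G g1 = rng G g2 \<and> gmul G g1 g2 = g \<and> lmul L (f g1) (h g2) \<noteq> lzero L g}"

definition section_star ::
  "'g groupoid \<Rightarrow> ('g, 'l) fell_bundle \<Rightarrow> ('g \<Rightarrow> 'l) \<Rightarrow> 'g \<Rightarrow> 'l" where
  "section_star G L f g = lstar L (f (ginv G g))"

text \<open>As the groupoid is the disjoint union of the sets of arrows with source \<open>x\<close>, over all units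
  \<open>x\<close>, the Hilbert space direct sum of the corresponding spaces of square-summable sections
  is the space of square-summable sections over the whole groupoid. The operator
  \<open>regular_rep G L f\<close> preserves the summands.\<close>

definition l2_sections :: "('g, 'l) fell_bundle \<Rightarrow> ('g \<Rightarrow> 'l) set" where
  "l2_sections L = {\<xi>. (\<forall>g. proj L (\<xi> g) = g) \<and> (\<lambda>g. (lnorm L (\<xi> g))\<^sup>2) summable_on UNIV}"

definition l2_section_norm :: "('g, 'l) fell_bundle \<Rightarrow> ('g \<Rightarrow> 'l) \<Rightarrow> real" where
  "l2_section_norm L \<xi> = sqrt (\<Sum>\<^sub>\<infinity>g. (lnorm L (\<xi> g))\<^sup>2)"

definition regular_rep ::
  "'g groupoid \<Rightarrow> ('g, 'l) fell_bundle \<Rightarrow> ('g \<Rightarrow> 'l) \<Rightarrow> ('g \<Rightarrow> 'l) \<Rightarrow> 'g \<Rightarrow> 'l" where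
  "regular_rep G L f \<xi> = convolution G L f \<xi>"

definition regular_rep_norm :: "'g groupoid \<Rightarrow> ('g, 'l) fell_bundle \<Rightarrow> ('g \<Rightarrow> 'l) \<Rightarrow> ennreal" where
  "regular_rep_norm G L f =
     (SUP \<xi>\<in>{\<xi>\<in>l2_sections L. l2_section_norm L \<xi> \<le> 1}.
        ennreal (l2_section_norm L (regular_rep G L f \<xi>)))"

definition star_representation ::
  "'g::t2_space groupoid \<Rightarrow> ('g, 'l::topological_space) fell_bundle \<Rightarrow>
   (('g \<Rightarrow> 'l) \<Rightarrow> 'h::complex_hilbert_space \<Rightarrow> 'h) \<Rightarrow> bool" where
  "star_representation G L \<pi> \<longleftrightarrow>
     (\<forall>f\<in>Gamma_c L. bounded_linear (\<pi> f) \<and> (\<forall>c v. \<pi> f (scaleC c v) = scaleC c (\<pi> f v))) \<and>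
     (\<forall>f\<in>Gamma_c L. \<forall>h\<in>Gamma_c L. \<forall>v. \<pi> (section_add L f h) v = \<pi> f v + \<pi> h v) \<and>
     (\<forall>c. \<forall>f\<in>Gamma_c L. \<forall>v. \<pi> (section_scale L c f) v = scaleC c (\<pi> f v)) \<and>
     (\<forall>f\<in>Gamma_c L. \<forall>h\<in>Gamma_c L. \<forall>v. \<pi> (convolution G L f h) v = \<pi> f (\<pi> h v)) \<and>
     (\<forall>f\<in>Gamma_c L. \<forall>v w. cinner (\<pi> (section_star G L f) v) w = cinner v (\<pi> f w))"

definition weakly_contains_regular ::
  "'g::t2_space groupoid \<Rightarrow> ('g, 'l::topological_space) fell_bundle \<Rightarrow>
   (('g \<Rightarrow> 'l) \<Rightarrow> 'h::complex_hilbert_space \<Rightarrow> 'h) \<Rightarrow> bool" where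
  "weakly_contains_regular G L \<pi> \<longleftrightarrow>
     (\<forall>f\<in>Gamma_c L. regular_rep_norm G L f \<le> ennreal (onorm (\<pi> f)))"

text \<open>The C*-algebra \<open>'a\<close>, together with the canonical map \<open>\<iota>\<close>, is a completion of the
  *-algebra \<open>Gamma_c L\<close> in the norm \<open>f \<mapsto> onorm (\<pi> f)\<close>.\<close>

definition cstar_completion ::
  "'g::t2_space groupoid \<Rightarrow> ('g, 'l::topological_space) fell_bundle \<Rightarrow>
   (('g \<Rightarrow> 'l) \<Rightarrow> 'h::complex_hilbert_space \<Rightarrow> 'h) \<Rightarrow>
   (('g \<Rightarrow> 'l) \<Rightarrow> 'a::cstar_algebra) \<Rightarrow> bool" where
  "cstar_completion G L \<pi> \<iota> \<longleftrightarrow>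
     (\<forall>f\<in>Gamma_c L. \<forall>h\<in>Gamma_c L. \<iota> (section_add L f h) = \<iota> f + \<iota> h) \<and>
     (\<forall>c. \<forall>f\<in>Gamma_c L. \<iota> (section_scale L c f) = scaleC c (\<iota> f)) \<and>
     (\<forall>f\<in>Gamma_c L. \<forall>h\<in>Gamma_c L. \<iota> (convolution G L f h) = \<iota> f * \<iota> h) \<and>
     (\<forall>f\<in>Gamma_c L. \<iota> (section_star G L f) = star (\<iota> f)) \<and>
     (\<forall>f\<in>Gamma_c L. norm (\<iota> f) = onorm (\<pi> f)) \<and>
     closure (\<iota> ` Gamma_c L) = UNIV"


section \<open>Real Radon measures and the associated traces\<close>

text \<open>Functions on \<open>X\<close> are extended by zero to the whole type. In particular \<open>Cc Y \<subseteq> Cc X\<close> if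
  \<open>Y\<close> is a relatively open subset of \<open>X\<close> (and \<open>X\<close> is Hausdorff).\<close>

definition Cc :: "'g::topological_space set \<Rightarrow> ('g \<Rightarrow> complex) set" where
  "Cc X = {f. continuous_on X f \<and> (\<exists>K. compact K \<and> K \<subseteq> X \<and> (\<forall>x. x \<notin> K \<longrightarrow> f x = 0))}"

text \<open>The number \<open>\<mu> f\<close> is the integral of \<open>f\<close>. A linear functional is continuous for the locally
  convex inductive limit topology iff for each compact \<open>K\<close> its restriction to the
  functions supported in \<open>K\<close> is bounded with respect to the supremum norm.\<close>

definition real_radon_measure :: "'g::topological_space set \<Rightarrow> (('g \<Rightarrow> complex) \<Rightarrow> complex) \<Rightarrow> bool"
  where "real_radon_measure X \<mu> \<longleftrightarrow>
     (\<forall>f\<in>Cc X. \<forall>h\<in>Cc X. \<mu> (\<lambda>x. f x + h x) = \<mu> f + \<mu> h) \<and>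
     (\<forall>c. \<forall>f\<in>Cc X. \<mu> (\<lambda>x. c * f x) = c * \<mu> f) \<and>
     (\<forall>f\<in>Cc X. \<mu> (\<lambda>x. cnj (f x)) = cnj (\<mu> f)) \<and>
     (\<forall>K. compact K \<and> K \<subseteq> X \<longrightarrow>
        (\<exists>C. \<forall>f\<in>Cc X. (\<forall>x. x \<notin> K \<longrightarrow> f x = 0) \<longrightarrow> cmod (\<mu> f) \<le> C * (SUP x. cmod (f x))))"

definition invariant_measure ::
  "'g::t2_space groupoid \<Rightarrow> (('g \<Rightarrow> complex) \<Rightarrow> complex) \<Rightarrow> bool" where
  "invariant_measure G \<mu> \<longleftrightarrow>
     (\<forall>U. open_bisection G U \<longrightarrow> (\<forall>f\<in>Cc (rng G ` U).
        \<mu> f = \<mu> (\<lambda>x. if x \<in> src G ` U then f (bisection_map G U x) else 0)))"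

definition unit_restriction ::
  "'g groupoid \<Rightarrow> ('g, 'l) fell_bundle \<Rightarrow> ('g \<Rightarrow> 'l) \<Rightarrow> 'g \<Rightarrow> complex" where
  "unit_restriction G L f x = (if x \<in> unit_space G then fibre_coord L (f x) else 0)"

text \<open>This says that \<open>\<tau>\<close> is the trace \<open>\<tau>\<^sub>\<mu>\<close>, which \<open>\<mu>\<close> determines uniquely on \<^const>\<open>Ped\<close>.\<close>

definition is_trace_of_measure ::
  "'g::t2_space groupoid \<Rightarrow> ('g, 'l::topological_space) fell_bundle \<Rightarrow>
   (('g \<Rightarrow> 'l) \<Rightarrow> 'a::cstar_algebra) \<Rightarrow> (('g \<Rightarrow> complex) \<Rightarrow> complex) \<Rightarrow> ('a \<Rightarrow> complex) \<Rightarrow> bool" where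
  "is_trace_of_measure G L \<iota> \<mu> \<tau> \<longleftrightarrow>
     ped_functional \<tau> \<and> ped_continuous \<tau> \<and> ped_self_adjoint \<tau> \<and> ped_tracial \<tau> \<and>
     (\<forall>f\<in>Gamma_c L. \<tau> (\<iota> f) = \<mu> (unit_restriction G L f))"

end

theory Submission
  imports Defs
begin

text \<open>Let \<open>e\<close> range over the real functions in \<open>C\<^sub>c(G\<^sup>0)\<close>. They act as local units on a dense
  subset of the completion \<open>A\<close>, so the finite sums \<open>\<Sum> x\<^sub>i\<^sup>*y\<^sub>i\<close> with \<open>e x\<^sub>i = x\<^sub>i\<close> and \<open>e y\<^sub>i = y\<^sub>i\<close> for
  some \<open>e\<close> form a dense ideal, which contains \<open>Ped\<close>. If such a sum \<open>a\<close> is positive, then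
  \<open>2a \<le> \<Sum> (x\<^sub>i\<^sup>*x\<^sub>i + y\<^sub>i\<^sup>*y\<^sub>i)\<close>, and Pedersen's Riesz decomposition gives \<open>a = \<Sum> z\<^sub>i\<^sup>*z\<^sub>i\<close> with
  \<open>e z\<^sub>i = z\<^sub>i\<close>. Hence \<open>\<tau>(a) = \<Sum> \<tau>(z\<^sub>iz\<^sub>i\<^sup>*)\<close>, where \<open>z\<^sub>iz\<^sub>i\<^sup>*\<close> lies in a C*-algebra contained in
  \<open>Ped\<close>. On it \<open>\<tau>\<close> is norm continuous and therefore equals \<open>\<mu> \<circ> E\<close>, where \<open>E\<close>, the continuous
  extension of the restriction of sections to the unit space, exists by weak containment of the
  regular representation. So \<open>f = \<Sum> E(z\<^sub>iz\<^sub>i\<^sup>*)\<close>. Positivity in \<open>A\<close> is tested in the faithful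
  representation that extends \<open>\<pi>\<close>.\<close>

section \<open>Square roots in C*-algebras\<close>

text \<open>The obvious candidate \<open>E(a)\<close> fails because its support need not be compact.
  For the pair groupoid on a countable discrete set with trivial twist and the regular
  representation, \<open>A\<close> consists of the compact operators, \<open>Ped\<close> of the
  finite-rank ones, and the diagonal of a rank-one projection can have infinite support. Passing
  from \<open>star z * z\<close> to \<open>z * star z\<close> repairs this. The local unit acts on
  \<open>z\<close> from the left only, hence on \<open>z * star z\<close> from both sides; this
  confines the support of \<open>E\<close> to one compact set. The factors \<open>z\<close> depend
  on \<open>a\<close> alone, so one \<open>f\<close> serves all measures. A plain factorization
  \<open>a = star b * b\<close> does not suffice, since nothing is known about a left unit for
  \<open>b\<close>. The factors in the Riesz decomposition are limits of products that begin with
  some \<open>b\<^sub>i\<close>, and therefore inherit its left unit. The decomposition calls for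
  inverse square roots, but \<open>A\<close> has no unit. They are replaced by maps on
  \<open>A\<close> that imitate left multiplication by elements of the unitization, and norm
  estimates return to \<open>A\<close> through the C*-identity or the isometric
  representation.\<close>

instance cstar_algebra \<subseteq> banach ..

lemma star_zero [simp]: "star (0::'a::cstar_algebra) = 0"
  using star_add[of "0::'a" 0] by simp

lemma star_minus [simp]: "star (- x) = - star (x::'a::cstar_algebra)"
  using star_add[of x "- x"] by (simp add: eq_neg_iff_add_eq_0 add.commute)

lemma star_diff: "star (x - y) = star x - star (y::'a::cstar_algebra)"
  using star_add[of x "- y"] by simp

lemma star_scaleR: "star (r *\<^sub>R x) = r *\<^sub>R star (x::'a::cstar_algebra)"
  by (simp add: scaleR_eq_scaleC star_scaleC)

lemma star_sum: "star (sum f I) = (\<Sum>i\<in>I. star (f i :: 'a::cstar_algebra))"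
  by (induction I rule: infinite_finite_induct) (auto simp: star_add)

lemma norm_star [simp]: "norm (star x) = norm (x::'a::cstar_algebra)"
proof -
  have le: "norm y \<le> norm (star y)" for y :: 'a
  proof (cases "y = 0")
    case False
    have "norm y * norm y \<le> norm (star y) * norm y"
      using norm_mult_ineq[of "star y" y] by (simp add: cstar_identity power2_eq_square)
    then show ?thesis using False by simp
  qed simp
  show ?thesis using le[of x] le[of "star x"] by (simp add: star_star)
qed

lemma bounded_linear_star: "bounded_linear (star :: 'a::cstar_algebra \<Rightarrow> 'a)"
  by (rule bounded_linear_intro[where K=1]) (auto simp: star_add star_scaleR)

lemmas tendsto_star = bounded_linear.tendsto[OF bounded_linear_star]

text \<open>Take \<open>x = star y\<close> and use the C*-identity. Estimates for left
  multiplication operators thereby become norm estimates without a unit.\<close>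

lemma norm_le_if_left_mult_le:
  fixes y :: "'a::cstar_algebra"
  assumes "\<And>x. norm (y * x) \<le> C * norm x" and "0 \<le> C"
  shows "norm y \<le> C"
proof (cases "y = 0")
  case False
  have "norm y * norm y = norm (y * star y)"
    using cstar_identity[of "star y"] by (simp add: star_star power2_eq_square)
  also have "\<dots> \<le> C * norm y" using assms(1)[of "star y"] by simp
  finally show ?thesis using False by simp
qed (simp add: assms)

text \<open>Newton's iteration \<open>y\<^sub>n\<^sub>+\<^sub>1 = (1 - b + y\<^sub>n\<^sup>2) / 2\<close> for \<open>1 - sqrt b\<close> lives in the unitization. Evaluated
  at \<open>b = 0\<close> it gives the scalars \<open>sqrt_scalar n\<close>, and \<open>sqrt_approx b n = sqrt_scalar n - y\<^sub>n\<close> has no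
  constant term.\<close>

primrec sqrt_scalar :: "nat \<Rightarrow> real" where
  "sqrt_scalar 0 = 0"
| "sqrt_scalar (Suc n) = (1 + (sqrt_scalar n)\<^sup>2) / 2"

primrec sqrt_approx :: "'a::cstar_algebra \<Rightarrow> nat \<Rightarrow> 'a" where
  "sqrt_approx b 0 = 0"
| "sqrt_approx b (Suc n) = (1/2) *\<^sub>R b + sqrt_scalar n *\<^sub>R sqrt_approx b n
     - (1/2) *\<^sub>R (sqrt_approx b n * sqrt_approx b n)"

text \<open>Left multiplication by \<open>b\<^sup>-\<^sup>1 sqrt_approx b n\<close>, a polynomial in \<open>b\<close>.\<close>

primrec inv_sqrt_approx :: "'a::cstar_algebra \<Rightarrow> nat \<Rightarrow> 'a \<Rightarrow> 'a" where
  "inv_sqrt_approx b 0 x = 0"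
| "inv_sqrt_approx b (Suc n) x = (1/2) *\<^sub>R x + sqrt_scalar n *\<^sub>R inv_sqrt_approx b n x
     - (1/2) *\<^sub>R (sqrt_approx b n * inv_sqrt_approx b n x)"

lemma sqrt_scalar_bounds: "0 \<le> sqrt_scalar n" "sqrt_scalar n \<le> 1"
proof (induction n)
  case (Suc n)
  have "(sqrt_scalar n)\<^sup>2 \<le> 1" using Suc by (simp add: abs_square_le_1)
  then show "0 \<le> sqrt_scalar (Suc n)" "sqrt_scalar (Suc n) \<le> 1" by auto
qed auto

text \<open>The increment is \<open>(1 - sqrt_scalar n)\<^sup>2 / 2\<close>.\<close>

lemma sqrt_scalar_mono: "sqrt_scalar n \<le> sqrt_scalar (Suc n)"
  using zero_le_power2[of "1 - sqrt_scalar n"] by (simp add: power2_eq_square algebra_simps)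

lemma sqrt_scalar_tendsto: "sqrt_scalar \<longlonglongrightarrow> 1"
proof -
  have "incseq sqrt_scalar" by (rule incseq_SucI) (rule sqrt_scalar_mono)
  then obtain T where T: "sqrt_scalar \<longlonglongrightarrow> T"
    using incseq_convergent[of sqrt_scalar 1] sqrt_scalar_bounds by blast
  then have "(\<lambda>n. (1 + (sqrt_scalar n)\<^sup>2) / 2) \<longlonglongrightarrow> (1 + T\<^sup>2) / 2" by (intro tendsto_intros) auto
  moreover have "(\<lambda>n. sqrt_scalar (Suc n)) \<longlonglongrightarrow> T" using T by (rule LIMSEQ_Suc)
  ultimately have "T = (1 + T\<^sup>2) / 2" using LIMSEQ_unique by fastforce
  then have "(T - 1)\<^sup>2 = 0" by (simp add: power2_eq_square algebra_simps)
  with T show ?thesis by simp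
qed

lemma sqrt_approx_commute: "y * b = b * y \<Longrightarrow> y * sqrt_approx b n = sqrt_approx b n * y"
proof (induction n)
  case (Suc n)
  have "y * (sqrt_approx b n * sqrt_approx b n) = (sqrt_approx b n * sqrt_approx b n) * y"
    using Suc by (metis mult.assoc)
  then show ?case using Suc by (simp add: algebra_simps)
qed simp

lemma star_sqrt_approx: "star b = b \<Longrightarrow> star (sqrt_approx b n) = sqrt_approx b n"
  by (induction n) (auto simp: star_add star_diff star_scaleR star_mult)

lemma inv_sqrt_approx_self: "inv_sqrt_approx b n b = sqrt_approx b n"
  by (induction n) auto

lemma inv_sqrt_approx_mult: "inv_sqrt_approx b n (x * y) = inv_sqrt_approx b n x * y"
  by (induction n) (auto simp: algebra_simps)

lemma inv_sqrt_approx_scaleR: "inv_sqrt_approx b n (r *\<^sub>R x) = r *\<^sub>R inv_sqrt_approx b n x"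
  by (induction n) (auto simp: algebra_simps)

lemma inv_sqrt_approx_commute:
  assumes "y * b = b * y"
  shows "inv_sqrt_approx b n (y * x) = y * inv_sqrt_approx b n x"
proof (induction n)
  case (Suc n)
  have "sqrt_approx b n * (y * inv_sqrt_approx b n x) = y * (sqrt_approx b n * inv_sqrt_approx b n x)"
    using sqrt_approx_commute[OF assms, of n] by (metis mult.assoc)
  then show ?case using Suc by (simp add: algebra_simps)
qed simp

lemma star_inv_sqrt_approx:
  assumes "star b = b" and "star y = y" and "y * b = b * y"
  shows "star (inv_sqrt_approx b n y) = inv_sqrt_approx b n y"
proof (induction n)
  case (Suc n)
  have "inv_sqrt_approx b n y * sqrt_approx b n = sqrt_approx b n * inv_sqrt_approx b n y"
    by (metis assms(3) inv_sqrt_approx_commute inv_sqrt_approx_mult sqrt_approx_commute)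
  then show ?case using Suc assms by (simp add: star_add star_diff star_scaleR star_mult star_sqrt_approx)
qed simp

text \<open>The hypothesis says that \<open>1 - b\<close> acts as a contraction. The scalar
  recursion replaces \<open>1 - b\<close> by 1, so it majorizes both the iterates and their
  increments, and the increments of a convergent scalar sequence are summable by
  telescoping.\<close>

lemma sqrt_approx_convergent:
  fixes b :: "'a::cstar_algebra"
  assumes b: "\<And>x. norm (x - b * x) \<le> norm x"
  shows "convergent (sqrt_approx b)"
proof -
  define t where "t = sqrt_scalar"
  define s where "s = sqrt_approx b"
  \<comment> \<open>Left multiplication by the iterate for \<open>1 - sqrt b\<close>, which lies in
    the unitization and not in \<open>'a\<close>.\<close>
  define Y where "Y n x = t n *\<^sub>R x - s n * x" for n and x :: 'a
  define \<delta> where "\<delta> n = t (Suc n) - t n" for n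
  have Y_Suc: "Y (Suc n) x = (1/2) *\<^sub>R ((x - b * x) + Y n (Y n x))" for n x
    by (simp add: Y_def t_def s_def algebra_simps power2_eq_square add_divide_distrib
        flip: scaleR_add_left)
  have Y_diff: "Y n x - Y n y = Y n (x - y)" for n x y
    by (simp add: Y_def algebra_simps)
  have t0: "0 \<le> t n" and \<delta>0: "0 \<le> \<delta> n" for n
    using sqrt_scalar_bounds sqrt_scalar_mono by (auto simp: t_def \<delta>_def)
  have Y_bound: "norm (Y n x) \<le> t n * norm x" for n x
  proof (induction n arbitrary: x)
    case (Suc n)
    have "norm (Y n (Y n x)) \<le> t n * (t n * norm x)"
      using Suc[of "Y n x"] Suc[of x] t0[of n] by (meson mult_left_mono order_trans)
    then have "norm ((x - b * x) + Y n (Y n x)) \<le> norm x + t n * (t n * norm x)"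
      using b[of x] norm_triangle_ineq[of "x - b * x" "Y n (Y n x)"] by linarith
    then show ?case unfolding Y_Suc norm_scaleR by (simp add: t_def power2_eq_square distrib_right mult.assoc)
  qed (simp add: Y_def t_def s_def)
  have Y_step: "norm (Y (Suc n) x - Y n x) \<le> \<delta> n * norm x" for n x
  proof (induction n arbitrary: x)
    case 0
    show ?case using Y_bound[of "Suc 0" x] by (simp add: Y_def \<delta>_def t_def s_def)
  next
    case (Suc n)
    \<comment> \<open>The terms \<open>x - b * x\<close> cancel, and the difference of squares is
      split as \<open>p\<^sup>2 - q\<^sup>2 = p (p - q) + (p - q) q\<close>.\<close>
    have eq: "Y (Suc (Suc n)) x - Y (Suc n) x
        = (1/2) *\<^sub>R (Y (Suc n) (Y (Suc n) x - Y n x) + (Y (Suc n) (Y n x) - Y n (Y n x)))"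
      unfolding Y_diff[symmetric] Y_Suc[of "Suc n" x] by (subst (3) Y_Suc) (simp add: algebra_simps)
    have "norm (Y (Suc n) (Y (Suc n) x - Y n x)) \<le> t (Suc n) * (\<delta> n * norm x)"
      using Y_bound[of "Suc n" "Y (Suc n) x - Y n x"] Suc[of x] t0[of "Suc n"]
      by (meson mult_left_mono order_trans)
    moreover have "norm (Y (Suc n) (Y n x) - Y n (Y n x)) \<le> \<delta> n * (t n * norm x)"
      using Suc[of "Y n x"] Y_bound[of n x] \<delta>0[of n] by (meson mult_left_mono order_trans)
    ultimately have "norm (Y (Suc (Suc n)) x - Y (Suc n) x)
        \<le> (1/2) * (t (Suc n) * (\<delta> n * norm x) + \<delta> n * (t n * norm x))"
      unfolding eq norm_scaleR
      using norm_triangle_ineq[of "Y (Suc n) (Y (Suc n) x - Y n x)" "Y (Suc n) (Y n x) - Y n (Y n x)"]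
      by simp
    also have "\<dots> = (((t (Suc n))\<^sup>2 - (t n)\<^sup>2) / 2) * norm x"
      by (simp add: \<delta>_def power2_eq_square field_simps)
    also have "((t (Suc n))\<^sup>2 - (t n)\<^sup>2) / 2 = \<delta> (Suc n)"
      by (simp add: \<delta>_def t_def field_simps)
    finally show ?case .
  qed
  have s_step: "norm (s (Suc n) - s n) \<le> 2 * \<delta> n" for n
  proof (rule norm_le_if_left_mult_le)
    fix x :: 'a
    \<comment> \<open>The scalar part and the increment of \<open>Y\<close> each contribute
      \<open>\<delta> n\<close>, whence the factor 2.\<close>
    have "(s (Suc n) - s n) * x = \<delta> n *\<^sub>R x - (Y (Suc n) x - Y n x)"
      by (simp add: Y_def \<delta>_def algebra_simps)
    also have "norm \<dots> \<le> \<delta> n * norm x + norm (Y (Suc n) x - Y n x)"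
      using norm_triangle_ineq4[of "\<delta> n *\<^sub>R x"] \<delta>0[of n] by (metis abs_of_nonneg norm_scaleR)
    finally show "norm ((s (Suc n) - s n) * x) \<le> 2 * \<delta> n * norm x" using Y_step[of n x] by simp
  qed (use \<delta>0[of n] in simp)
  have "summable \<delta>"
    using telescope_summable[OF sqrt_scalar_tendsto] unfolding \<delta>_def t_def .
  then have "summable (\<lambda>n. 2 * \<delta> n)" by (rule summable_mult)
  then have "summable (\<lambda>n. s (Suc n) - s n)"
    by (rule summable_comparison_test'[where N=0]) (rule s_step)
  then have "convergent (\<lambda>n. \<Sum>i<n. s (Suc i) - s i)" by (simp add: summable_iff_convergent)
  moreover have "(\<Sum>i<n. s (Suc i) - s i) = s n" for n
    by (simp add: sum_lessThan_telescope) (simp add: s_def)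
  ultimately show ?thesis by (simp add: s_def)
qed

text \<open>The maps \<open>Q n\<close> stand for left multiplication by elements of the unitization that behave like
  \<open>b\<^sup>-\<^sup>1\<^sup>/\<^sup>2\<close>.\<close>

lemma sqrt_exists:
  fixes b :: "'a::cstar_algebra"
  assumes sa: "star b = b" and t: "t > 0" and b: "\<And>x. norm (x - (t *\<^sub>R b) * x) \<le> norm x"
  obtains s :: 'a and Q :: "nat \<Rightarrow> 'a \<Rightarrow> 'a" where "s * s = b" and "star s = s"
    and "\<And>n x y. Q n (x * y) = Q n x * y" and "\<And>n x. Q n (s * x) = s * Q n x"
    and "\<And>n. star (Q n s) = Q n s" and "(\<lambda>n. Q n b) \<longlonglongrightarrow> s"
proof -
  let ?b = "t *\<^sub>R b"
  have sa': "star ?b = ?b" by (simp add: star_scaleR sa)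
  obtain s where s: "sqrt_approx ?b \<longlonglongrightarrow> s"
    using sqrt_approx_convergent[OF b] by (auto simp: convergent_def)
  \<comment> \<open>As the scalars tend to 1, the linear term of the limit equation is exactly
    \<open>s\<close>; it cancels and leaves \<open>s * s = ?b\<close>.\<close>
  have "(\<lambda>n. sqrt_approx ?b (Suc n)) \<longlonglongrightarrow> (1/2) *\<^sub>R ?b + 1 *\<^sub>R s - (1/2) *\<^sub>R (s * s)"
    unfolding sqrt_approx.simps by (intro tendsto_intros s sqrt_scalar_tendsto)
  then have "s = (1/2) *\<^sub>R ?b + 1 *\<^sub>R s - (1/2) *\<^sub>R (s * s)"
    using LIMSEQ_Suc[OF s] LIMSEQ_unique by blast
  then have "(1/2) *\<^sub>R ?b = (1/2) *\<^sub>R (s * s)" by simp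
  then have ss: "s * s = ?b" by (metis scaleR_cancel_left zero_neq_numeral divide_eq_0_iff zero_neq_one)
  have star_s: "star s = s"
    using tendsto_star[OF s] s by (simp add: star_sqrt_approx[OF sa'] LIMSEQ_unique)
  have comm: "s * ?b = ?b * s" by (simp add: mult.assoc flip: ss)
  define r where "r = sqrt t"
  have r: "r > 0" "r * r = t" using t by (auto simp: r_def)
  \<comment> \<open>Formally \<open>inv_sqrt_approx ?b n\<close> approaches the inverse root of
    \<open>t b\<close>, which is \<open>1 / r\<close> times that of \<open>b\<close>; the factor
    \<open>r\<close> undoes the scaling.\<close>
  define Q where "Q n x = r *\<^sub>R inv_sqrt_approx ?b n x" for n x
  show ?thesis
  proof (rule that[of "(1/r) *\<^sub>R s" Q])
    show "(1/r) *\<^sub>R s * (1/r) *\<^sub>R s = b" using r t ss by simp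
    show "star ((1/r) *\<^sub>R s) = (1/r) *\<^sub>R s" by (simp add: star_scaleR star_s)
    show "Q n (x * y) = Q n x * y" for n x y
      by (simp add: Q_def inv_sqrt_approx_mult)
    show "Q n ((1/r) *\<^sub>R s * x) = (1/r) *\<^sub>R s * Q n x" for n x
      by (simp add: Q_def inv_sqrt_approx_scaleR inv_sqrt_approx_commute[OF comm])
    show "star (Q n ((1/r) *\<^sub>R s)) = Q n ((1/r) *\<^sub>R s)" for n
      by (simp add: Q_def inv_sqrt_approx_scaleR star_scaleR star_inv_sqrt_approx[OF sa' star_s comm])
    have "Q n b = (1/r) *\<^sub>R sqrt_approx ?b n" for n
    proof -
      have "Q n b = Q n ((1/t) *\<^sub>R ?b)" using t by simp
      also have "\<dots> = (r / t) *\<^sub>R inv_sqrt_approx ?b n ?b"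
        unfolding Q_def inv_sqrt_approx_scaleR by simp
      also have "r / t = 1 / r" using r t by (simp add: field_simps)
      finally show ?thesis by (simp add: inv_sqrt_approx_self)
    qed
    then show "(\<lambda>n. Q n b) \<longlonglongrightarrow> (1/r) *\<^sub>R s" by (simp add: s tendsto_scaleR)
  qed
qed

section \<open>Positive elements and faithful representations\<close>

lemma cinner_add_right: "cinner x (y + z) = cinner x y + cinner (x::'a::complex_hilbert_space) z"
  by (metis cinner_add_left cinner_commute complex_cnj_add)

lemma cinner_scaleC_right: "cinner x (scaleC c y) = cnj c * cinner (x::'a::complex_hilbert_space) y"
  by (metis cinner_commute cinner_scaleC_left complex_cnj_cnj complex_cnj_mult)

lemma cinner_scaleR_left: "cinner (r *\<^sub>R x) y = r * cinner (x::'a::complex_hilbert_space) y"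
  by (simp add: scaleR_eq_scaleC cinner_scaleC_left)

lemma cinner_scaleR_right: "cinner x (r *\<^sub>R y) = r * cinner (x::'a::complex_hilbert_space) y"
  by (simp add: scaleR_eq_scaleC cinner_scaleC_right)

lemma cinner_zero_left [simp]: "cinner 0 (y::'a::complex_hilbert_space) = 0"
  using cinner_add_left[of 0 0 y] by simp

lemma cinner_zero_right [simp]: "cinner (x::'a::complex_hilbert_space) 0 = 0"
  using cinner_add_right[of x 0 0] by simp

lemma cinner_minus_left [simp]: "cinner (- x) y = - cinner (x::'a::complex_hilbert_space) y"
  using cinner_add_left[of x "- x" y] by (simp add: eq_neg_iff_add_eq_0 add.commute)

lemma cinner_minus_right [simp]: "cinner x (- y) = - cinner (x::'a::complex_hilbert_space) y"
  using cinner_add_right[of x y "- y"] by (simp add: eq_neg_iff_add_eq_0 add.commute)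

lemma cinner_diff_left: "cinner (x - y) z = cinner x z - cinner (y::'a::complex_hilbert_space) z"
  using cinner_add_left[of x "- y" z] by simp

lemma cinner_diff_right: "cinner x (y - z) = cinner x y - cinner (x::'a::complex_hilbert_space) z"
  using cinner_add_right[of x y "- z"] by simp

lemma Re_cinner_commute: "Re (cinner y x) = Re (cinner x (y::'a::complex_hilbert_space))"
  by (subst cinner_commute) simp

lemma norm_add_squared:
  "(norm (x + y))\<^sup>2 = (norm x)\<^sup>2 + 2 * Re (cinner x y) + (norm (y::'a::complex_hilbert_space))\<^sup>2"
proof -
  have "complex_of_real ((norm (x + y))\<^sup>2) = cinner x x + cinner x y + cinner y x + cinner y y"
    by (simp only: cinner_add_left cinner_add_right ac_simps flip: cinner_self)
  then have "(norm (x + y))\<^sup>2 = Re (cinner x x + cinner x y + cinner y x + cinner y y)"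
    by (metis Re_complex_of_real)
  then show ?thesis by (simp add: cinner_self Re_cinner_commute[of y x])
qed

lemma norm_diff_squared:
  "(norm (x - y))\<^sup>2 = (norm x)\<^sup>2 - 2 * Re (cinner x y) + (norm (y::'a::complex_hilbert_space))\<^sup>2"
  using norm_add_squared[of x "- y"] by simp

text \<open>The triangle inequality is an axiom of the norm here, so this is just the expansion of
  \<open>(norm (x + y))\<^sup>2\<close>.\<close>

lemma Re_cinner_le: "Re (cinner x y) \<le> norm x * norm (y::'a::complex_hilbert_space)"
proof -
  have "(norm (x + y))\<^sup>2 \<le> (norm x + norm y)\<^sup>2" by (simp add: norm_triangle_ineq power_mono)
  then show ?thesis unfolding norm_add_squared by (simp add: power2_sum)
qed

text \<open>Faithfulness is stated as isometry: \<open>norm_rep_le\<close> and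
  \<open>norm_le_rep\<close> together make \<open>norm x\<close> the operator norm. This turns
  comparisons of vectors, in particular of the quadratic forms
  \<open>Re (cinner (\<rho> b v) v)\<close> that serve as the order, into norm estimates in
  \<open>'a\<close>.\<close>

locale faithful_representation =
  fixes \<rho> :: "'a::cstar_algebra \<Rightarrow> 'h::complex_hilbert_space \<Rightarrow> 'h"
  assumes rep_add: "\<rho> (x + y) v = \<rho> x v + \<rho> y v"
    and rep_scaleR: "\<rho> (r *\<^sub>R x) v = r *\<^sub>R \<rho> x v"
    and rep_add_vec: "\<rho> x (v + w) = \<rho> x v + \<rho> x w"
    and rep_mult: "\<rho> (x * y) v = \<rho> x (\<rho> y v)"
    and rep_star: "cinner (\<rho> (star x) v) w = cinner v (\<rho> x w)"
    and norm_rep_le: "norm (\<rho> x v) \<le> norm x * norm v"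
    and norm_le_rep: "0 \<le> C \<Longrightarrow> (\<And>v. norm (\<rho> x v) \<le> C * norm v) \<Longrightarrow> norm x \<le> C"
begin

lemma rep_zero [simp]: "\<rho> 0 v = 0"
  using rep_add[of 0 0 v] by simp

lemma rep_minus [simp]: "\<rho> (- x) v = - \<rho> x v"
  using rep_add[of x "- x" v] by (simp add: eq_neg_iff_add_eq_0 add.commute)

lemma rep_diff: "\<rho> (x - y) v = \<rho> x v - \<rho> y v"
  using rep_add[of x "- y" v] by simp

lemma rep_zero_vec [simp]: "\<rho> x 0 = 0"
  using rep_add_vec[of x 0 0] by simp

lemma rep_minus_vec [simp]: "\<rho> x (- v) = - \<rho> x v"
  using rep_add_vec[of x v "- v"] by (simp add: eq_neg_iff_add_eq_0 add.commute)

lemma rep_diff_vec: "\<rho> x (v - w) = \<rho> x v - \<rho> x w"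
  using rep_add_vec[of x v "- w"] by simp

lemma Re_cinner_rep_star_mult: "Re (cinner (\<rho> (star x * x) v) v) = (norm (\<rho> x v))\<^sup>2"
  by (simp add: rep_mult rep_star cinner_self)

lemma Re_cinner_rep_sum:
  "Re (cinner (\<rho> (\<Sum>i\<in>I. star (x i) * x i) v) v) = (\<Sum>i\<in>I. (norm (\<rho> (x i) v))\<^sup>2)"
  by (induction I rule: infinite_finite_induct)
    (auto simp: rep_add cinner_add_left Re_cinner_rep_star_mult)

text \<open>The inequality \<open>b\<^sup>2 \<le> b\<close> is needed before roots of
  \<open>b\<close> exist. It is read off from the positivity of
  \<open>b (1 - b)\<^sup>2 = b - 2 b\<^sup>2 + b\<^sup>3\<close> together with
  \<open>b\<^sup>3 \<le> b\<^sup>2\<close>, which follows from \<open>norm b \<le> 1\<close>. Then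
  \<open>(1 - b)\<^sup>2 \<le> 1 - b \<le> 1\<close>.\<close>

lemma norm_diff_positive_mult_le:
  assumes sa: "star b = b" and pos: "\<And>v. 0 \<le> Re (cinner (\<rho> b v) v)" and b: "norm b \<le> 1"
  shows "norm (x - b * x) \<le> norm x"
proof (rule norm_le_rep)
  fix v
  have contr: "norm (\<rho> b w) \<le> norm w" for w
    using norm_rep_le[of b w] b mult_right_mono[OF b norm_ge_zero[of w]] by simp
  have main: "norm (w - \<rho> b w) \<le> norm w" for w
  proof -
    have sym: "cinner (\<rho> b u) u' = cinner u (\<rho> b u')" for u u'
      using rep_star[of b u u'] sa by simp
    have "Re (cinner (\<rho> b (\<rho> b w)) (\<rho> b w)) \<le> norm (\<rho> b (\<rho> b w)) * norm (\<rho> b w)"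
      by (rule Re_cinner_le)
    also have "\<dots> \<le> (norm (\<rho> b w))\<^sup>2"
      using mult_right_mono[OF contr[of "\<rho> b w"] norm_ge_zero[of "\<rho> b w"]]
      by (simp add: power2_eq_square)
    finally have 1: "Re (cinner (\<rho> b (\<rho> b w)) (\<rho> b w)) \<le> (norm (\<rho> b w))\<^sup>2" .
    have "0 \<le> Re (cinner (\<rho> b (w - \<rho> b w)) (w - \<rho> b w))" by (rule pos)
    also have "\<dots> = Re (cinner (\<rho> b w) w) - 2 * (norm (\<rho> b w))\<^sup>2 + Re (cinner (\<rho> b (\<rho> b w)) (\<rho> b w))"
      by (simp add: rep_diff_vec cinner_diff_left cinner_diff_right sym[of "\<rho> b w" w] cinner_self)
    finally have "(norm (\<rho> b w))\<^sup>2 \<le> Re (cinner (\<rho> b w) w)" using 1 by simp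
    then have "(norm (w - \<rho> b w))\<^sup>2 \<le> (norm w)\<^sup>2"
      using pos[of w] by (simp add: norm_diff_squared Re_cinner_commute[of w])
    then show ?thesis by (simp add: power2_le_iff_abs_le)
  qed
  show "norm (\<rho> (x - b * x) v) \<le> norm x * norm v"
    using main[of "\<rho> x v"] norm_rep_le[of x v] by (simp add: rep_diff rep_mult)
qed simp

lemma positive_sqrt:
  assumes sa: "star b = b" and pos: "\<And>v. 0 \<le> Re (cinner (\<rho> b v) v)"
  obtains s and Q :: "nat \<Rightarrow> 'a \<Rightarrow> 'a" where "s * s = b" and "star s = s"
    and "\<And>n x y. Q n (x * y) = Q n x * y" and "\<And>n x. Q n (s * x) = s * Q n x"
    and "\<And>n. star (Q n s) = Q n s" and "(\<lambda>n. Q n b) \<longlonglongrightarrow> s"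
proof -
  \<comment> \<open>Scales \<open>b\<close> into the unit ball; the summand 1 covers
    \<open>b = 0\<close>.\<close>
  define t where "t = 1 / (norm b + 1)"
  have t: "t > 0" unfolding t_def by (intro divide_pos_pos add_nonneg_pos) auto
  have "norm (x - t *\<^sub>R b * x) \<le> norm x" for x
  proof (rule norm_diff_positive_mult_le)
    show "star (t *\<^sub>R b) = t *\<^sub>R b" by (simp add: star_scaleR sa)
    show "0 \<le> Re (cinner (\<rho> (t *\<^sub>R b) v) v)" for v
      using t pos[of v] by (simp add: rep_scaleR cinner_scaleR_left)
    show "norm (t *\<^sub>R b) \<le> 1" using norm_ge_zero[of b] by (auto simp: t_def divide_simps simp del: norm_ge_zero)
  qed
  from sqrt_exists[OF sa t this] that show ?thesis by blast
qed

text \<open>Pedersen's Riesz decomposition. With \<open>b = \<Sum>\<^sub>i b\<^sub>i\<^sup>*b\<^sub>i\<close> the elements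
  \<open>z\<^sub>i = lim b\<^sub>i b\<^sup>-\<^sup>1\<^sup>/\<^sup>2 a\<^sup>1\<^sup>/\<^sup>2\<close> do the job.\<close>

lemma riesz_decomposition:
  fixes b :: "nat \<Rightarrow> 'a"
  assumes a: "cstar_positive a"
    and le: "\<And>v. Re (cinner (\<rho> a v) v) \<le> (\<Sum>i<m. (norm (\<rho> (b i) v))\<^sup>2)"
    and k: "\<And>i. i < m \<Longrightarrow> k * b i = b i"
  obtains z where "\<And>i. i < m \<Longrightarrow> k * z i = z i" and "a = (\<Sum>i<m. star (z i) * z i)"
proof -
  obtain \<beta> where \<beta>: "a = star \<beta> * \<beta>" using a by (auto simp: cstar_positive_def)
  define B where "B = (\<Sum>i<m. star (b i) * b i)"
  have sa_B: "star B = B" by (simp add: B_def star_sum star_mult star_star)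
  have quad_B: "Re (cinner (\<rho> B v) v) = (\<Sum>i<m. (norm (\<rho> (b i) v))\<^sup>2)" for v
    by (simp add: B_def Re_cinner_rep_sum)
  then have pos_B: "0 \<le> Re (cinner (\<rho> B v) v)" for v by (simp add: sum_nonneg)
  obtain s Q where s: "s * s = B" "star s = s"
    and Q_mult: "\<And>n x y. Q n (x * y) = Q n x * y" and Q_s: "\<And>n x. Q n (s * x) = s * Q n x"
    and star_Q: "\<And>n. star (Q n s) = Q n s" and Q_lim: "(\<lambda>n. Q n B) \<longlonglongrightarrow> s"
    using positive_sqrt[OF sa_B pos_B] by blast
  have sa_a: "star a = a" by (simp add: \<beta> star_mult star_star)
  have "0 \<le> Re (cinner (\<rho> a v) v)" for v by (simp add: \<beta> Re_cinner_rep_star_mult)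
  \<comment> \<open>The given factor \<open>\<beta>\<close> is replaced by a self-adjoint root, so
    that taking adjoints can move \<open>c\<close> from the right end of a product to the
    left.\<close>
  then obtain c where c: "c * c = a" "star c = c"
    using positive_sqrt[OF sa_a] by blast
  have norm_s: "(norm (\<rho> s v))\<^sup>2 = (\<Sum>i<m. (norm (\<rho> (b i) v))\<^sup>2)" for v
    using Re_cinner_rep_star_mult[of s v] s quad_B[of v] by simp
  have c_le_s: "norm (\<rho> c v) \<le> norm (\<rho> s v)" for v
  proof (rule power2_le_imp_le)
    show "(norm (\<rho> c v))\<^sup>2 \<le> (norm (\<rho> s v))\<^sup>2"
      using Re_cinner_rep_star_mult[of c v] c le[of v] norm_s[of v] by simp
  qed simp
  have b_le_s: "norm (\<rho> (b i) v) \<le> norm (\<rho> s v)" if "i < m" for i v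
  proof (rule power2_le_imp_le)
    show "(norm (\<rho> (b i) v))\<^sup>2 \<le> (norm (\<rho> s v))\<^sup>2"
      unfolding norm_s by (rule member_le_sum) (use that in auto)
  qed simp
  \<comment> \<open>A pointwise bound, that is \<open>star x * x \<le> star y * y\<close>, is
    inherited by products with any right factor.\<close>
  have mult_mono: "norm (x * w) \<le> norm (y * w)" if "\<And>v. norm (\<rho> x v) \<le> norm (\<rho> y v)" for x y w
  proof (rule norm_le_rep)
    show "norm (\<rho> (x * w) v) \<le> norm (y * w) * norm v" for v
      using that[of "\<rho> w v"] norm_rep_le[of "y * w" v] by (simp add: rep_mult)
  qed simp
  have s_Q_c: "s * Q n c = Q n s * c" for n by (metis Q_mult Q_s)
  have s_Q_s: "s * Q n s = Q n B" for n by (metis Q_s s(1))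
  \<comment> \<open>Two dominations by \<open>s\<close>: first \<open>b i\<close> is replaced by
    \<open>s\<close>, then an adjoint brings \<open>c\<close> to the front and \<open>c\<close> is
    replaced by \<open>s\<close>. What remains is \<open>s * Q n s = Q n B\<close>, which
    converges.\<close>
  have diff_bound: "norm (b i * (Q n c) - b i * (Q n' c)) \<le> norm (Q n B - Q n' B)" if i: "i < m" for i n n'
  proof -
    have "norm (b i * (Q n c - Q n' c)) \<le> norm (s * (Q n c - Q n' c))"
      by (rule mult_mono) (rule b_le_s[OF i])
    also have "s * (Q n c - Q n' c) = (Q n s - Q n' s) * c"
      by (simp add: right_diff_distrib left_diff_distrib s_Q_c)
    also have "norm \<dots> = norm (c * (Q n s - Q n' s))"
      by (subst norm_star[symmetric]) (simp add: star_mult star_diff star_Q c)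
    also have "\<dots> \<le> norm (s * (Q n s - Q n' s))" by (rule mult_mono) (rule c_le_s)
    finally show ?thesis by (simp add: right_diff_distrib s_Q_s)
  qed
  have "convergent (\<lambda>n. b i * Q n c)" if "i < m" for i
  proof -
    have "Cauchy (\<lambda>n. Q n B)" using Q_lim by (rule LIMSEQ_imp_Cauchy)
    then have "Cauchy (\<lambda>n. b i * Q n c)"
      unfolding Cauchy_def dist_norm using diff_bound[OF that] by (meson le_less_trans)
    then show ?thesis by (simp add: Cauchy_convergent_iff)
  qed
  then obtain z where z: "\<And>i. i < m \<Longrightarrow> (\<lambda>n. b i * Q n c) \<longlonglongrightarrow> z i"
    unfolding convergent_def by metis
  \<comment> \<open>The left unit survives because \<open>b i\<close> is the leftmost factor of
    every approximant.\<close>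
  have kz: "k * z i = z i" if "i < m" for i
  proof -
    have "(\<lambda>n. k * (b i * Q n c)) \<longlonglongrightarrow> k * z i" by (intro tendsto_intros z that)
    moreover have "k * (b i * Q n c) = b i * Q n c" for n
      using k[OF that] by (simp flip: mult.assoc)
    ultimately show ?thesis using z[OF that] LIMSEQ_unique by simp
  qed
  \<comment> \<open>The adjoint of the difference is \<open>c (Q n s - 1)\<close>, dominated by
    \<open>s (Q n s - 1) = Q n B - s\<close>. The 1 is harmless because the comparison takes place
    on vectors.\<close>
  have lim_c: "(\<lambda>n. s * Q n c) \<longlonglongrightarrow> c"
  proof -
    have "norm (s * Q n c - c) \<le> norm (Q n B - s)" for n
    proof -
      have "norm (s * Q n c - c) = norm (c * Q n s - c)"
        by (subst norm_star[symmetric]) (simp add: s_Q_c star_mult star_diff star_Q c)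
      also have "\<dots> \<le> norm (Q n B - s)"
      proof (rule norm_le_rep)
        fix v
        have "norm (\<rho> (c * Q n s - c) v) = norm (\<rho> c (\<rho> (Q n s) v - v))"
          by (simp add: rep_diff rep_mult rep_diff_vec)
        also have "\<dots> \<le> norm (\<rho> s (\<rho> (Q n s) v - v))" by (rule c_le_s)
        also have "\<rho> s (\<rho> (Q n s) v - v) = \<rho> (Q n B - s) v"
          by (simp add: rep_diff rep_diff_vec flip: rep_mult s_Q_s)
        finally show "norm (\<rho> (c * Q n s - c) v) \<le> norm (Q n B - s) * norm v"
          using norm_rep_le[of "Q n B - s" v] by linarith
      qed simp
      finally show ?thesis .
    qed
    moreover have "(\<lambda>n. norm (Q n B - s)) \<longlonglongrightarrow> 0"
      using Q_lim by (simp add: LIM_zero tendsto_norm_zero)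
    ultimately have "(\<lambda>n. s * Q n c - c) \<longlonglongrightarrow> 0"
      by (intro Lim_null_comparison[of "\<lambda>n. s * Q n c - c"]) auto
    then show ?thesis by (simp add: LIM_zero_iff)
  qed
  have "(\<lambda>n. \<Sum>i<m. star (b i * Q n c) * (b i * Q n c)) \<longlonglongrightarrow> (\<Sum>i<m. star (z i) * z i)"
    by (intro tendsto_sum tendsto_mult tendsto_star z) auto
  moreover have "(\<Sum>i<m. star (b i * Q n c) * (b i * Q n c)) = star (s * Q n c) * (s * Q n c)" for n
  proof -
    have "(\<Sum>i<m. star (b i * Q n c) * (b i * Q n c)) = star (Q n c) * B * Q n c"
      by (simp add: B_def sum_distrib_left sum_distrib_right star_mult mult.assoc)
    then show ?thesis by (simp add: star_mult s(2) mult.assoc flip: s(1))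
  qed
  moreover have "(\<lambda>n. star (s * Q n c) * (s * Q n c)) \<longlonglongrightarrow> star c * c"
    by (intro tendsto_mult tendsto_star lim_c)
  ultimately have "(\<Sum>i<m. star (z i) * z i) = a" using c LIMSEQ_unique by fastforce
  with kz that show ?thesis by blast
qed

end

section \<open>The Pedersen ideal\<close>

lemma two_sided_ideal_Ped: "two_sided_ideal (Ped :: 'a::cstar_algebra set)"
  unfolding two_sided_ideal_def complex_subspace_def Ped_def by auto

lemma Ped_zero: "(0::'a::cstar_algebra) \<in> Ped"
  and Ped_add: "x \<in> Ped \<Longrightarrow> y \<in> Ped \<Longrightarrow> x + y \<in> (Ped :: 'a set)"
  and Ped_scaleC: "x \<in> Ped \<Longrightarrow> scaleC c x \<in> (Ped :: 'a set)"
  and Ped_mult_right: "x \<in> Ped \<Longrightarrow> x * w \<in> (Ped :: 'a set)"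
  and Ped_mult_left: "x \<in> Ped \<Longrightarrow> w * x \<in> (Ped :: 'a set)"
  using two_sided_ideal_Ped unfolding two_sided_ideal_def complex_subspace_def by blast+

lemma Ped_sum: "(\<And>i. i \<in> I \<Longrightarrow> f i \<in> (Ped :: 'a::cstar_algebra set)) \<Longrightarrow> sum f I \<in> Ped"
  by (induction I rule: infinite_finite_induct) (auto intro: Ped_zero Ped_add)

text \<open>If \<open>j\<close> is close to \<open>k\<close> and \<open>r = k - j\<close>, then \<open>e = (1 - r)\<^sup>-\<^sup>1 j e\<close> lies in every ideal
  containing \<open>j\<close>.\<close>

lemma local_unit_in_Ped:
  fixes e k :: "'a::cstar_algebra"
  assumes "k * e = e"
  shows "e \<in> Ped"
  unfolding Ped_def
proof (intro InterI, elim CollectE conjE)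
  fix I :: "'a set" assume I: "two_sided_ideal I" "closure I = UNIV"
  then obtain j where j: "j \<in> I" "dist j k < 1"
    using closure_approachable[of k I] zero_less_one by blast
  define r where "r = k - j"
  have r: "norm r < 1" using j by (simp add: r_def dist_norm norm_minus_commute)
  \<comment> \<open>Without a unit the powers start at exponent 1: \<open>p n\<close> is the power
    of \<open>r\<close> with exponent \<open>n + 1\<close>, and the sum \<open>s\<close> stands for
    \<open>(1 - r)\<^sup>-\<^sup>1 - 1\<close>.\<close>
  define p where "p n = ((\<lambda>x. x * r) ^^ n) r" for n
  have p_Suc: "p (Suc n) = p n * r" for n by (simp add: p_def)
  have "norm (p n) \<le> norm r * norm r ^ n" for n
  proof (induction n)
    case (Suc n)
    then have "norm (p n) * norm r \<le> norm r * norm r ^ n * norm r"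
      by (simp add: mult_right_mono)
    then show ?case using norm_mult_ineq[of "p n" r] by (simp add: p_Suc mult.commute)
  qed (simp add: p_def)
  moreover have "summable (\<lambda>n. norm r * norm r ^ n)"
    using r by (intro summable_mult summable_geometric) simp
  ultimately have sm: "summable p" by (rule summable_comparison_test'[where N=0, rotated])
  define s where "s = suminf p"
  have "s = p 0 + (\<Sum>n. p (Suc n))" using suminf_split_head[OF sm] by (simp add: s_def)
  also have "(\<Sum>n. p (Suc n)) = s * r" using suminf_mult2[OF sm, of r] by (simp add: p_Suc s_def)
  finally have s: "s = r + s * r" by (simp add: p_def)
  have re: "r * e = e - j * e" by (simp add: r_def left_diff_distrib assms)
  have "s * e = r * e + s * (r * e)" by (subst s) (simp add: distrib_right mult.assoc)
  then have "s * (j * e) = r * e" by (simp add: re right_diff_distrib)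
  then have "e = j * e + s * (j * e)" by (simp add: re)
  moreover have "j * e \<in> I" "s * (j * e) \<in> I" using I(1) j by (auto simp: two_sided_ideal_def)
  ultimately show "e \<in> I" using I(1) unfolding two_sided_ideal_def complex_subspace_def by metis
qed

text \<open>In \<open>star x * y\<close> the local unit sits between the factors. The outer sides
  are free, so a multiplication by \<open>z\<close> changes one factor only: \<open>y\<close>
  becomes \<open>y * z\<close>, or \<open>x\<close> becomes \<open>x * star z\<close>. This makes
  the set \<open>J\<close> of such sums an ideal, and directedness makes it closed under addition.
  If \<open>u * x = x\<close>, then \<open>x = star u * x\<close> lies in \<open>J\<close>, whence
  its density.\<close>

lemma Ped_representation:
  fixes U :: "'a::cstar_algebra set"
  assumes sa: "\<And>u. u \<in> U \<Longrightarrow> star u = u"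
    and directed: "\<And>u u'. u \<in> U \<Longrightarrow> u' \<in> U \<Longrightarrow> \<exists>w\<in>U. w * u = u \<and> w * u' = u'"
    and dense: "closure {x. \<exists>u\<in>U. u * x = x} = UNIV"
    and "a \<in> Ped"
  obtains u xs where "u \<in> U" and "a = (\<Sum>(x, y)\<leftarrow>xs. star x * y)"
    and "\<And>x y. (x, y) \<in> set xs \<Longrightarrow> u * x = x \<and> u * y = y"
proof -
  define J where "J = {a. \<exists>u\<in>U. \<exists>xs. a = (\<Sum>(x, y)\<leftarrow>xs. star x * y) \<and>
    (\<forall>(x, y)\<in>set xs. u * x = x \<and> u * y = y)}"
  have sub: "{x. \<exists>u\<in>U. u * x = x} \<subseteq> J"
  proof clarify
    fix x u assume u: "u \<in> U" "u * x = x"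
    then obtain w where w: "w \<in> U" "w * u = u" using directed by blast
    then have "w * x = x" using u by (metis mult.assoc)
    then show "x \<in> J"
      unfolding J_def using u w sa by (auto intro!: bexI[of _ w] exI[of _ "[(u, x)]"])
  qed
  have "closure J = UNIV" using closure_mono[OF sub] dense by blast
  moreover have "two_sided_ideal J"
    unfolding two_sided_ideal_def complex_subspace_def
  proof (intro conjI ballI allI)
    obtain u where "u \<in> U" using dense by fastforce
    then show "0 \<in> J" unfolding J_def by (auto intro!: bexI[of _ u] exI[of _ "[]"])
  next
    fix x y assume "x \<in> J" "y \<in> J"
    then obtain u1 xs1 u2 xs2 where u: "u1 \<in> U" "u2 \<in> U"
      and xs1: "x = (\<Sum>(x, y)\<leftarrow>xs1. star x * y)" "\<forall>(x, y)\<in>set xs1. u1 * x = x \<and> u1 * y = y"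
      and xs2: "y = (\<Sum>(x, y)\<leftarrow>xs2. star x * y)" "\<forall>(x, y)\<in>set xs2. u2 * x = x \<and> u2 * y = y"
      unfolding J_def by blast
    obtain w where w: "w \<in> U" "w * u1 = u1" "w * u2 = u2" using directed u by blast
    have "w * z = z" if "u1 * z = z \<or> u2 * z = z" for z
      using that w by (metis mult.assoc)
    then have "\<forall>(x, y)\<in>set (xs1 @ xs2). w * x = x \<and> w * y = y" using xs1 xs2 by fastforce
    moreover have "x + y = (\<Sum>(x, y)\<leftarrow>xs1 @ xs2. star x * y)" using xs1 xs2 by simp
    ultimately show "x + y \<in> J" unfolding J_def using w by blast
  next
    fix c x assume "x \<in> J"
    then obtain u xs where u: "u \<in> U" "x = (\<Sum>(x, y)\<leftarrow>xs. star x * y)"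
      "\<forall>(x, y)\<in>set xs. u * x = x \<and> u * y = y" unfolding J_def by blast
    let ?xs = "map (\<lambda>(x, y). (x, scaleC c y)) xs"
    have "scaleC c (\<Sum>(x, y)\<leftarrow>xs. star x * y) = (\<Sum>(x, y)\<leftarrow>?xs. star x * y)"
    proof (induction xs)
      case Nil
      have "scaleC c 0 = (0::'a)" using scaleC_add_right[of c "0::'a" 0] by simp
      then show ?case by simp
    qed (auto simp: scaleC_add_right scaleC_mult_right)
    moreover have "\<forall>(x, y)\<in>set ?xs. u * x = x \<and> u * y = y"
      using u by (auto simp: scaleC_mult_right)
    ultimately show "scaleC c x \<in> J" unfolding J_def using u by blast
  next
    fix x z assume "x \<in> J"
    then obtain u xs where u: "u \<in> U" "x = (\<Sum>(x, y)\<leftarrow>xs. star x * y)"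
      "\<forall>(x, y)\<in>set xs. u * x = x \<and> u * y = y" unfolding J_def by blast
    let ?xs = "map (\<lambda>(x, y). (x, y * z)) xs"
    have "(\<Sum>(x, y)\<leftarrow>xs. star x * y) * z = (\<Sum>(x, y)\<leftarrow>?xs. star x * y)"
      by (induction xs) (auto simp: distrib_right mult.assoc)
    moreover have "\<forall>(x, y)\<in>set ?xs. u * x = x \<and> u * y = y"
      using u by (auto simp flip: mult.assoc)
    ultimately show "x * z \<in> J" unfolding J_def using u by blast
    let ?ys = "map (\<lambda>(x, y). (x * star z, y)) xs"
    have "z * (\<Sum>(x, y)\<leftarrow>xs. star x * y) = (\<Sum>(x, y)\<leftarrow>?ys. star x * y)"
      by (induction xs) (auto simp: distrib_left mult.assoc star_mult star_star)
    moreover have "\<forall>(x, y)\<in>set ?ys. u * x = x \<and> u * y = y"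
      using u by (auto simp flip: mult.assoc)
    ultimately show "z * x \<in> J" unfolding J_def using u by blast
  qed
  ultimately have "a \<in> J" using \<open>a \<in> Ped\<close> unfolding Ped_def by blast
  then show ?thesis unfolding J_def using that by blast
qed

text \<open>Positivity of the squared norm of \<open>\<rho> (y - x) v\<close> bounds the mixed
  products \<open>star x * y\<close> by squares. All \<open>x\<close> and all \<open>y\<close> of
  the representation together form the list \<open>bs\<close> that dominates
  \<open>a\<close>.\<close>

lemma (in faithful_representation) Ped_positive_decomposition:
  fixes U :: "'a set"
  assumes sa: "\<And>u. u \<in> U \<Longrightarrow> star u = u"
    and directed: "\<And>u u'. u \<in> U \<Longrightarrow> u' \<in> U \<Longrightarrow> \<exists>w\<in>U. w * u = u \<and> w * u' = u'"
    and dense: "closure {x. \<exists>u\<in>U. u * x = x} = UNIV"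
    and "a \<in> Ped" and pos: "cstar_positive a"
  obtains u z and m :: nat where "u \<in> U" and "\<And>i. i < m \<Longrightarrow> u * z i = z i"
    and "a = (\<Sum>i<m. star (z i) * z i)"
proof -
  obtain u xs where u: "u \<in> U" and a: "a = (\<Sum>(x, y)\<leftarrow>xs. star x * y)"
    and xs: "\<And>x y. (x, y) \<in> set xs \<Longrightarrow> u * x = x \<and> u * y = y"
    using Ped_representation[OF sa directed dense \<open>a \<in> Ped\<close>] by blast
  define bs where "bs = map fst xs @ map snd xs"
  have le: "2 * Re (cinner (\<rho> (\<Sum>(x, y)\<leftarrow>xs. star x * y) v) v)
      \<le> (\<Sum>b\<leftarrow>map fst xs @ map snd xs. (norm (\<rho> b v))\<^sup>2)" for v
  proof (induction xs)
    case (Cons p xs)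
    obtain x y where p: "p = (x, y)" by fastforce
    have "2 * Re (cinner (\<rho> (star x * y) v) v) = 2 * Re (cinner (\<rho> y v) (\<rho> x v))"
      by (simp add: rep_mult rep_star)
    also have "\<dots> \<le> (norm (\<rho> x v))\<^sup>2 + (norm (\<rho> y v))\<^sup>2"
      using zero_le_power2[of "norm (\<rho> y v - \<rho> x v)"] unfolding norm_diff_squared by linarith
    finally show ?case using Cons by (simp add: p rep_add cinner_add_left)
  qed simp
  have sum_bs: "(\<Sum>b\<leftarrow>bs. g b) = (\<Sum>i<length bs. g (bs ! i))" for g :: "'a \<Rightarrow> real"
    by (simp add: sum_list_sum_nth atLeast0LessThan)
  show ?thesis
  proof (rule riesz_decomposition[OF pos, where b = "\<lambda>i. bs ! i" and m = "length bs" and k = u])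
    fix v
    \<comment> \<open>Since \<open>a\<close> is positive, \<open>a \<le> 2 a\<close>, which absorbs
      the factor 2 in \<open>le\<close>.\<close>
    have "0 \<le> Re (cinner (\<rho> a v) v)"
      using pos by (auto simp: cstar_positive_def Re_cinner_rep_star_mult)
    then show "Re (cinner (\<rho> a v) v) \<le> (\<Sum>i<length bs. (norm (\<rho> (bs ! i) v))\<^sup>2)"
      using le[of v] sum_bs[of "\<lambda>b. (norm (\<rho> b v))\<^sup>2"] unfolding a[symmetric] bs_def[symmetric] by linarith
  next
    fix i assume "i < length bs"
    then have "bs ! i \<in> set bs" by (rule nth_mem)
    then show "u * bs ! i = bs ! i" using xs by (auto simp: bs_def)
  qed (use that u in blast)
qed

section \<open>Etale groupoids\<close>

context groupoid
begin

lemma unit_iff_rng: "g \<in> unit_space G \<longleftrightarrow> rng G g = g"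
proof
  assume "rng G g = g"
  then have "g = src G g" by (metis src_rng)
  then show "g \<in> unit_space G" unfolding unit_space_def by (rule range_eqI)
qed (auto simp: unit_space_def rng_src)

lemma unit_iff_src: "g \<in> unit_space G \<longleftrightarrow> src G g = g"
proof
  assume "src G g = g"
  then show "g \<in> unit_space G" unfolding unit_space_def by (rule range_eqI[OF sym])
qed (auto simp: unit_space_def src_src)

lemma rng_unit [simp]: "x \<in> unit_space G \<Longrightarrow> rng G x = x"
  and src_unit [simp]: "x \<in> unit_space G \<Longrightarrow> src G x = x"
  by (simp_all add: unit_iff_rng[symmetric] unit_iff_src[symmetric])

lemma rng_in_unit_space [simp]: "rng G g \<in> unit_space G"
  and src_in_unit_space [simp]: "src G g \<in> unit_space G"
  by (simp_all add: unit_iff_src src_rng src_src)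

lemma gmul_ginv_cancel_left: "src G g = rng G h \<Longrightarrow> gmul G (ginv G g) (gmul G g h) = h"
  by (metis gmul_assoc gmul_ginv_left gmul_rng src_ginv)

lemma gmul_ginv_cancel_left': "rng G g = rng G h \<Longrightarrow> gmul G g (gmul G (ginv G g) h) = h"
  by (metis gmul_assoc gmul_ginv_right gmul_rng rng_ginv src_ginv)

lemma ginv_ginv [simp]: "ginv G (ginv G g) = g"
proof -
  have "ginv G (ginv G g) = gmul G g (gmul G (ginv G g) (ginv G (ginv G g)))"
    by (simp add: gmul_ginv_cancel_left' rng_ginv src_ginv)
  also have "gmul G (ginv G g) (ginv G (ginv G g)) = src G g"
    by (simp add: gmul_ginv_right rng_ginv)
  finally show ?thesis by (simp add: gmul_src)
qed

lemma ginv_unit [simp]: "x \<in> unit_space G \<Longrightarrow> ginv G x = x"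
  by (metis gmul_ginv_right gmul_rng rng_ginv rng_unit src_unit)

text \<open>Factorizations of \<open>g\<close> are parametrized by their first factor, an arrow with
  the range of \<open>g\<close>; convolution sums are indexed this way below.\<close>

lemma gmul_eq_iff:
  "src G g1 = rng G g2 \<and> gmul G g1 g2 = g \<longleftrightarrow> rng G g1 = rng G g \<and> g2 = gmul G (ginv G g1) g"
  by (metis gmul_ginv_cancel_left gmul_ginv_cancel_left' rng_ginv rng_gmul src_ginv)

lemma src_eq_rng_ginv: "src G g = rng G (ginv G g)"
  by (simp add: rng_ginv)

lemma rng_ginv_gmul: "rng G \<gamma> = rng G g \<Longrightarrow> rng G (gmul G (ginv G \<gamma>) g) = src G \<gamma>"
  by (simp add: rng_gmul src_ginv rng_ginv)

end

context etale_groupoid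
begin

lemma continuous_rng: "continuous_on UNIV (rng G)"
proof -
  have "isCont (rng G) g" for g
  proof -
    obtain U q where U: "open U" "g \<in> U" "homeomorphism U (rng G ` U) (rng G) q"
      using rng_local_homeomorphism by blast
    then have "continuous_on U (rng G)" by (simp add: homeomorphism_def)
    with U show ?thesis by (simp add: continuous_on_eq_continuous_at)
  qed
  then show ?thesis by (simp add: continuous_on_eq_continuous_at)
qed

lemma continuous_src: "continuous_on UNIV (src G)"
proof -
  have "continuous_on UNIV (\<lambda>g. rng G (ginv G g))"
    by (rule continuous_on_compose2[OF continuous_rng continuous_ginv]) simp
  then show ?thesis by (simp add: src_eq_rng_ginv)
qed

text \<open>If \<open>rng G\<close> is injective on \<open>U\<close> and both \<open>g\<close> and
  \<open>rng G g\<close> lie in \<open>U\<close>, then they coincide, because they have the same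
  range.\<close>

lemma open_unit_space: "open (unit_space G)"
proof (subst open_subopen, intro ballI)
  fix x assume x: "x \<in> unit_space G"
  obtain U q where U: "open U" "x \<in> U" "homeomorphism U (rng G ` U) (rng G) q"
    using rng_local_homeomorphism by blast
  have inj: "inj_on (rng G) U" using U(3) by (metis homeomorphism_def inj_on_inverseI)
  let ?V = "U \<inter> rng G -` U"
  have "open ?V" using U(1) continuous_rng by (intro open_Int) (auto simp: open_vimage)
  moreover have "x \<in> ?V" using U x by simp
  moreover have "?V \<subseteq> unit_space G"
  proof
    fix g assume "g \<in> ?V"
    then have "rng G g = g" using inj by (auto simp: inj_on_def rng_rng)
    then show "g \<in> unit_space G" by (simp add: unit_iff_rng)
  qed
  ultimately show "\<exists>T. open T \<and> x \<in> T \<and> T \<subseteq> unit_space G" by blast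
qed

text \<open>An equalizer in a Hausdorff space. As the unit space is thus clopen, continuous sections
  over it extend by zero to continuous sections over the groupoid.\<close>

lemma closed_unit_space: "closed (unit_space G)"
proof -
  have "unit_space G = {g. rng G g = g}" by (auto simp: unit_iff_rng)
  moreover have "closed {g. rng G g = g}"
    by (rule closed_Collect_eq[OF continuous_rng continuous_on_id])
  ultimately show ?thesis by (simp only:)
qed

lemma local_section:
  obtains U q where "open U" "\<gamma> \<in> U" "open (rng G ` U)" "\<And>g. g \<in> U \<Longrightarrow> q (rng G g) = g"
    "continuous_on (rng G ` U) q"
proof -
  obtain U q where U: "open U" "\<gamma> \<in> U" "openin (top_of_set (unit_space G)) (rng G ` U)"
    "homeomorphism U (rng G ` U) (rng G) q"
    using rng_local_homeomorphism by blast
  then have "open (rng G ` U)" using open_unit_space openin_open_eq by blast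
  with U that show ?thesis by (auto simp: homeomorphism_def)
qed

text \<open>Finitely many open sets on which \<open>rng G\<close> is injective cover
  \<open>K\<close>, and each contains at most one arrow of the fibre.\<close>

lemma finite_rng_fibre:
  assumes "compact K"
  shows "finite {\<gamma>\<in>K. rng G \<gamma> = x}"
proof -
  have "\<forall>\<gamma>. \<exists>U. open U \<and> \<gamma> \<in> U \<and> inj_on (rng G) U"
    by (metis local_section inj_on_inverseI)
  then obtain U where U: "\<And>\<gamma>. open (U \<gamma>) \<and> \<gamma> \<in> U \<gamma> \<and> inj_on (rng G) (U \<gamma>)" by metis
  obtain D where D: "D \<subseteq> K" "finite D" "K \<subseteq> (\<Union>\<gamma>\<in>D. U \<gamma>)"
    using compactE_image[OF assms, of K U] U by blast
  have "finite {\<gamma>\<in>U \<delta>. rng G \<gamma> = x}" for \<delta>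
  proof (rule finite_subset)
    show "{\<gamma>\<in>U \<delta>. rng G \<gamma> = x} \<subseteq> {the_inv_into (U \<delta>) (rng G) x}"
      using U by (auto simp: the_inv_into_f_f)
  qed simp
  then have "finite (\<Union>\<delta>\<in>D. {\<gamma>\<in>U \<delta>. rng G \<gamma> = x})" using D by blast
  then show ?thesis by (rule finite_subset[rotated]) (use D in blast)
qed

lemma finite_src_fibre:
  assumes "compact K"
  shows "finite {\<gamma>\<in>K. src G \<gamma> = x}"
proof -
  have "compact (ginv G ` K)"
    by (rule compact_continuous_image[OF continuous_on_subset[OF continuous_ginv] assms]) simp
  then have "finite (ginv G ` {\<gamma>\<in>ginv G ` K. rng G \<gamma> = x})" by (simp add: finite_rng_fibre)
  moreover have "{\<gamma>\<in>K. src G \<gamma> = x} \<subseteq> ginv G ` {\<gamma>\<in>ginv G ` K. rng G \<gamma> = x}"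
  proof
    fix \<gamma> assume "\<gamma> \<in> {\<gamma>\<in>K. src G \<gamma> = x}"
    then have "ginv G \<gamma> \<in> {\<gamma>\<in>ginv G ` K. rng G \<gamma> = x}" by (auto simp: rng_ginv)
    then show "\<gamma> \<in> ginv G ` {\<gamma>\<in>ginv G ` K. rng G \<gamma> = x}" by (rule rev_image_eqI) simp
  qed
  ultimately show ?thesis by (rule finite_subset[rotated])
qed

lemma Cc_local_unit:
  assumes K: "compact K" "K \<subseteq> unit_space G"
  obtains h where "h \<in> Cc (unit_space G)" "\<And>x. x \<in> K \<Longrightarrow> h x = 1" "\<And>x. h x \<in> \<real>"
proof -
  let ?X = "top_of_set (unit_space G)"
  have H: "Hausdorff_space ?X"
    by (rule Hausdorff_space_subtopology)
      (auto simp: Hausdorff_space_def disjnt_def separation_t2)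
  have cr: "completely_regular_space ?X"
    using locally_compact_unit_space H completely_regular_eq_regular_space
      locally_compact_Hausdorff_imp_regular_space by blast
  have "compactin ?X K" using K by (simp add: compactin_subtopology)
  then obtain U C where U: "openin ?X U" "compactin ?X C" "K \<subseteq> U" "U \<subseteq> C"
    using locally_compact_space_compact_closed_compact[of ?X] H locally_compact_unit_space by metis
  have "closedin ?X (unit_space G - U)" using U(1) by (metis closedin_diff closedin_topspace topspace_euclidean_subtopology)
  moreover have "disjnt K (unit_space G - U)" using U by (auto simp: disjnt_def)
  ultimately obtain f where f: "continuous_map ?X euclideanreal f"
      "f ` (unit_space G - U) \<subseteq> {0}" "f ` K \<subseteq> {1}"
    using Urysohn_completely_regular_compact_closed_alt[OF cr \<open>compactin ?X K\<close>] by metis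
  \<comment> \<open>On the unit space this is \<open>f\<close>, which vanishes outside
    \<open>U\<close> and hence outside \<open>C\<close>. The case distinction sets the value 0 at
    all other arrows, where \<open>f\<close> is arbitrary.\<close>
  define h where "h x = (if x \<in> C then complex_of_real (f x) else 0)" for x
  have C: "compact C" "C \<subseteq> unit_space G" using U(2) by (auto simp: compactin_subtopology)
  have h_eq: "h x = complex_of_real (f x)" if "x \<in> unit_space G" for x
    using that f(2) U by (auto simp: h_def)
  have "continuous_on (unit_space G) (\<lambda>x. complex_of_real (f x))"
    using f(1) by (intro continuous_on_of_real) simp
  then have "continuous_on (unit_space G) h" using h_eq by (simp cong: continuous_on_cong)
  then have "h \<in> Cc (unit_space G)" using C by (auto simp: Cc_def h_def)
  moreover have "h x = 1" if "x \<in> K" for x using that f(3) U(3,4) by (auto simp: h_def)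
  moreover have "h x \<in> \<real>" for x by (simp add: h_def)
  ultimately show ?thesis using that by blast
qed

end

section \<open>Fell line bundles\<close>

context banach_line_bundle
begin

lemma lscale_zero_left: "lscale L 0 a = lzero L (proj L a)"
proof -
  have "lscale L 0 a = lscale L (1 + (- 1)) a" by simp
  also have "\<dots> = ladd L (lscale L 1 a) (lscale L (- 1) a)" by (rule lscale_ladd_left)
  finally show ?thesis by (simp add: lscale_one ladd_inverse)
qed

lemma lscale_lzero [simp]: "lscale L c (lzero L g) = lzero L g"
  by (metis lscale_lscale lscale_zero_left mult_zero_right proj_lzero)

lemma ladd_lzero_left: "ladd L (lzero L (proj L a)) a = a"
  by (metis ladd_commute ladd_lzero proj_lzero)

lemma lnorm_lzero [simp]: "lnorm L (lzero L g) = 0"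
  by (simp add: lnorm_eq_0 proj_lzero)

text \<open>Nonnegativity is not among the axioms; it comes from the triangle inequality for
  \<open>a + (- a)\<close>.\<close>

lemma lnorm_nonneg [simp]: "0 \<le> lnorm L a"
  using lnorm_ladd[of a "lscale L (- 1) a"] by (simp add: proj_lscale ladd_inverse lnorm_lscale)

lemma lscale_eq_lzero_iff: "lscale L c a = lzero L (proj L a) \<longleftrightarrow> c = 0 \<or> a = lzero L (proj L a)"
  using lnorm_eq_0[of "lscale L c a"] lnorm_eq_0[of a] by (simp add: lnorm_lscale proj_lscale)

lemma lscale_diff: "ladd L (lscale L c a) (lscale L (- 1) (lscale L c' a)) = lscale L (c - c') a"
  using lscale_ladd_left[of c "- c'" a] by (simp add: lscale_lscale)

lemma lscale_cancel:
  assumes "lscale L c a = lscale L c' a" and "a \<noteq> lzero L (proj L a)"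
  shows "c = c'"
  using lscale_diff[of c a c'] assms by (simp add: ladd_inverse proj_lscale lscale_eq_lzero_iff eq_commute[of "lzero L _"])

lemma fibre_scale:
  assumes "proj L e = proj L a" and "e \<noteq> lzero L (proj L e)"
  obtains c where "a = lscale L c e"
proof -
  obtain e' where e': "\<And>a'. proj L a' = proj L a \<Longrightarrow> \<exists>c. a' = lscale L c e'"
    using one_dimensional[of "proj L a"] by blast
  then obtain c d where c: "a = lscale L c e'" and d: "e = lscale L d e'"
    using assms by metis
  have "d \<noteq> 0" using d assms(2) by (auto simp: lscale_zero_left proj_lzero)
  then have "a = lscale L (c / d) e" by (simp add: c d lscale_lscale)
  then show ?thesis by (rule that)
qed

lemma continuous_lzero: "continuous_on UNIV (lzero L)"
  unfolding continuous_on_topological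
proof (intro ballI allI impI)
  fix g W assume "open W" "lzero L g \<in> W"
  then obtain V \<epsilon> where "open V" "g \<in> V" "0 < \<epsilon>" "{a. proj L a \<in> V \<and> lnorm L a < \<epsilon>} \<subseteq> W"
    using lzero_neighbourhood by metis
  then show "\<exists>V. open V \<and> g \<in> V \<and> (\<forall>g'\<in>UNIV. g' \<in> V \<longrightarrow> lzero L g' \<in> W)"
    by (intro exI[of _ V]) (auto simp: proj_lzero)
qed

lemma comm_monoid_fibre_group: "comm_monoid (fibre_group L g)"
  by (rule comm_monoidI)
    (auto simp: fibre_group_def proj_ladd proj_lzero ladd_assoc ladd_lzero_left intro: ladd_commute)

lemma tendsto_ladd:
  assumes "(A \<longlongrightarrow> a) F" and "(B \<longlongrightarrow> b) F"
    and "\<forall>\<^sub>F x in F. proj L (A x) = proj L (B x)" and "proj L a = proj L b"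
  shows "((\<lambda>x. ladd L (A x) (B x)) \<longlongrightarrow> ladd L a b) F"
  using continuous_on_tendsto_compose[OF continuous_ladd tendsto_Pair[OF assms(1,2)]] assms(3,4)
  by simp

lemma tendsto_lscale:
  assumes "(c \<longlongrightarrow> d) F" and "(A \<longlongrightarrow> a) F"
  shows "((\<lambda>x. lscale L (c x) (A x)) \<longlongrightarrow> lscale L d a) F"
  using continuous_on_tendsto_compose[OF continuous_lscale tendsto_Pair[OF assms]] by simp

lemma finprod_fibre_insert:
  assumes "finite S" and "s \<notin> S" and "\<And>i. i \<in> insert s S \<Longrightarrow> proj L (T i) = g"
  shows "finprod (fibre_group L g) T (insert s S) = ladd L (T s) (finprod (fibre_group L g) T S)"
  using comm_monoid.finprod_insert[OF comm_monoid_fibre_group assms(1,2), of T g] assms(3)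
  by (simp add: fibre_group_def Pi_def)

lemma proj_finprod:
  assumes "\<And>i. i \<in> S \<Longrightarrow> proj L (T i) = g"
  shows "proj L (finprod (fibre_group L g) T S) = g"
  using comm_monoid.finprod_closed[OF comm_monoid_fibre_group, of T S g] assms
  by (simp add: fibre_group_def Pi_def)

text \<open>The group in which the sum is formed moves with \<open>g\<close>, so continuity has to
  come from joint continuity of \<open>ladd L\<close> on pairs in a common fibre; the terms only
  need to lie over \<open>g\<close> for \<open>g\<close> near \<open>g0\<close>.\<close>

lemma tendsto_finprod:
  assumes "finite S" and "\<And>i. i \<in> S \<Longrightarrow> ((\<lambda>g. T g i) \<longlongrightarrow> T g0 i) (nhds g0)"
    and "\<forall>\<^sub>F g in nhds g0. \<forall>i\<in>S. proj L (T g i) = g"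
  shows "((\<lambda>g. finprod (fibre_group L g) (T g) S) \<longlongrightarrow> finprod (fibre_group L g0) (T g0) S) (nhds g0)"
  using assms
proof (induction S rule: finite_induct)
  case empty
  have "((\<lambda>g. lzero L g) \<longlongrightarrow> lzero L g0) (nhds g0)"
    using continuous_on_tendsto_compose[OF continuous_lzero filterlim_ident] by simp
  then show ?case
    by (simp add: comm_monoid.finprod_empty[OF comm_monoid_fibre_group]) (simp add: fibre_group_def)
next
  case (insert s S)
  have ev: "\<forall>\<^sub>F g in nhds g0. \<forall>i\<in>insert s S. proj L (T g i) = g" by (rule insert.prems)
  then have at: "\<And>i. i \<in> insert s S \<Longrightarrow> proj L (T g0 i) = g0" using eventually_nhds_x_imp_x by blast
  have IH: "((\<lambda>g. finprod (fibre_group L g) (T g) S) \<longlongrightarrow> finprod (fibre_group L g0) (T g0) S) (nhds g0)"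
    using insert ev by (auto intro!: insert.IH elim: eventually_mono)
  have "((\<lambda>g. ladd L (T g s) (finprod (fibre_group L g) (T g) S))
      \<longlongrightarrow> ladd L (T g0 s) (finprod (fibre_group L g0) (T g0) S)) (nhds g0)"
  proof (rule tendsto_ladd[OF _ IH])
    show "\<forall>\<^sub>F g in nhds g0. proj L (T g s) = proj L (finprod (fibre_group L g) (T g) S)"
      using ev by eventually_elim (simp add: proj_finprod)
  qed (use insert at in \<open>auto simp: proj_finprod\<close>)
  then have "((\<lambda>g. finprod (fibre_group L g) (T g) (insert s S))
      \<longlongrightarrow> ladd L (T g0 s) (finprod (fibre_group L g0) (T g0) S)) (nhds g0)"
  proof (rule Lim_transform_eventually)
    show "\<forall>\<^sub>F g in nhds g0. ladd L (T g s) (finprod (fibre_group L g) (T g) S)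
        = finprod (fibre_group L g) (T g) (insert s S)"
      using ev by eventually_elim
        (rule finprod_fibre_insert[symmetric, OF insert.hyps], auto)
  qed
  moreover have "finprod (fibre_group L g0) (T g0) (insert s S)
      = ladd L (T g0 s) (finprod (fibre_group L g0) (T g0) S)"
    by (rule finprod_fibre_insert[OF insert.hyps at])
  ultimately show ?case by simp
qed

end

section \<open>Identification of the fibres over units with the complex numbers\<close>

context twisted_etale_groupoid
begin

lemma lmul_lzero_left [simp]:
  "src G g = rng G (proj L b) \<Longrightarrow> lmul L (lzero L g) b = lzero L (gmul G g (proj L b))"
  using lmul_lscale_left[of "lzero L g" b 0] by (simp add: lscale_zero_left proj_lzero proj_lmul)

lemma lmul_lzero_right [simp]:
  "src G (proj L a) = rng G h \<Longrightarrow> lmul L a (lzero L h) = lzero L (gmul G (proj L a) h)"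
  using lmul_lscale_right[of a "lzero L h" 0] by (simp add: lscale_zero_left proj_lzero proj_lmul)

lemma lstar_lzero [simp]: "lstar L (lzero L g) = lzero L (ginv G g)"
  using lstar_lscale[of 0 "lzero L g"] by (simp add: lscale_zero_left proj_lzero proj_lstar)

lemma gmul_unit_self [simp]: "x \<in> unit_space G \<Longrightarrow> gmul G x x = x"
  by (metis gmul_rng rng_unit)

text \<open>For a nonzero \<open>e\<close> over \<open>x\<close> write \<open>e e = c e\<close>.
  Since \<open>lstar L e\<close> is a multiple of \<open>e\<close> and
  \<open>lmul L (lstar L e) e\<close> has norm \<open>(lnorm L e)\<^sup>2 \<noteq> 0\<close>, the
  scalar \<open>c\<close> is nonzero, and \<open>e / c\<close> is the identity.\<close>

lemma fibre_one_ex1: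
  assumes x: "x \<in> unit_space G"
  shows "\<exists>!e. proj L e = x \<and> (\<forall>a. proj L a = x \<longrightarrow> lmul L e a = a \<and> lmul L a e = a)"
proof (rule ex_ex1I)
  obtain e where e: "proj L e = x" "e \<noteq> lzero L x" using one_dimensional[of x] by blast
  have scale: "\<exists>c. a = lscale L c e" if "proj L a = x" for a
    using fibre_scale[of e a] e that by auto
  obtain d where d: "lstar L e = lscale L d e" using scale e x by (metis ginv_unit proj_lstar)
  obtain c where c: "lmul L e e = lscale L c e" using scale e x by (metis gmul_unit_self proj_lmul rng_unit src_unit)
  have "lmul L (lstar L e) e = lscale L (d * c) e"
    using e x by (simp add: d lmul_lscale_left c lscale_lscale)
  moreover have "lmul L (lstar L e) e \<noteq> lzero L x"
    using lnorm_lstar_lmul[of e] lnorm_eq_0[of e] e by auto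
  ultimately have "c \<noteq> 0" using e by (auto simp: lscale_zero_left)
  then show "\<exists>e. proj L e = x \<and> (\<forall>a. proj L a = x \<longrightarrow> lmul L e a = a \<and> lmul L a e = a)"
    using e x scale
    by (intro exI[of _ "lscale L (1 / c) e"])
      (force simp: proj_lscale lmul_lscale_left lmul_lscale_right c lscale_lscale lscale_one)
qed metis

lemma proj_fibre_one [simp]: "x \<in> unit_space G \<Longrightarrow> proj L (fibre_one L x) = x"
  and fibre_one_mult: "x \<in> unit_space G \<Longrightarrow> proj L a = x \<Longrightarrow> lmul L (fibre_one L x) a = a"
  and mult_fibre_one: "x \<in> unit_space G \<Longrightarrow> proj L a = x \<Longrightarrow> lmul L a (fibre_one L x) = a"
  using theI'[OF fibre_one_ex1] unfolding fibre_one_def by blast+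

lemma fibre_one_eqI:
  assumes "x \<in> unit_space G" and "proj L e = x" and "\<And>a. proj L a = x \<Longrightarrow> lmul L e a = a"
  shows "e = fibre_one L x"
  using assms by (metis mult_fibre_one proj_fibre_one)

lemma lstar_fibre_one [simp]:
  assumes x: "x \<in> unit_space G"
  shows "lstar L (fibre_one L x) = fibre_one L x"
proof (rule fibre_one_eqI[OF x])
  show "proj L (lstar L (fibre_one L x)) = x" using x by (simp add: proj_lstar)
  fix a assume a: "proj L a = x"
  have "lmul L (lstar L (fibre_one L x)) a = lstar L (lmul L (lstar L a) (fibre_one L x))"
    using a x by (simp add: lstar_lmul proj_lstar lstar_lstar)
  also have "lmul L (lstar L a) (fibre_one L x) = lstar L a"
    using a x by (simp add: mult_fibre_one proj_lstar)
  finally show "lmul L (lstar L (fibre_one L x)) a = a" by (simp add: lstar_lstar)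
qed

lemma fibre_one_nonzero: "x \<in> unit_space G \<Longrightarrow> fibre_one L x \<noteq> lzero L x"
  using one_dimensional[of x] fibre_one_mult[of x] lmul_lzero_left[of x] by fastforce

lemma lnorm_fibre_one [simp]:
  assumes x: "x \<in> unit_space G"
  shows "lnorm L (fibre_one L x) = 1"
proof -
  have "lnorm L (fibre_one L x) = (lnorm L (fibre_one L x))\<^sup>2"
    using lnorm_lstar_lmul[of "fibre_one L x"] x by (simp add: fibre_one_mult)
  moreover have "lnorm L (fibre_one L x) \<noteq> 0"
    using fibre_one_nonzero[OF x] x by (simp add: lnorm_eq_0)
  ultimately show ?thesis by (simp add: power2_eq_square)
qed

lemma lnorm_lstar [simp]: "lnorm L (lstar L a) = lnorm L a"
proof -
  have le: "lnorm L b \<le> lnorm L (lstar L b)" for b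
  proof (cases "lnorm L b = 0")
    case False
    have "lnorm L b * lnorm L b \<le> lnorm L (lstar L b) * lnorm L b"
      using lnorm_lmul[of "lstar L b" b] by (simp add: lnorm_lstar_lmul proj_lstar src_ginv power2_eq_square)
    with False show ?thesis
      by (metis lnorm_nonneg less_eq_real_def mult_right_le_imp_le)
  qed simp
  show ?thesis using le[of a] le[of "lstar L a"] by (simp add: lstar_lstar)
qed

text \<open>Since \<open>1\<^sub>x\<close> acts on the one-dimensional fibre over \<open>g\<close> by an idempotent scalar, it suffices
  that it acts non-trivially on \<open>a a\<^sup>*\<close>.\<close>

lemma fibre_one_lmul:
  assumes x: "x = rng G (proj L a)"
  shows "lmul L (fibre_one L x) a = a"
proof (cases "a = lzero L (proj L a)")
  case True
  then show ?thesis using x by (metis gmul_rng lmul_lzero_right proj_fibre_one rng_in_unit_space src_unit)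
next
  case False
  have xu: "x \<in> unit_space G" using x by simp
  have "proj L (lmul L (fibre_one L x) a) = proj L a"
    using x xu by (simp add: proj_lmul src_rng gmul_rng)
  then obtain c where c: "lmul L (fibre_one L x) a = lscale L c a" using fibre_scale False by metis
  let ?b = "lmul L a (lstar L a)"
  have comp: "src G (proj L a) = rng G (proj L (lstar L a))" by (simp add: proj_lstar rng_ginv)
  have b: "proj L ?b = x" using comp x by (simp add: proj_lmul proj_lstar gmul_ginv_right)
  have "?b = lmul L (fibre_one L x) ?b" using fibre_one_mult[OF xu b] by simp
  also have "\<dots> = lmul L (lmul L (fibre_one L x) a) (lstar L a)"
    using x xu comp by (intro lmul_assoc[symmetric]) (simp_all add: src_rng)
  also have "\<dots> = lscale L c ?b" using comp by (simp add: c lmul_lscale_left)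
  finally have "lscale L 1 ?b = lscale L c ?b" by (simp add: lscale_one)
  moreover have "?b \<noteq> lzero L (proj L ?b)"
    using lnorm_lstar_lmul[of "lstar L a"] False
    by (simp add: lstar_lstar lnorm_eq_0[symmetric])
  ultimately have "c = 1" using lscale_cancel by metis
  then show ?thesis by (simp add: c lscale_one)
qed

lemma fibre_coord_lscale [simp]:
  assumes x: "x \<in> unit_space G"
  shows "fibre_coord L (lscale L c (fibre_one L x)) = c"
  unfolding fibre_coord_def
proof (rule the_equality)
  fix d assume "lscale L c (fibre_one L x) = lscale L d (fibre_one L (proj L (lscale L c (fibre_one L x))))"
  then show "d = c" using x lscale_cancel[of d "fibre_one L x" c] fibre_one_nonzero[OF x]
    by (simp add: proj_lscale)
qed (use x in \<open>simp add: proj_lscale\<close>)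

lemma lscale_fibre_coord:
  assumes "proj L a \<in> unit_space G"
  shows "lscale L (fibre_coord L a) (fibre_one L (proj L a)) = a"
proof -
  obtain c where "a = lscale L c (fibre_one L (proj L a))"
    using fibre_scale[of "fibre_one L (proj L a)" a] assms fibre_one_nonzero by auto
  then show ?thesis by (metis assms fibre_coord_lscale)
qed

lemma fibre_coord_lzero [simp]: "x \<in> unit_space G \<Longrightarrow> fibre_coord L (lzero L x) = 0"
  by (metis fibre_coord_lscale lscale_zero_left proj_fibre_one)

lemma cmod_fibre_coord: "proj L a \<in> unit_space G \<Longrightarrow> cmod (fibre_coord L a) = lnorm L a"
  by (metis lnorm_fibre_one lnorm_lscale lscale_fibre_coord mult.right_neutral)

lemma fibre_coord_ladd:
  assumes "proj L a \<in> unit_space G" and "proj L b = proj L a"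
  shows "fibre_coord L (ladd L a b) = fibre_coord L a + fibre_coord L b"
  by (metis assms fibre_coord_lscale lscale_fibre_coord lscale_ladd_left)

lemma fibre_coord_scale:
  assumes "proj L a \<in> unit_space G"
  shows "fibre_coord L (lscale L c a) = c * fibre_coord L a"
  by (metis assms fibre_coord_lscale lscale_fibre_coord lscale_lscale)

lemma fibre_coord_lmul:
  assumes "proj L a \<in> unit_space G" and "proj L b = proj L a"
  shows "fibre_coord L (lmul L a b) = fibre_coord L a * fibre_coord L b"
proof -
  let ?x = "proj L a" and ?e = "fibre_one L (proj L a)"
  have "lmul L (lscale L (fibre_coord L a) ?e) (lscale L (fibre_coord L b) ?e)
      = lscale L (fibre_coord L a * fibre_coord L b) ?e"
    using assms by (simp add: lmul_lscale_left lmul_lscale_right proj_lscale lscale_lscale fibre_one_mult mult.commute)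
  then show ?thesis using lscale_fibre_coord[of a] lscale_fibre_coord[of b] assms by simp
qed

lemma fibre_coord_lstar:
  assumes "proj L a \<in> unit_space G"
  shows "fibre_coord L (lstar L a) = cnj (fibre_coord L a)"
proof -
  have "lstar L (lscale L (fibre_coord L a) (fibre_one L (proj L a)))
      = lscale L (cnj (fibre_coord L a)) (fibre_one L (proj L a))"
    using assms by (simp add: lstar_lscale)
  then show ?thesis using lscale_fibre_coord[OF assms] assms by simp
qed

text \<open>The positivity axiom for \<open>lstar L a\<close> rewrites the product as
  \<open>lmul L (lstar L b) b\<close> with \<open>b\<close> over a unit, where the coordinate is the
  squared modulus of that of \<open>b\<close>.\<close>

lemma fibre_coord_lmul_lstar_nonneg: "fibre_coord L (lmul L a (lstar L a)) \<in> \<real>\<^sub>\<ge>\<^sub>0"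
proof -
  obtain b where b: "proj L b = src G (proj L (lstar L a))" "lmul L a (lstar L a) = lmul L (lstar L b) b"
    using lstar_lmul_positive[of "lstar L a"] by (auto simp: lstar_lstar)
  then have "proj L b \<in> unit_space G" by simp
  then have "fibre_coord L (lmul L (lstar L b) b) = cnj (fibre_coord L b) * fibre_coord L b"
    by (simp add: fibre_coord_lmul fibre_coord_lstar proj_lstar)
  then show ?thesis
    using b(2) by (simp add: mult.commute[of "cnj _"] flip: complex_norm_square)
qed

lemma fibre_coord_finprod_nonneg:
  assumes x: "x \<in> unit_space G"
    and T: "\<And>i. i \<in> S \<Longrightarrow> proj L (T i) = x \<and> fibre_coord L (T i) \<in> \<real>\<^sub>\<ge>\<^sub>0"
  shows "fibre_coord L (finprod (fibre_group L x) T S) \<in> \<real>\<^sub>\<ge>\<^sub>0"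
  using T
proof (induction S rule: infinite_finite_induct)
  case (infinite S)
  then show ?case using x
    by (simp add: comm_monoid.finprod_infinite[OF comm_monoid_fibre_group]) (simp add: fibre_group_def)
next
  case empty
  show ?case using x
    by (simp add: comm_monoid.finprod_empty[OF comm_monoid_fibre_group]) (simp add: fibre_group_def)
next
  case (insert s S)
  then have "fibre_coord L (finprod (fibre_group L x) T (insert s S))
      = fibre_coord L (T s) + fibre_coord L (finprod (fibre_group L x) T S)"
    using x by (subst finprod_fibre_insert) (auto simp: fibre_coord_ladd proj_finprod)
  then show ?case using insert by (simp add: nonneg_Reals_add_I)
qed

lemma open_unit_fibres: "open {a. proj L a \<in> unit_space G}"
  using open_vimage[OF open_unit_space continuous_proj] by (simp add: vimage_def)

text \<open>If \<open>c\<close> and \<open>c\<^sub>0\<close> are the coordinates of \<open>a\<close> and \<open>a\<^sub>0\<close>, then \<open>a a - c\<^sub>0 a\<close> has norm \<open>|c - c\<^sub>0| |c|\<close>,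
  which is continuous in \<open>a\<close>.\<close>

lemma continuous_fibre_coord: "continuous_on {a. proj L a \<in> unit_space G} (fibre_coord L)"
  unfolding continuous_on_def
proof
  let ?S = "{a. proj L a \<in> unit_space G}"
  fix a0 assume a0: "a0 \<in> ?S"
  define c0 where "c0 = fibre_coord L a0"
  define F where "F = at a0 within ?S"
  have ev: "\<forall>\<^sub>F a in F. a \<in> ?S" by (simp add: F_def eventually_at_filter)
  have id: "((\<lambda>a. a) \<longlongrightarrow> a0) F" by (simp add: F_def)
  have norm_lim: "((\<lambda>a. lnorm L a) \<longlongrightarrow> lnorm L a0) F"
    using continuous_on_tendsto_compose[OF continuous_lnorm id] by simp
  have norm_eq: "\<forall>\<^sub>F a in F. lnorm L a = cmod (fibre_coord L a)"
    using ev by eventually_elim (simp add: cmod_fibre_coord)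
  have *: "lnorm L (ladd L (lmul L a a) (lscale L (- c0) a)) = cmod (fibre_coord L a - c0) * lnorm L a"
    if "a \<in> ?S" for a
  proof -
    have pr: "proj L (lmul L a a) = proj L a" using that by (simp add: proj_lmul)
    have "fibre_coord L (ladd L (lmul L a a) (lscale L (- c0) a)) = (fibre_coord L a - c0) * fibre_coord L a"
      using that pr by (simp add: fibre_coord_ladd proj_lscale fibre_coord_scale fibre_coord_lmul algebra_simps)
    moreover have "proj L (ladd L (lmul L a a) (lscale L (- c0) a)) = proj L a"
      using pr by (simp add: proj_ladd proj_lscale)
    ultimately show ?thesis using that by (metis cmod_fibre_coord mem_Collect_eq norm_mult)
  qed
  have "((\<lambda>a. ladd L (lmul L a a) (lscale L (- c0) a)) \<longlongrightarrow> ladd L (lmul L a0 a0) (lscale L (- c0) a0)) F"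
  proof (rule tendsto_ladd)
    show "((\<lambda>a. lmul L a a) \<longlongrightarrow> lmul L a0 a0) F"
      using continuous_on_tendsto_compose[OF continuous_lmul tendsto_Pair[OF id id]] a0
        eventually_mono[OF ev] by simp
    show "((\<lambda>a. lscale L (- c0) a) \<longlongrightarrow> lscale L (- c0) a0) F" by (intro tendsto_lscale tendsto_const id)
    show "\<forall>\<^sub>F a in F. proj L (lmul L a a) = proj L (lscale L (- c0) a)"
      using ev by eventually_elim (simp add: proj_lmul proj_lscale)
  qed (use a0 in \<open>simp add: proj_lmul proj_lscale\<close>)
  from continuous_on_tendsto_compose[OF continuous_lnorm this]
  have "((\<lambda>a. lnorm L (ladd L (lmul L a a) (lscale L (- c0) a))) \<longlongrightarrow> 0) F"
    using *[OF a0] by (simp add: c0_def)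
  then have lim: "((\<lambda>a. cmod (fibre_coord L a - c0) * lnorm L a) \<longlongrightarrow> 0) F"
    by (rule tendsto_cong[THEN iffD1, rotated]) (use ev * in \<open>auto elim: eventually_mono\<close>)
  \<comment> \<open>For \<open>c0 \<noteq> 0\<close> the factor \<open>lnorm L a\<close> has a
    nonzero limit and can be divided out; for \<open>c0 = 0\<close> it is itself the quantity that
    has to tend to 0.\<close>
  have "((\<lambda>a. cmod (fibre_coord L a - c0)) \<longlongrightarrow> 0) F"
  proof (cases "c0 = 0")
    case True
    then have "((\<lambda>a. lnorm L a) \<longlongrightarrow> 0) F" using norm_lim a0 by (simp add: c0_def flip: cmod_fibre_coord)
    then show ?thesis using norm_eq True by (simp add: tendsto_cong)
  next
    case False
    then have nz: "lnorm L a0 \<noteq> 0" using a0 by (simp add: c0_def flip: cmod_fibre_coord)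
    have "((\<lambda>a. cmod (fibre_coord L a - c0) * lnorm L a / lnorm L a) \<longlongrightarrow> 0 / lnorm L a0) F"
      by (intro tendsto_divide lim norm_lim nz)
    moreover have "\<forall>\<^sub>F a in F. lnorm L a \<noteq> 0"
      using tendsto_imp_eventually_ne[OF norm_lim nz] .
    then have "\<forall>\<^sub>F a in F. cmod (fibre_coord L a - c0) * lnorm L a / lnorm L a = cmod (fibre_coord L a - c0)"
      by eventually_elim simp
    ultimately show ?thesis by (simp add: tendsto_cong)
  qed
  then show "(fibre_coord L \<longlongrightarrow> fibre_coord L a0) (at a0 within ?S)"
    unfolding F_def c0_def by (simp add: tendsto_norm_zero_iff LIM_zero_iff)
qed

text \<open>Normalizing vectors with nonzero coordinate gives a continuous map \<open>N\<close> on
  the open set \<open>S\<close> that equals \<open>fibre_one L\<close> after \<open>proj L\<close>.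
  As \<open>proj L\<close> is open, continuity descends to the unit space.\<close>

lemma continuous_fibre_one: "continuous_on (unit_space G) (fibre_one L)"
proof -
  define S where "S = {a. proj L a \<in> unit_space G} \<inter> fibre_coord L -` (- {0})"
  have "open S"
    unfolding S_def by (rule continuous_open_preimage[OF continuous_fibre_coord open_unit_fibres]) auto
  define N where "N a = lscale L (1 / fibre_coord L a) a" for a
  have N: "N a = fibre_one L (proj L a)" if "a \<in> S" for a
  proof -
    have "N a = lscale L (1 / fibre_coord L a) (lscale L (fibre_coord L a) (fibre_one L (proj L a)))"
      using that by (simp add: N_def S_def lscale_fibre_coord)
    then show ?thesis using that by (simp add: lscale_lscale lscale_one S_def)
  qed
  have "continuous_on S (fibre_coord L)"
    by (rule continuous_on_subset[OF continuous_fibre_coord]) (auto simp: S_def)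
  then have "continuous_on S (\<lambda>a. (1 / fibre_coord L a, a))"
    by (intro continuous_intros) (auto simp: S_def)
  from continuous_on_compose2[OF continuous_lscale this]
  have contN: "continuous_on S N" by (simp add: N_def)
  have "isCont (fibre_one L) x" if x: "x \<in> unit_space G" for x
    unfolding continuous_at_open
  proof (intro allI impI, elim conjE)
    fix W assume W: "open W" "fibre_one L x \<in> W"
    define W' where "W' = S \<inter> N -` W"
    have "open W'" unfolding W'_def by (rule continuous_open_preimage[OF contN \<open>open S\<close> W(1)])
    then have "open (proj L ` W')" by (rule open_proj)
    moreover have "fibre_one L x \<in> S"
      using x fibre_coord_lscale[OF x, of 1] by (simp add: S_def lscale_one)
    then have "fibre_one L x \<in> W'" using W N x by (simp add: W'_def)
    then have "x \<in> proj L ` W'" using x by (metis image_eqI proj_fibre_one)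
    moreover have "\<forall>x'\<in>proj L ` W'. fibre_one L x' \<in> W" using N by (auto simp: W'_def)
    ultimately show "\<exists>V. open V \<and> x \<in> V \<and> (\<forall>x'\<in>V. fibre_one L x' \<in> W)" by blast
  qed
  then show ?thesis by (simp add: continuous_at_imp_continuous_on)
qed

end

section \<open>The convolution algebra\<close>

lemma Gamma_cI:
  fixes L :: "('g::t2_space, 'l::topological_space) fell_bundle"
  assumes "\<And>g. proj L (f g) = g" and "continuous_on UNIV f" and "compact K"
    and "\<And>g. g \<notin> K \<Longrightarrow> f g = lzero L g"
  shows "f \<in> Gamma_c L"
proof -
  have "closure {g. f g \<noteq> lzero L g} \<subseteq> K"
    using assms(3,4) by (intro closure_minimal compact_imp_closed) auto
  then have "compact (K \<inter> closure {g. f g \<noteq> lzero L g})" using assms(3) by (intro compact_Int_closed) auto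
  then have "compact (closure {g. f g \<noteq> lzero L g})"
    using \<open>closure {g. f g \<noteq> lzero L g} \<subseteq> K\<close> by (simp add: Int_absorb1)
  with assms show ?thesis by (simp add: Gamma_c_def)
qed

lemma Gamma_cD:
  assumes "f \<in> Gamma_c L"
  shows "proj L (f g) = g" and "continuous_on UNIV f"
    and "\<exists>K. compact K \<and> (\<forall>g. g \<notin> K \<longrightarrow> f g = lzero L g)"
  using assms closure_subset[of "{g. f g \<noteq> lzero L g}"]
  by (auto simp: Gamma_c_def intro!: exI[of _ "closure {g. f g \<noteq> lzero L g}"])

text \<open>The inclusion of functions on the unit space into sections of the bundle.\<close>

definition unit_section :: "'g groupoid \<Rightarrow> ('g, 'l) fell_bundle \<Rightarrow> ('g \<Rightarrow> complex) \<Rightarrow> 'g \<Rightarrow> 'l" where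
  "unit_section G L h g =
     (if g \<in> unit_space G then lscale L (h g) (fibre_one L g) else lzero L g)"

context twisted_etale_groupoid
begin

section \<open>Closure of \<open>Gamma_c L\<close> under the operations of the *-algebra\<close>

lemma section_add_Gamma_c:
  assumes f: "f \<in> Gamma_c L" and h: "h \<in> Gamma_c L"
  shows "section_add L f h \<in> Gamma_c L"
proof -
  obtain K K' where K: "compact K" "compact K'"
    "\<And>g. g \<notin> K \<Longrightarrow> f g = lzero L g" "\<And>g. g \<notin> K' \<Longrightarrow> h g = lzero L g"
    using Gamma_cD(3)[OF f] Gamma_cD(3)[OF h] by metis
  have "continuous_on UNIV (\<lambda>g. (f g, h g))"
    using Gamma_cD(2)[OF f] Gamma_cD(2)[OF h] by (rule continuous_on_Pair)
  from continuous_on_compose2[OF continuous_ladd this] have "continuous_on UNIV (section_add L f h)"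
    using Gamma_cD(1)[OF f] Gamma_cD(1)[OF h] by (simp add: section_add_def[abs_def] image_subset_iff)
  then show ?thesis
    using K ladd_lzero_left[of "lzero L _"] Gamma_cD(1)[OF f] Gamma_cD(1)[OF h]
    by (intro Gamma_cI[of _ _ "K \<union> K'"]) (auto simp: section_add_def proj_ladd proj_lzero)
qed

lemma section_scale_Gamma_c:
  assumes f: "f \<in> Gamma_c L"
  shows "section_scale L c f \<in> Gamma_c L"
proof -
  obtain K where K: "compact K" "\<And>g. g \<notin> K \<Longrightarrow> f g = lzero L g" using Gamma_cD(3)[OF f] by metis
  have "continuous_on UNIV (\<lambda>g. (c, f g))"
    using Gamma_cD(2)[OF f] by (intro continuous_on_Pair continuous_on_const)
  from continuous_on_compose2[OF continuous_lscale this] have "continuous_on UNIV (section_scale L c f)"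
    by (simp add: section_scale_def[abs_def])
  then show ?thesis
    using K Gamma_cD(1)[OF f] by (intro Gamma_cI[of _ _ K]) (auto simp: section_scale_def proj_lscale)
qed

lemma section_star_Gamma_c:
  assumes f: "f \<in> Gamma_c L"
  shows "section_star G L f \<in> Gamma_c L"
proof -
  obtain K where K: "compact K" "\<And>g. g \<notin> K \<Longrightarrow> f g = lzero L g" using Gamma_cD(3)[OF f] by metis
  have "continuous_on UNIV (\<lambda>g. lstar L (f (ginv G g)))"
    by (rule continuous_on_compose2[OF continuous_lstar
          continuous_on_compose2[OF Gamma_cD(2)[OF f] continuous_ginv]]) auto
  moreover have "compact (ginv G ` K)"
    by (rule compact_continuous_image[OF continuous_on_subset[OF continuous_ginv] K(1)]) simp
  moreover have "section_star G L f g = lzero L g" if "g \<notin> ginv G ` K" for g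
  proof -
    have "ginv G g \<notin> K" using that by (metis ginv_ginv image_eqI)
    then show ?thesis by (simp add: section_star_def K(2))
  qed
  ultimately show ?thesis
    using Gamma_cD(1)[OF f]
    by (intro Gamma_cI[of _ _ "ginv G ` K"]) (auto simp: section_star_def[abs_def] proj_lstar)
qed

lemma proj_convolution_term:
  assumes "\<And>g. proj L (f g) = g" and "\<And>g. proj L (h g) = g" and "rng G \<gamma> = rng G g"
  shows "proj L (lmul L (f \<gamma>) (h (gmul G (ginv G \<gamma>) g))) = g"
  using assms by (simp add: proj_lmul rng_ginv_gmul gmul_ginv_cancel_left')

text \<open>The set \<open>S\<close> may be any finite set containing the first factors of all
  nonzero summands. This freedom matters because the set of nonzero summands itself varies
  irregularly with \<open>g\<close>.\<close>

lemma convolution_eq: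
  assumes f: "\<And>g. proj L (f g) = g" and h: "\<And>g. proj L (h g) = g"
    and S: "finite S" "\<And>\<gamma>. \<gamma> \<in> S \<Longrightarrow> rng G \<gamma> = rng G g"
    and nz: "\<And>\<gamma>. rng G \<gamma> = rng G g \<Longrightarrow> \<gamma> \<notin> S \<Longrightarrow> lmul L (f \<gamma>) (h (gmul G (ginv G \<gamma>) g)) = lzero L g"
  shows "convolution G L f h g
    = finprod (fibre_group L g) (\<lambda>\<gamma>. lmul L (f \<gamma>) (h (gmul G (ginv G \<gamma>) g))) S"
proof -
  interpret M: comm_monoid "fibre_group L g" by (rule comm_monoid_fibre_group)
  let ?t = "\<lambda>\<gamma>. lmul L (f \<gamma>) (h (gmul G (ginv G \<gamma>) g))"
  let ?i = "\<lambda>\<gamma>. (\<gamma>, gmul G (ginv G \<gamma>) g)"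
  define N where "N = {\<gamma>\<in>S. ?t \<gamma> \<noteq> lzero L g}"
  have carrier: "?t \<gamma> \<in> carrier (fibre_group L g)" if "\<gamma> \<in> S" for \<gamma>
    using proj_convolution_term[OF f h S(2)[OF that]] by (simp add: fibre_group_def)
  have "src G g1 = rng G g2 \<and> gmul G g1 g2 = g \<and> lmul L (f g1) (h g2) \<noteq> lzero L g \<longleftrightarrow> (g1, g2) \<in> ?i ` N"
    for g1 g2
  proof -
    have "(g1, g2) \<in> ?i ` N \<longleftrightarrow> g1 \<in> N \<and> g2 = gmul G (ginv G g1) g" by auto
    also have "\<dots> \<longleftrightarrow> rng G g1 = rng G g \<and> g2 = gmul G (ginv G g1) g \<and> lmul L (f g1) (h g2) \<noteq> lzero L g"
      using nz S(2) by (auto simp: N_def)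
    finally show ?thesis using gmul_eq_iff[of g1 g2 g] by blast
  qed
  then have "{(g1, g2). src G g1 = rng G g2 \<and> gmul G g1 g2 = g \<and> lmul L (f g1) (h g2) \<noteq> lzero L g} = ?i ` N"
    by blast
  then have "convolution G L f h g = finprod (fibre_group L g) (\<lambda>(g1, g2). lmul L (f g1) (h g2)) (?i ` N)"
    by (simp add: convolution_def)
  also have "\<dots> = finprod (fibre_group L g) ?t N"
    using carrier by (subst M.finprod_reindex) (auto simp: N_def inj_on_def)
  also have "\<dots> = finprod (fibre_group L g) ?t S"
  proof (rule M.finprod_mono_neutral_cong_left)
    show "?t i = \<one>\<^bsub>fibre_group L g\<^esub>" if "i \<in> S - N" for i using that by (simp add: N_def fibre_group_def)
  qed (use S carrier in \<open>auto simp: N_def\<close>)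
  finally show ?thesis .
qed

lemma proj_convolution:
  assumes f: "\<And>g. proj L (f g) = g" and h: "\<And>g. proj L (h g) = g"
  shows "proj L (convolution G L f h g) = g"
  unfolding convolution_def by (rule proj_finprod) (auto simp: proj_lmul f h)

text \<open>Local sections of the range map through the finitely many arrows of the support of \<open>f\<close> with
  range \<open>rng G g\<^sub>0\<close> exhaust the index set of the convolution sum at every \<open>g\<close> near \<open>g\<^sub>0\<close>.\<close>

lemma continuous_convolution:
  assumes f: "f \<in> Gamma_c L" and h: "h \<in> Gamma_c L"
  shows "continuous_on UNIV (convolution G L f h)"
proof -
  have proj_f: "\<And>g. proj L (f g) = g" and proj_h: "\<And>g. proj L (h g) = g"
    using Gamma_cD(1) f h by blast+
  obtain K where K: "compact K" "\<And>g. g \<notin> K \<Longrightarrow> f g = lzero L g" using Gamma_cD(3)[OF f] by metis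
  have "\<forall>\<gamma>. \<exists>U q. open U \<and> \<gamma> \<in> U \<and> open (rng G ` U) \<and> (\<forall>g\<in>U. q (rng G g) = g) \<and>
      continuous_on (rng G ` U) q"
    by (metis local_section)
  then obtain U q where U: "\<And>\<gamma>. open (U \<gamma>)" "\<And>\<gamma>. \<gamma> \<in> U \<gamma>" "\<And>\<gamma>. open (rng G ` U \<gamma>)"
    and q: "\<And>\<gamma> g. g \<in> U \<gamma> \<Longrightarrow> q \<gamma> (rng G g) = g" "\<And>\<gamma>. continuous_on (rng G ` U \<gamma>) (q \<gamma>)"
    by metis
  have lim: "(convolution G L f h \<longlongrightarrow> convolution G L f h g0) (nhds g0)" for g0
  proof -
    define S where "S = {\<gamma>\<in>K. rng G \<gamma> = rng G g0}"
    have S: "finite S" unfolding S_def using K(1) by (rule finite_rng_fibre)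
    \<comment> \<open>The arrow near \<open>\<gamma>\<close> that has the same range as
      \<open>g\<close>.\<close>
    define \<sigma> where "\<sigma> \<gamma> g = q \<gamma> (rng G g)" for \<gamma> g
    have lim_rng: "(rng G \<longlongrightarrow> rng G g0) (nhds g0)"
      using continuous_on_tendsto_compose[OF continuous_rng filterlim_ident] by simp
    have in_U: "\<forall>\<^sub>F g in nhds g0. \<forall>\<gamma>\<in>S. rng G g \<in> rng G ` U \<gamma>"
    proof (rule eventually_ball_finite[OF S], rule ballI)
      fix \<gamma> assume "\<gamma> \<in> S"
      then have "rng G g0 \<in> rng G ` U \<gamma>" using U(2)[of \<gamma>] by (metis (mono_tags, lifting) S_def image_eqI mem_Collect_eq)
      then show "\<forall>\<^sub>F g in nhds g0. rng G g \<in> rng G ` U \<gamma>"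
        using lim_rng U(3) by (blast intro: topological_tendstoD)
    qed
    have \<sigma>0: "\<sigma> \<gamma> g0 = \<gamma>" if "\<gamma> \<in> S" for \<gamma>
      using that q(1)[OF U(2)[of \<gamma>]] by (simp add: S_def \<sigma>_def)
    have lim_\<sigma>: "(\<sigma> \<gamma> \<longlongrightarrow> \<gamma>) (nhds g0)" if "\<gamma> \<in> S" for \<gamma>
    proof -
      have "((\<lambda>g. q \<gamma> (rng G g)) \<longlongrightarrow> q \<gamma> (rng G g0)) (nhds g0)"
        using eventually_nhds_x_imp_x[OF in_U] that
        by (intro continuous_on_tendsto_compose[OF q(2) lim_rng] eventually_mono[OF in_U]) auto
      then show ?thesis using \<sigma>0[OF that] by (simp add: \<sigma>_def[abs_def])
    qed
    have rng_\<sigma>: "\<forall>\<^sub>F g in nhds g0. \<forall>\<gamma>\<in>S. rng G (\<sigma> \<gamma> g) = rng G g"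
      using in_U by eventually_elim (auto simp: \<sigma>_def q(1))
    \<comment> \<open>Disjoint neighbourhoods of the arrows in \<open>S\<close> keep the moved
      arrows distinct, so reindexing the sum by \<open>S\<close> counts no summand twice.\<close>
    have inj_\<sigma>: "\<forall>\<^sub>F g in nhds g0. \<forall>\<gamma>\<in>S. \<forall>\<gamma>'\<in>S. \<gamma> \<noteq> \<gamma>' \<longrightarrow> \<sigma> \<gamma> g \<noteq> \<sigma> \<gamma>' g"
    proof (intro eventually_ball_finite S ballI)
      fix \<gamma> \<gamma>' assume \<gamma>: "\<gamma> \<in> S" "\<gamma>' \<in> S"
      show "\<forall>\<^sub>F g in nhds g0. \<gamma> \<noteq> \<gamma>' \<longrightarrow> \<sigma> \<gamma> g \<noteq> \<sigma> \<gamma>' g"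
      proof (cases "\<gamma> = \<gamma>'")
        case False
        then obtain A B where AB: "open A" "open B" "\<gamma> \<in> A" "\<gamma>' \<in> B" "A \<inter> B = {}"
          using separation_t2 by metis
        have "\<forall>\<^sub>F g in nhds g0. \<sigma> \<gamma> g \<in> A" "\<forall>\<^sub>F g in nhds g0. \<sigma> \<gamma>' g \<in> B"
          using lim_\<sigma>[OF \<gamma>(1)] lim_\<sigma>[OF \<gamma>(2)] AB by (blast intro: topological_tendstoD)+
        then show ?thesis by eventually_elim (use AB in auto)
      qed simp
    qed
    \<comment> \<open>The part of \<open>K\<close> outside the chosen neighbourhoods is compact, so
      its range image is closed; it misses \<open>rng G g0\<close> by the choice of
      \<open>S\<close>.\<close>
    have cover: "\<forall>\<^sub>F g in nhds g0. \<forall>\<gamma>\<in>K. rng G \<gamma> = rng G g \<longrightarrow> \<gamma> \<in> (\<Union>\<delta>\<in>S. U \<delta>)"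
    proof -
      let ?C = "rng G ` (K - (\<Union>\<delta>\<in>S. U \<delta>))"
      have "compact (K - (\<Union>\<delta>\<in>S. U \<delta>))" using K(1) U(1) by (intro compact_diff) auto
      then have "compact ?C" by (intro compact_continuous_image continuous_on_subset[OF continuous_rng]) auto
      then have "open (- ?C)" by (simp add: compact_imp_closed open_Compl)
      moreover have "rng G g0 \<in> - ?C" using U(2) by (force simp: S_def)
      ultimately have "\<forall>\<^sub>F g in nhds g0. rng G g \<in> - ?C" using lim_rng by (blast intro: topological_tendstoD)
      then show ?thesis
      proof eventually_elim
        case (elim g)
        show ?case
        proof (intro ballI impI, rule ccontr)
          fix \<gamma> assume "\<gamma> \<in> K" "rng G \<gamma> = rng G g" "\<gamma> \<notin> (\<Union>\<delta>\<in>S. U \<delta>)"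
          then have "rng G \<gamma> \<in> ?C" by (intro imageI DiffI)
          with elim \<open>rng G \<gamma> = rng G g\<close> show False by simp
        qed
      qed
    qed
    define T where "T g \<gamma> = lmul L (f (\<sigma> \<gamma> g)) (h (gmul G (ginv G (\<sigma> \<gamma> g)) g))" for g \<gamma>
    have conv: "\<forall>\<^sub>F g in nhds g0. convolution G L f h g = finprod (fibre_group L g) (T g) S"
      using rng_\<sigma> inj_\<sigma> cover
    proof eventually_elim
      case (elim g)
      interpret M: comm_monoid "fibre_group L g" by (rule comm_monoid_fibre_group)
      have "convolution G L f h g = finprod (fibre_group L g)
          (\<lambda>\<gamma>. lmul L (f \<gamma>) (h (gmul G (ginv G \<gamma>) g))) ((\<lambda>\<gamma>. \<sigma> \<gamma> g) ` S)"
      proof (rule convolution_eq[OF proj_f proj_h])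
        fix \<gamma> assume \<gamma>: "rng G \<gamma> = rng G g" "\<gamma> \<notin> (\<lambda>\<gamma>. \<sigma> \<gamma> g) ` S"
        have "\<gamma> \<notin> K"
        proof
          assume "\<gamma> \<in> K"
          then obtain \<delta> where "\<delta> \<in> S" "\<gamma> \<in> U \<delta>" using elim(3) \<gamma>(1) by blast
          then have "\<gamma> = \<sigma> \<delta> g" using q(1)[of \<gamma> \<delta>] \<gamma>(1) by (simp add: \<sigma>_def)
          with \<open>\<delta> \<in> S\<close> \<gamma>(2) show False by blast
        qed
        then show "lmul L (f \<gamma>) (h (gmul G (ginv G \<gamma>) g)) = lzero L g"
          using \<gamma>(1) by (simp add: K(2) proj_h rng_ginv_gmul gmul_ginv_cancel_left')
      qed (use S elim(1) in auto)
      also have "\<dots> = finprod (fibre_group L g) (T g) S"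
        unfolding T_def using elim proj_convolution_term[OF proj_f proj_h]
        by (intro M.finprod_reindex) (auto simp: inj_on_def fibre_group_def)
      finally show ?case .
    qed
    have lim_T: "((\<lambda>g. T g \<gamma>) \<longlongrightarrow> T g0 \<gamma>) (nhds g0)" if \<gamma>: "\<gamma> \<in> S" for \<gamma>
    proof -
      have lim_inv: "((\<lambda>g. ginv G (\<sigma> \<gamma> g)) \<longlongrightarrow> ginv G \<gamma>) (nhds g0)"
        using continuous_on_tendsto_compose[OF continuous_ginv lim_\<sigma>[OF \<gamma>]] by simp
      have "((\<lambda>g. gmul G (ginv G (\<sigma> \<gamma> g)) g) \<longlongrightarrow> gmul G (ginv G \<gamma>) g0) (nhds g0)"
        using continuous_on_tendsto_compose[OF continuous_gmul tendsto_Pair[OF lim_inv filterlim_ident]]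
          \<gamma> eventually_mono[OF rng_\<sigma>] by (simp add: src_ginv S_def)
      then have lim_h: "((\<lambda>g. h (gmul G (ginv G (\<sigma> \<gamma> g)) g)) \<longlongrightarrow> h (gmul G (ginv G \<gamma>) g0)) (nhds g0)"
        using continuous_on_tendsto_compose[OF Gamma_cD(2)[OF h]] by simp
      have lim_f: "((\<lambda>g. f (\<sigma> \<gamma> g)) \<longlongrightarrow> f \<gamma>) (nhds g0)"
        using continuous_on_tendsto_compose[OF Gamma_cD(2)[OF f] lim_\<sigma>[OF \<gamma>]] by simp
      have "\<forall>\<^sub>F g in nhds g0. src G (\<sigma> \<gamma> g) = rng G (gmul G (ginv G (\<sigma> \<gamma> g)) g)"
        using rng_\<sigma> by eventually_elim (use \<gamma> in \<open>simp add: rng_ginv_gmul\<close>)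
      moreover have "src G \<gamma> = rng G (gmul G (ginv G \<gamma>) g0)" using \<gamma> by (simp add: S_def rng_ginv_gmul)
      ultimately show ?thesis
        using continuous_on_tendsto_compose[OF continuous_lmul tendsto_Pair[OF lim_f lim_h]]
        by (simp add: T_def \<sigma>0[OF \<gamma>] proj_f proj_h)
    qed
    have "((\<lambda>g. finprod (fibre_group L g) (T g) S) \<longlongrightarrow> finprod (fibre_group L g0) (T g0) S) (nhds g0)"
    proof (rule tendsto_finprod[OF S lim_T])
      show "\<forall>\<^sub>F g in nhds g0. \<forall>\<gamma>\<in>S. proj L (T g \<gamma>) = g"
        using rng_\<sigma> by eventually_elim (simp add: T_def proj_convolution_term[OF proj_f proj_h])
    qed
    then have "(convolution G L f h \<longlongrightarrow> finprod (fibre_group L g0) (T g0) S) (nhds g0)"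
      by (rule Lim_transform_eventually) (use conv in \<open>eventually_elim, simp\<close>)
    then show ?thesis by (simp add: eventually_nhds_x_imp_x[OF conv])
  qed
  show ?thesis
    unfolding continuous_on_def at_within_def by (auto intro: tendsto_mono[OF inf_le1 lim])
qed

text \<open>The support lies in the product of the two supports, which is compact because composable
  pairs form a closed set in the Hausdorff case.\<close>

lemma convolution_Gamma_c:
  assumes f: "f \<in> Gamma_c L" and h: "h \<in> Gamma_c L"
  shows "convolution G L f h \<in> Gamma_c L"
proof -
  have proj_f: "\<And>g. proj L (f g) = g" and proj_h: "\<And>g. proj L (h g) = g"
    using Gamma_cD(1) f h by blast+
  obtain K K' where K: "compact K" "compact K'"
    "\<And>g. g \<notin> K \<Longrightarrow> f g = lzero L g" "\<And>g. g \<notin> K' \<Longrightarrow> h g = lzero L g"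
    using Gamma_cD(3)[OF f] Gamma_cD(3)[OF h] by metis
  let ?C = "{(g1, g2). src G g1 = rng G g2}"
  have "continuous_on UNIV (\<lambda>p. src G (fst p))" "continuous_on UNIV (\<lambda>p. rng G (snd p))"
    by (auto intro!: continuous_on_compose2[OF continuous_src] continuous_on_compose2[OF continuous_rng]
        continuous_intros)
  then have "closed {p. src G (fst p) = rng G (snd p)}" by (rule closed_Collect_eq)
  moreover have "{p. src G (fst p) = rng G (snd p)} = ?C" by auto
  ultimately have "closed ?C" by simp
  then have "compact ((K \<times> K') \<inter> ?C)" by (rule compact_Int_closed[OF compact_Times[OF K(1,2)]])
  then have comp: "compact ((\<lambda>(g1, g2). gmul G g1 g2) ` ((K \<times> K') \<inter> ?C))"
    by (intro compact_continuous_image continuous_on_subset[OF continuous_gmul]) auto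
  have "convolution G L f h g = lzero L g" if g: "g \<notin> (\<lambda>(g1, g2). gmul G g1 g2) ` ((K \<times> K') \<inter> ?C)" for g
  proof -
    have "lmul L (f \<gamma>) (h (gmul G (ginv G \<gamma>) g)) = lzero L g" if \<gamma>: "rng G \<gamma> = rng G g" for \<gamma>
    proof (cases "\<gamma> \<in> K \<and> gmul G (ginv G \<gamma>) g \<in> K'")
      case True
      then have "(\<gamma>, gmul G (ginv G \<gamma>) g) \<in> (K \<times> K') \<inter> ?C" using \<gamma> by (simp add: rng_ginv_gmul)
      then have "g \<in> (\<lambda>(g1, g2). gmul G g1 g2) ` ((K \<times> K') \<inter> ?C)"
        using gmul_ginv_cancel_left'[OF \<gamma>] by force
      with g show ?thesis by blast
    next
      case False
      then show ?thesis
        using \<gamma> K(3)[of \<gamma>] K(4)[of "gmul G (ginv G \<gamma>) g"]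
        by (auto simp: proj_f proj_h rng_ginv_gmul gmul_ginv_cancel_left')
    qed
    then have "convolution G L f h g
        = finprod (fibre_group L g) (\<lambda>\<gamma>. lmul L (f \<gamma>) (h (gmul G (ginv G \<gamma>) g))) {}"
      by (intro convolution_eq proj_f proj_h) auto
    then show ?thesis
      by (simp add: comm_monoid.finprod_empty[OF comm_monoid_fibre_group]) (simp add: fibre_group_def)
  qed
  with comp show ?thesis
    using continuous_convolution[OF f h] proj_convolution[OF proj_f proj_h] by (intro Gamma_cI) auto
qed

lemma convolution_single:
  assumes f: "\<And>g. proj L (f g) = g" and h: "\<And>g. proj L (h g) = g" and \<delta>: "rng G \<delta> = rng G g"
    and nz: "\<And>\<gamma>. rng G \<gamma> = rng G g \<Longrightarrow> \<gamma> \<noteq> \<delta> \<Longrightarrow> lmul L (f \<gamma>) (h (gmul G (ginv G \<gamma>) g)) = lzero L g"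
  shows "convolution G L f h g = lmul L (f \<delta>) (h (gmul G (ginv G \<delta>) g))"
proof -
  let ?t = "\<lambda>\<gamma>. lmul L (f \<gamma>) (h (gmul G (ginv G \<gamma>) g))"
  have pr: "proj L (?t \<delta>) = g" by (rule proj_convolution_term[OF f h \<delta>])
  have "convolution G L f h g = finprod (fibre_group L g) ?t {\<delta>}"
    by (rule convolution_eq[OF f h]) (use \<delta> nz in auto)
  also have "\<dots> = ladd L (?t \<delta>) (finprod (fibre_group L g) ?t {})"
    by (rule finprod_fibre_insert) (use pr in auto)
  also have "finprod (fibre_group L g) ?t {} = lzero L (proj L (?t \<delta>))"
    by (simp only: pr comm_monoid.finprod_empty[OF comm_monoid_fibre_group]) (simp add: fibre_group_def)
  finally show ?thesis by (simp only: ladd_lzero)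
qed

section \<open>Functions on the unit space as sections, and restriction of sections to the unit
  space\<close>

lemma proj_unit_section: "proj L (unit_section G L h g) = g"
  by (simp add: unit_section_def proj_lscale proj_lzero)

lemma unit_section_Gamma_c:
  assumes h: "h \<in> Cc (unit_space G)"
  shows "unit_section G L h \<in> Gamma_c L"
proof -
  obtain K where K: "compact K" "\<And>x. x \<notin> K \<Longrightarrow> h x = 0" using h by (auto simp: Cc_def)
  have "continuous_on (unit_space G) (\<lambda>g. (h g, fibre_one L g))"
    using h continuous_fibre_one by (auto simp: Cc_def intro!: continuous_on_Pair)
  from continuous_on_compose2[OF continuous_lscale this]
  have "continuous_on (unit_space G) (unit_section G L h)"
    by (subst continuous_on_cong[OF refl]) (auto simp: unit_section_def)
  moreover have "continuous_on (- unit_space G) (unit_section G L h)"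
    using continuous_on_subset[OF continuous_lzero]
    by (subst continuous_on_cong[OF refl]) (auto simp: unit_section_def)
  ultimately have "continuous_on (unit_space G \<union> - unit_space G) (unit_section G L h)"
    using open_unit_space closed_unit_space by (intro continuous_on_open_Un) auto
  then have "continuous_on UNIV (unit_section G L h)" by (simp only: Compl_partition)
  then show ?thesis
    using K by (intro Gamma_cI[of _ _ K])
      (auto simp: proj_unit_section, auto simp: unit_section_def lscale_zero_left)
qed

lemma convolution_unit_section:
  assumes f: "\<And>g. proj L (f g) = g"
  shows "convolution G L (unit_section G L h) f g = lscale L (h (rng G g)) (f g)"
proof -
  let ?x = "rng G g"
  have "convolution G L (unit_section G L h) f g
      = lmul L (unit_section G L h ?x) (f (gmul G (ginv G ?x) g))"
  proof (rule convolution_single[OF proj_unit_section f])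
    fix \<gamma> assume \<gamma>: "rng G \<gamma> = rng G g" "\<gamma> \<noteq> rng G g"
    then have "\<gamma> \<notin> unit_space G" by auto
    then show "lmul L (unit_section G L h \<gamma>) (f (gmul G (ginv G \<gamma>) g)) = lzero L g"
      using \<gamma> by (simp add: unit_section_def f rng_ginv_gmul gmul_ginv_cancel_left')
  qed (simp add: rng_rng)
  also have "\<dots> = lscale L (h ?x) (f g)"
    by (simp add: unit_section_def gmul_rng lmul_lscale_left f fibre_one_lmul src_rng)
  finally show ?thesis .
qed

lemma section_star_unit_section:
  "section_star G L (unit_section G L h) = unit_section G L (\<lambda>x. cnj (h x))"
proof
  fix g
  have "ginv G g \<in> unit_space G \<longleftrightarrow> g \<in> unit_space G" by (metis ginv_ginv ginv_unit)
  then show "section_star G L (unit_section G L h) g = unit_section G L (\<lambda>x. cnj (h x)) g"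
    by (simp add: section_star_def unit_section_def lstar_lscale)
qed

lemma unit_restriction_Cc:
  assumes f: "f \<in> Gamma_c L"
  shows "unit_restriction G L f \<in> Cc (unit_space G)"
proof -
  obtain K where K: "compact K" "\<And>g. g \<notin> K \<Longrightarrow> f g = lzero L g" using Gamma_cD(3)[OF f] by metis
  have "continuous_on (unit_space G) (\<lambda>x. fibre_coord L (f x))"
    by (rule continuous_on_compose2[OF continuous_fibre_coord continuous_on_subset[OF Gamma_cD(2)[OF f]]])
      (auto simp: Gamma_cD(1)[OF f])
  then have "continuous_on (unit_space G) (unit_restriction G L f)"
    by (subst continuous_on_cong[OF refl]) (auto simp: unit_restriction_def)
  moreover have "compact (K \<inter> unit_space G)" using K(1) closed_unit_space by (rule compact_Int_closed)
  moreover have "unit_restriction G L f x = 0" if "x \<notin> K \<inter> unit_space G" for x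
    using that K(2)[of x] by (auto simp: unit_restriction_def)
  ultimately show ?thesis by (auto simp: Cc_def)
qed

text \<open>Over a unit, \<open>gmul G g1 g2 = x\<close> forces \<open>g2 = ginv G g1\<close>, so
  every summand has the form \<open>lmul L a (lstar L a)\<close>.\<close>

lemma unit_restriction_mult_star_nonneg:
  assumes f: "\<And>g. proj L (f g) = g"
  shows "unit_restriction G L (convolution G L f (section_star G L f)) x \<in> \<real>\<^sub>\<ge>\<^sub>0"
proof (cases "x \<in> unit_space G")
  case x: True
  have "fibre_coord L (convolution G L f (section_star G L f) x) \<in> \<real>\<^sub>\<ge>\<^sub>0"
    unfolding convolution_def
  proof (rule fibre_coord_finprod_nonneg[OF x])
    fix p assume "p \<in> {(g1, g2). src G g1 = rng G g2 \<and> gmul G g1 g2 = x \<and>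
      lmul L (f g1) (section_star G L f g2) \<noteq> lzero L x}"
    then obtain g1 g2 where p: "p = (g1, g2)" "src G g1 = rng G g2" "gmul G g1 g2 = x" by blast
    then have "rng G g1 = x" "g2 = gmul G (ginv G g1) x" using gmul_eq_iff[of g1 g2 x] x by auto
    then have "g2 = ginv G g1" by (metis gmul_src src_ginv)
    then show "proj L (case p of (g1, g2) \<Rightarrow> lmul L (f g1) (section_star G L f g2)) = x \<and>
      fibre_coord L (case p of (g1, g2) \<Rightarrow> lmul L (f g1) (section_star G L f g2)) \<in> \<real>\<^sub>\<ge>\<^sub>0"
      using p \<open>rng G g1 = x\<close> fibre_coord_lmul_lstar_nonneg[of "f g1"]
      by (simp add: section_star_def proj_lmul proj_lstar f gmul_ginv_right)
  qed
  then show ?thesis using x by (simp add: unit_restriction_def)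
qed (simp add: unit_restriction_def)

text \<open>\<open>f x\<close> is the value at \<open>x\<close> of the regular representation of \<open>f\<close> applied to the unit vector at
  \<open>x\<close>.\<close>

lemma lnorm_le_regular_rep_norm:
  assumes f: "f \<in> Gamma_c L" and x: "x \<in> unit_space G"
  shows "ennreal (lnorm L (f x)) \<le> regular_rep_norm G L f"
proof -
  obtain K where K: "compact K" "\<And>g. g \<notin> K \<Longrightarrow> f g = lzero L g" using Gamma_cD(3)[OF f] by metis
  have proj_f: "\<And>g. proj L (f g) = g" using Gamma_cD(1)[OF f] .
  define \<xi> where "\<xi> g = (if g = x then fibre_one L x else lzero L g)" for g
  have proj_\<xi>: "\<And>g. proj L (\<xi> g) = g" using x by (simp add: \<xi>_def proj_lzero)
  have \<xi>_norm: "(lnorm L (\<xi> g))\<^sup>2 = (if g = x then 1 else 0)" for g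
    using x by (simp add: \<xi>_def)
  have "((\<lambda>g. (lnorm L (\<xi> g))\<^sup>2) has_sum 1) {x}" by (rule has_sum_finiteI) (auto simp: \<xi>_norm)
  then have hs: "((\<lambda>g. (lnorm L (\<xi> g))\<^sup>2) has_sum 1) UNIV"
    by (rule has_sum_cong_neutral[THEN iffD1, rotated -1]) (auto simp: \<xi>_norm)
  have \<xi>_l2: "\<xi> \<in> l2_sections L" "l2_section_norm L \<xi> \<le> 1"
    using hs proj_\<xi> by (auto simp: l2_sections_def l2_section_norm_def summable_on_def infsumI)
  have eq_x: "src G g = x \<and> \<gamma> = g" if "rng G \<gamma> = rng G g" "gmul G (ginv G \<gamma>) g = x" for \<gamma> g
  proof -
    have "src G \<gamma> = x" using rng_ginv_gmul[OF that(1)] that(2) x by simp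
    moreover have "gmul G \<gamma> x = g" using gmul_ginv_cancel_left'[OF that(1)] that(2) by simp
    ultimately show ?thesis using gmul_src[of \<gamma>] by simp
  qed
  define \<eta> where "\<eta> = regular_rep G L f \<xi>"
  have \<eta>_x: "\<eta> x = f x"
  proof -
    have "\<eta> x = lmul L (f x) (\<xi> (gmul G (ginv G x) x))"
      unfolding \<eta>_def regular_rep_def
    proof (rule convolution_single[OF proj_f proj_\<xi>])
      fix \<gamma> assume \<gamma>: "rng G \<gamma> = rng G x" "\<gamma> \<noteq> x"
      then have "gmul G (ginv G \<gamma>) x \<noteq> x" using eq_x by blast
      then show "lmul L (f \<gamma>) (\<xi> (gmul G (ginv G \<gamma>) x)) = lzero L x"
        using \<gamma> by (simp add: \<xi>_def proj_f rng_ginv_gmul gmul_ginv_cancel_left')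
    qed simp
    then show ?thesis using x by (simp add: \<xi>_def mult_fibre_one proj_f)
  qed
  have \<eta>_0: "\<eta> g = lzero L g" if "g \<notin> {g\<in>K. src G g = x}" for g
  proof -
    have "\<eta> g = lmul L (f g) (\<xi> (gmul G (ginv G g) g))"
      unfolding \<eta>_def regular_rep_def
    proof (rule convolution_single[OF proj_f proj_\<xi>])
      fix \<gamma> assume \<gamma>: "rng G \<gamma> = rng G g" "\<gamma> \<noteq> g"
      then have "gmul G (ginv G \<gamma>) g \<noteq> x" using eq_x by blast
      then show "lmul L (f \<gamma>) (\<xi> (gmul G (ginv G \<gamma>) g)) = lzero L g"
        using \<gamma> by (simp add: \<xi>_def proj_f rng_ginv_gmul gmul_ginv_cancel_left')
    qed simp
    then have \<eta>: "\<eta> g = lmul L (f g) (\<xi> (src G g))" by (simp add: gmul_ginv_left)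
    show ?thesis
    proof (cases "src G g = x")
      case True
      then have "f g = lzero L g" using that K(2) by blast
      then show ?thesis using \<eta> proj_\<xi> by (simp add: rng_src gmul_src)
    next
      case False
      then show ?thesis using \<eta> by (simp add: \<xi>_def proj_f rng_src gmul_src)
    qed
  qed
  \<comment> \<open>Summability has to be established: otherwise the infinite sum would be 0 by
    convention and could not bound its term at \<open>x\<close>.\<close>
  have "finite {g\<in>K. src G g = x}" using K(1) by (rule finite_src_fibre)
  then have "(\<lambda>g. (lnorm L (\<eta> g))\<^sup>2) summable_on {g\<in>K. src G g = x}" by (rule summable_on_finite)
  then have sm: "(\<lambda>g. (lnorm L (\<eta> g))\<^sup>2) summable_on UNIV"
    by (rule summable_on_cong_neutral[THEN iffD1, rotated -1]) (use \<eta>_0 in auto)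
  have "(\<Sum>\<^sub>\<infinity>g\<in>{x}. (lnorm L (\<eta> g))\<^sup>2) \<le> (\<Sum>\<^sub>\<infinity>g. (lnorm L (\<eta> g))\<^sup>2)"
    by (rule infsum_mono_neutral[OF summable_on_finite sm]) auto
  then have "lnorm L (f x) \<le> l2_section_norm L \<eta>"
    by (simp add: l2_section_norm_def \<eta>_x real_le_rsqrt)
  then have "ennreal (lnorm L (f x)) \<le> ennreal (l2_section_norm L (regular_rep G L f \<xi>))"
    by (simp add: \<eta>_def ennreal_leI)
  also have "\<dots> \<le> regular_rep_norm G L f"
    unfolding regular_rep_norm_def by (rule SUP_upper) (use \<xi>_l2 in simp)
  finally show ?thesis .
qed

end

section \<open>The completion and its faithful representation\<close>

text \<open>Multiplying \<open>x\<close> by the conjugate of the inner product makes the latter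
  real, so the bound for real parts applies.\<close>

lemma cmod_cinner_le: "cmod (cinner x y) \<le> norm x * norm (y::'a::complex_hilbert_space)"
proof (cases "cinner x y = 0")
  case False
  let ?c = "cinner x y"
  have "cinner (scaleC (cnj ?c) x) y = complex_of_real ((cmod ?c)\<^sup>2)"
    by (simp only: cinner_scaleC_left mult.commute[of "cnj ?c"] complex_norm_square)
  then have "(cmod ?c)\<^sup>2 \<le> norm (scaleC (cnj ?c) x) * norm y"
    using Re_cinner_le[of "scaleC (cnj ?c) x" y] by simp
  then show ?thesis using False by (simp add: norm_scaleC power2_eq_square mult.assoc)
qed simp

lemma bounded_linear_cinner_left: "bounded_linear (\<lambda>x. cinner x (y::'a::complex_hilbert_space))"
  by (rule bounded_linear_intro[where K = "norm y"])
    (auto simp: cinner_add_left cinner_scaleR_left scaleR_conv_of_real cmod_cinner_le)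

lemma bounded_linear_cinner_right: "bounded_linear (\<lambda>y. cinner (x::'a::complex_hilbert_space) y)"
  by (rule bounded_linear_intro[where K = "norm x"])
    (auto simp: cinner_add_right cinner_scaleR_right scaleR_conv_of_real cmod_cinner_le mult.commute[of _ "norm x"])

lemma scaleC_zero: "scaleC 0 x = (0::'a::complex_normed_space)"
  using scaleR_eq_scaleC[of 0 x] by simp

lemma scaleC_minus_one: "scaleC (- 1) x = - (x::'a::complex_normed_space)"
  using scaleR_eq_scaleC[of "- 1" x] by simp

locale completed_groupoid_algebra = twisted_etale_groupoid G L
  for G :: "'g::t2_space groupoid" and L :: "('g, 'l::topological_space) fell_bundle" +
  fixes \<pi> :: "('g \<Rightarrow> 'l) \<Rightarrow> 'h::complex_hilbert_space \<Rightarrow> 'h"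
    and \<iota> :: "('g \<Rightarrow> 'l) \<Rightarrow> 'a::cstar_algebra"
  assumes representation: "star_representation G L \<pi>"
    and weak_containment: "weakly_contains_regular G L \<pi>"
    and completion: "cstar_completion G L \<pi> \<iota>"
begin

lemma \<iota>_add: "f \<in> Gamma_c L \<Longrightarrow> h \<in> Gamma_c L \<Longrightarrow> \<iota> (section_add L f h) = \<iota> f + \<iota> h"
  and \<iota>_scale: "f \<in> Gamma_c L \<Longrightarrow> \<iota> (section_scale L c f) = scaleC c (\<iota> f)"
  and \<iota>_mult: "f \<in> Gamma_c L \<Longrightarrow> h \<in> Gamma_c L \<Longrightarrow> \<iota> (convolution G L f h) = \<iota> f * \<iota> h"
  and \<iota>_star: "f \<in> Gamma_c L \<Longrightarrow> \<iota> (section_star G L f) = star (\<iota> f)"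
  and norm_\<iota>: "f \<in> Gamma_c L \<Longrightarrow> norm (\<iota> f) = onorm (\<pi> f)"
  and closure_\<iota>: "closure (\<iota> ` Gamma_c L) = UNIV"
  using completion unfolding cstar_completion_def by blast+

lemma bounded_linear_\<pi>: "f \<in> Gamma_c L \<Longrightarrow> bounded_linear (\<pi> f)"
  and \<pi>_add: "f \<in> Gamma_c L \<Longrightarrow> h \<in> Gamma_c L \<Longrightarrow> \<pi> (section_add L f h) v = \<pi> f v + \<pi> h v"
  and \<pi>_scale: "f \<in> Gamma_c L \<Longrightarrow> \<pi> (section_scale L c f) v = scaleC c (\<pi> f v)"
  and \<pi>_mult: "f \<in> Gamma_c L \<Longrightarrow> h \<in> Gamma_c L \<Longrightarrow> \<pi> (convolution G L f h) v = \<pi> f (\<pi> h v)"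
  and \<pi>_star: "f \<in> Gamma_c L \<Longrightarrow> cinner (\<pi> (section_star G L f) v) w = cinner v (\<pi> f w)"
  using representation unfolding star_representation_def by blast+

lemma norm_\<pi>_le: "f \<in> Gamma_c L \<Longrightarrow> norm (\<pi> f v) \<le> norm (\<iota> f) * norm v"
  using onorm[OF bounded_linear_\<pi>] by (simp add: norm_\<iota>)

lemma section_diff:
  assumes "f \<in> Gamma_c L" and "h \<in> Gamma_c L"
  obtains d where "d \<in> Gamma_c L" and "\<iota> d = \<iota> f - \<iota> h" and "\<And>v. \<pi> d v = \<pi> f v - \<pi> h v"
    and "\<And>g. d g = ladd L (f g) (lscale L (- 1) (h g))"
proof (rule that[of "section_add L f (section_scale L (- 1) h)"])
qed (use assms in \<open>auto simp: section_add_Gamma_c section_scale_Gamma_c \<iota>_add \<iota>_scale \<pi>_add \<pi>_scale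
  scaleC_minus_one section_add_def section_scale_def\<close>)

lemma norm_\<pi>_diff_le:
  assumes "f \<in> Gamma_c L" and "h \<in> Gamma_c L"
  shows "norm (\<pi> f v - \<pi> h v) \<le> norm (\<iota> f - \<iota> h) * norm v"
  using section_diff[OF assms] norm_\<pi>_le by metis

text \<open>For the difference \<open>d\<close>, the value at \<open>x\<close> is bounded by the
  norm of the regular representation, hence by \<open>onorm (\<pi> d)\<close>; this is where weak
  containment enters. The bound is uniform in \<open>x\<close>, so norm convergence in the
  completion yields uniform convergence of the restrictions.\<close>

lemma unit_restriction_diff_le:
  assumes f: "f \<in> Gamma_c L" and h: "h \<in> Gamma_c L"
  shows "cmod (unit_restriction G L f x - unit_restriction G L h x) \<le> norm (\<iota> f - \<iota> h)"
proof (cases "x \<in> unit_space G")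
  case x: True
  obtain d where d: "d \<in> Gamma_c L" "\<iota> d = \<iota> f - \<iota> h" "d x = ladd L (f x) (lscale L (- 1) (h x))"
    using section_diff[OF f h] by metis
  have "fibre_coord L (d x) = fibre_coord L (f x) - fibre_coord L (h x)"
    using x Gamma_cD(1)[OF f] Gamma_cD(1)[OF h]
    by (simp add: d(3) fibre_coord_ladd fibre_coord_scale proj_lscale)
  then have "cmod (unit_restriction G L f x - unit_restriction G L h x) = cmod (fibre_coord L (d x))"
    using x by (simp add: unit_restriction_def)
  also have "\<dots> = lnorm L (d x)" using x Gamma_cD(1)[OF d(1)] by (simp add: cmod_fibre_coord)
  also have "\<dots> \<le> norm (\<iota> d)"
  proof -
    have "ennreal (lnorm L (d x)) \<le> ennreal (onorm (\<pi> d))"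
      using lnorm_le_regular_rep_norm[OF d(1) x] weak_containment d(1)
      unfolding weakly_contains_regular_def by (meson order_trans)
    then show ?thesis by (simp add: norm_\<iota>[OF d(1)] ennreal_le_iff onorm_pos_le[OF bounded_linear_\<pi>[OF d(1)]])
  qed
  finally show ?thesis by (simp add: d(2))
qed (simp add: unit_restriction_def)

lemma dense_sequence:
  obtains F where "\<And>n. F n \<in> Gamma_c L" and "(\<lambda>n. \<iota> (F n)) \<longlonglongrightarrow> x"
proof -
  have "x \<in> closure (\<iota> ` Gamma_c L)" by (simp add: closure_\<iota>)
  then obtain y where y: "\<forall>n. y n \<in> \<iota> ` Gamma_c L" "y \<longlonglongrightarrow> x" unfolding closure_sequential by blast
  then have "\<forall>n. \<exists>f. f \<in> Gamma_c L \<and> y n = \<iota> f" by blast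
  then obtain F where F: "\<And>n. F n \<in> Gamma_c L" "\<And>n. y n = \<iota> (F n)" by metis
  then have "y = (\<lambda>n. \<iota> (F n))" by blast
  with y(2) that[of F] F(1) show ?thesis by simp
qed

text \<open>Extension of \<open>\<pi>\<close> by continuity; \<open>extension_lim\<close> shows that
  the chosen sequence does not influence the value.\<close>

definition extension :: "'a \<Rightarrow> 'h \<Rightarrow> 'h" where
  "extension x v = lim (\<lambda>n. \<pi> ((SOME F. (\<forall>n. F n \<in> Gamma_c L) \<and> (\<lambda>n. \<iota> (F n)) \<longlonglongrightarrow> x) n) v)"

lemma extension_lim:
  assumes F: "\<And>n. F n \<in> Gamma_c L" and lim: "(\<lambda>n. \<iota> (F n)) \<longlonglongrightarrow> x"
  shows "(\<lambda>n. \<pi> (F n) v) \<longlonglongrightarrow> extension x v"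
proof -
  define E where "E = (SOME F. (\<forall>n. F n \<in> Gamma_c L) \<and> (\<lambda>n. \<iota> (F n)) \<longlonglongrightarrow> x)"
  have "\<exists>F. (\<forall>n. F n \<in> Gamma_c L) \<and> (\<lambda>n. \<iota> (F n)) \<longlonglongrightarrow> x" using assms by blast
  from someI_ex[OF this] have E: "\<And>n. E n \<in> Gamma_c L" "(\<lambda>n. \<iota> (E n)) \<longlonglongrightarrow> x" by (auto simp: E_def)
  have "Cauchy (\<lambda>n. \<pi> (E n) v)"
  proof (rule metric_CauchyI)
    fix e :: real assume e: "0 < e"
    have "Cauchy (\<lambda>n. \<iota> (E n))" using E(2) by (rule LIMSEQ_imp_Cauchy)
    moreover have "0 < e / (norm v + 1)" using e by (simp add: add_nonneg_pos)
    ultimately obtain M where M: "\<And>m n. M \<le> m \<Longrightarrow> M \<le> n \<Longrightarrow> dist (\<iota> (E m)) (\<iota> (E n)) < e / (norm v + 1)"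
      unfolding Cauchy_def by blast
    have "dist (\<pi> (E m) v) (\<pi> (E n) v) < e" if mn: "M \<le> m" "M \<le> n" for m n
    proof -
      have "dist (\<pi> (E m) v) (\<pi> (E n) v) \<le> norm (\<iota> (E m) - \<iota> (E n)) * norm v"
        unfolding dist_norm by (rule norm_\<pi>_diff_le[OF E(1) E(1)])
      also have "\<dots> \<le> norm (\<iota> (E m) - \<iota> (E n)) * (norm v + 1)" by (simp add: mult_left_mono)
      also have "\<dots> < e"
        using M[OF mn] by (simp add: dist_norm pos_less_divide_eq add_nonneg_pos)
      finally show ?thesis .
    qed
    then show "\<exists>M. \<forall>m\<ge>M. \<forall>n\<ge>M. dist (\<pi> (E m) v) (\<pi> (E n) v) < e" by blast
  qed
  then have "convergent (\<lambda>n. \<pi> (E n) v)" by (simp add: Cauchy_convergent_iff)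
  then have lim_E: "(\<lambda>n. \<pi> (E n) v) \<longlonglongrightarrow> extension x v"
    by (simp add: extension_def convergent_LIMSEQ_iff flip: E_def)
  have "(\<lambda>n. norm (\<iota> (F n) - \<iota> (E n)) * norm v) \<longlonglongrightarrow> norm (x - x) * norm v"
    by (intro tendsto_intros lim E)
  then have "(\<lambda>n. norm (\<iota> (F n) - \<iota> (E n)) * norm v) \<longlonglongrightarrow> 0" by simp
  then have "(\<lambda>n. \<pi> (F n) v - \<pi> (E n) v) \<longlonglongrightarrow> 0"
    by (rule Lim_null_comparison[rotated]) (simp add: norm_\<pi>_diff_le F E)
  from tendsto_add[OF this lim_E] show ?thesis by simp
qed

lemma extension_\<iota>: "f \<in> Gamma_c L \<Longrightarrow> extension (\<iota> f) v = \<pi> f v"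
  using extension_lim[of "\<lambda>_. f" "\<iota> f" v] by (simp add: LIMSEQ_const_iff)

lemma norm_extension_le: "norm (extension x v) \<le> norm x * norm v"
proof -
  obtain F where F: "\<And>n. F n \<in> Gamma_c L" "(\<lambda>n. \<iota> (F n)) \<longlonglongrightarrow> x" using dense_sequence by blast
  show ?thesis
  proof (rule LIMSEQ_le)
    show "(\<lambda>n. norm (\<pi> (F n) v)) \<longlonglongrightarrow> norm (extension x v)" by (intro tendsto_norm extension_lim F)
    show "(\<lambda>n. norm (\<iota> (F n)) * norm v) \<longlonglongrightarrow> norm x * norm v" by (intro tendsto_intros F)
  qed (use norm_\<pi>_le F in blast)
qed

lemma extension_add: "extension (x + y) v = extension x v + extension y v"
proof -
  obtain F where F: "\<And>n. F n \<in> Gamma_c L" "(\<lambda>n. \<iota> (F n)) \<longlonglongrightarrow> x" using dense_sequence by blast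
  obtain H where H: "\<And>n. H n \<in> Gamma_c L" "(\<lambda>n. \<iota> (H n)) \<longlonglongrightarrow> y" using dense_sequence by blast
  have "(\<lambda>n. \<pi> (section_add L (F n) (H n)) v) \<longlonglongrightarrow> extension (x + y) v"
    by (rule extension_lim) (use F H in \<open>auto simp: section_add_Gamma_c \<iota>_add intro: tendsto_add\<close>)
  moreover have "(\<lambda>n. \<pi> (section_add L (F n) (H n)) v) \<longlonglongrightarrow> extension x v + extension y v"
    using F H by (simp add: \<pi>_add tendsto_add extension_lim)
  ultimately show ?thesis by (rule LIMSEQ_unique)
qed

lemma extension_scaleR: "extension (r *\<^sub>R x) v = r *\<^sub>R extension x v"
proof -
  obtain F where F: "\<And>n. F n \<in> Gamma_c L" "(\<lambda>n. \<iota> (F n)) \<longlonglongrightarrow> x" using dense_sequence by blast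
  let ?F = "\<lambda>n. section_scale L (complex_of_real r) (F n)"
  have "(\<lambda>n. \<pi> (?F n) v) \<longlonglongrightarrow> extension (r *\<^sub>R x) v"
    by (rule extension_lim)
      (use F in \<open>auto simp: section_scale_Gamma_c \<iota>_scale simp flip: scaleR_eq_scaleC intro: tendsto_scaleR\<close>)
  moreover have "(\<lambda>n. \<pi> (?F n) v) \<longlonglongrightarrow> r *\<^sub>R extension x v"
    using F by (simp add: \<pi>_scale tendsto_scaleR extension_lim flip: scaleR_eq_scaleC)
  ultimately show ?thesis by (rule LIMSEQ_unique)
qed

lemma extension_add_vec: "extension x (v + w) = extension x v + extension x w"
proof -
  obtain F where F: "\<And>n. F n \<in> Gamma_c L" "(\<lambda>n. \<iota> (F n)) \<longlonglongrightarrow> x" using dense_sequence by blast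
  have "(\<lambda>n. \<pi> (F n) (v + w)) \<longlonglongrightarrow> extension x v + extension x w"
    using F by (simp add: linear_add[OF bounded_linear.linear[OF bounded_linear_\<pi>]] tendsto_add extension_lim)
  then show ?thesis using extension_lim[OF F] LIMSEQ_unique by blast
qed

lemma extension_mult: "extension (x * y) v = extension x (extension y v)"
proof -
  obtain F where F: "\<And>n. F n \<in> Gamma_c L" "(\<lambda>n. \<iota> (F n)) \<longlonglongrightarrow> x" using dense_sequence by blast
  obtain H where H: "\<And>n. H n \<in> Gamma_c L" "(\<lambda>n. \<iota> (H n)) \<longlonglongrightarrow> y" using dense_sequence by blast
  have "(\<lambda>n. \<pi> (convolution G L (F n) (H n)) v) \<longlonglongrightarrow> extension (x * y) v"
    by (rule extension_lim) (use F H in \<open>auto simp: convolution_Gamma_c \<iota>_mult intro: tendsto_mult\<close>)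
  moreover have "(\<lambda>n. \<pi> (convolution G L (F n) (H n)) v) \<longlonglongrightarrow> extension x (extension y v)"
  proof -
    let ?w = "extension y v"
    \<comment> \<open>Both operator and vector vary with \<open>n\<close>; the norms of
      \<open>\<iota> (F n)\<close> converge, so replacing the vector by its limit \<open>?w\<close>
      costs nothing in the limit.\<close>
    have "(\<lambda>n. norm (\<iota> (F n)) * norm (\<pi> (H n) v - ?w)) \<longlonglongrightarrow> norm x * norm (?w - ?w)"
      by (intro tendsto_intros F extension_lim[OF H])
    then have "(\<lambda>n. norm (\<iota> (F n)) * norm (\<pi> (H n) v - ?w)) \<longlonglongrightarrow> 0" by simp
    then have "(\<lambda>n. \<pi> (F n) (\<pi> (H n) v - ?w)) \<longlonglongrightarrow> 0"
      by (rule Lim_null_comparison[rotated]) (simp add: norm_\<pi>_le F)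
    from tendsto_add[OF this extension_lim[OF F, of ?w]]
    show ?thesis
      by (simp add: \<pi>_mult F H linear_diff[OF bounded_linear.linear[OF bounded_linear_\<pi>[OF F(1)]]])
  qed
  ultimately show ?thesis by (rule LIMSEQ_unique)
qed

lemma extension_star: "cinner (extension (star x) v) w = cinner v (extension x w)"
proof -
  obtain F where F: "\<And>n. F n \<in> Gamma_c L" "(\<lambda>n. \<iota> (F n)) \<longlonglongrightarrow> x" using dense_sequence by blast
  have "(\<lambda>n. \<pi> (section_star G L (F n)) v) \<longlonglongrightarrow> extension (star x) v"
    by (rule extension_lim) (use F in \<open>auto simp: section_star_Gamma_c \<iota>_star intro: tendsto_star\<close>)
  from bounded_linear.tendsto[OF bounded_linear_cinner_left this]
  have "(\<lambda>n. cinner v (\<pi> (F n) w)) \<longlonglongrightarrow> cinner (extension (star x) v) w" by (simp add: \<pi>_star F)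
  moreover have "(\<lambda>n. cinner v (\<pi> (F n) w)) \<longlonglongrightarrow> cinner v (extension x w)"
    by (rule bounded_linear.tendsto[OF bounded_linear_cinner_right extension_lim[OF F]])
  ultimately show ?thesis by (rule LIMSEQ_unique)
qed

text \<open>On the image of \<open>Gamma_c L\<close> the norm is the operator norm of
  \<open>\<pi>\<close>; the general case follows by perturbation, as \<open>extension\<close>
  changes by at most \<open>norm (\<iota> (F n) - x)\<close> in operator norm.\<close>

lemma norm_le_extension:
  assumes C: "0 \<le> C" and bound: "\<And>v. norm (extension x v) \<le> C * norm v"
  shows "norm x \<le> C"
proof -
  obtain F where F: "\<And>n. F n \<in> Gamma_c L" "(\<lambda>n. \<iota> (F n)) \<longlonglongrightarrow> x" using dense_sequence by blast
  have "norm (\<iota> (F n)) \<le> C + norm (\<iota> (F n) - x)" for n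
    unfolding norm_\<iota>[OF F(1)]
  proof (rule onorm_bound)
    fix v
    have "\<pi> (F n) v = extension x v + extension (\<iota> (F n) - x) v"
      by (simp add: extension_\<iota>[OF F(1)] flip: extension_add)
    then have "norm (\<pi> (F n) v) \<le> norm (extension x v) + norm (extension (\<iota> (F n) - x) v)"
      by (simp add: norm_triangle_ineq)
    also have "\<dots> \<le> C * norm v + norm (\<iota> (F n) - x) * norm v"
      by (intro add_mono bound norm_extension_le)
    finally show "norm (\<pi> (F n) v) \<le> (C + norm (\<iota> (F n) - x)) * norm v" by (simp add: distrib_right)
  qed (use C in simp)
  moreover have "(\<lambda>n. C + norm (\<iota> (F n) - x)) \<longlonglongrightarrow> C + norm (x - x)"
    by (intro tendsto_intros F)
  ultimately show ?thesis
    using LIMSEQ_le[OF tendsto_norm[OF F(2)]] by auto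
qed

sublocale extension: faithful_representation extension
  by unfold_locales (fact extension_add extension_scaleR extension_add_vec extension_mult
    extension_star norm_extension_le norm_le_extension)+

section \<open>Local units\<close>

text \<open>Real values make these elements self-adjoint, as \<open>Ped_representation\<close>
  requires of its set \<open>U\<close>.\<close>

definition local_units :: "'a set" where
  "local_units = {\<iota> (unit_section G L h) |h. h \<in> Cc (unit_space G) \<and> (\<forall>x. h x \<in> \<real>)}"

lemma star_local_unit: "u \<in> local_units \<Longrightarrow> star u = u"
  unfolding local_units_def
  by (auto simp: section_star_unit_section Reals_cnj_iff unit_section_Gamma_c simp flip: \<iota>_star)

lemma unit_section_acts_trivially:
  assumes f: "f \<in> Gamma_c L" and h: "h \<in> Cc (unit_space G)"
    and one: "\<And>g. f g \<noteq> lzero L g \<Longrightarrow> h (rng G g) = 1"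
  shows "\<iota> (unit_section G L h) * \<iota> f = \<iota> f"
proof -
  have "convolution G L (unit_section G L h) f = f"
  proof
    fix g
    show "convolution G L (unit_section G L h) f g = f g"
      using one[of g] Gamma_cD(1)[OF f]
      by (cases "f g = lzero L g") (simp_all add: convolution_unit_section lscale_one)
  qed
  then show ?thesis using \<iota>_mult[OF unit_section_Gamma_c[OF h] f] by simp
qed

text \<open>A Urysohn function equal to 1 on both compact supports acts trivially on both
  units.\<close>

lemma local_units_directed:
  assumes "u \<in> local_units" and "u' \<in> local_units"
  shows "\<exists>w\<in>local_units. w * u = u \<and> w * u' = u'"
proof -
  obtain h h' where h: "u = \<iota> (unit_section G L h)" "h \<in> Cc (unit_space G)"
    and h': "u' = \<iota> (unit_section G L h')" "h' \<in> Cc (unit_space G)"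
    using assms unfolding local_units_def by blast
  obtain K K' where K: "compact K" "K \<subseteq> unit_space G" "\<And>x. x \<notin> K \<Longrightarrow> h x = 0"
    and K': "compact K'" "K' \<subseteq> unit_space G" "\<And>x. x \<notin> K' \<Longrightarrow> h' x = 0"
    using h h' unfolding Cc_def by blast
  have "compact (K \<union> K')" "K \<union> K' \<subseteq> unit_space G" using K K' by auto
  then obtain k where k: "k \<in> Cc (unit_space G)" "\<And>x. x \<in> K \<union> K' \<Longrightarrow> k x = 1" "\<And>x. k x \<in> \<real>"
    using Cc_local_unit by blast
  have "\<iota> (unit_section G L k) * u = u" unfolding h(1)
  proof (rule unit_section_acts_trivially[OF unit_section_Gamma_c[OF h(2)] k(1)])
    fix g assume g: "unit_section G L h g \<noteq> lzero L g"
    then have "g \<in> unit_space G" by (simp add: unit_section_def split: if_splits)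
    with g have "h g \<noteq> 0" by (auto simp: unit_section_def lscale_zero_left)
    then have "g \<in> K" using K(3) by blast
    then show "k (rng G g) = 1" using k(2) \<open>g \<in> unit_space G\<close> by simp
  qed
  moreover have "\<iota> (unit_section G L k) * u' = u'" unfolding h'(1)
  proof (rule unit_section_acts_trivially[OF unit_section_Gamma_c[OF h'(2)] k(1)])
    fix g assume g: "unit_section G L h' g \<noteq> lzero L g"
    then have "g \<in> unit_space G" by (simp add: unit_section_def split: if_splits)
    with g have "h' g \<noteq> 0" by (auto simp: unit_section_def lscale_zero_left)
    then have "g \<in> K'" using K'(3) by blast
    then show "k (rng G g) = 1" using k(2) \<open>g \<in> unit_space G\<close> by simp
  qed
  moreover have "\<iota> (unit_section G L k) \<in> local_units" using k unfolding local_units_def by blast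
  ultimately show ?thesis by blast
qed

lemma local_units_dense: "closure {x. \<exists>u\<in>local_units. u * x = x} = UNIV"
proof -
  have "\<iota> f \<in> {x. \<exists>u\<in>local_units. u * x = x}" if f: "f \<in> Gamma_c L" for f
  proof -
    obtain K where K: "compact K" "\<And>g. g \<notin> K \<Longrightarrow> f g = lzero L g" using Gamma_cD(3)[OF f] by metis
    have "compact (rng G ` K)"
      by (rule compact_continuous_image[OF continuous_on_subset[OF continuous_rng] K(1)]) simp
    moreover have "rng G ` K \<subseteq> unit_space G" by auto
    ultimately obtain h where h: "h \<in> Cc (unit_space G)" "\<And>x. x \<in> rng G ` K \<Longrightarrow> h x = 1" "\<And>x. h x \<in> \<real>"
      using Cc_local_unit by blast
    then have "\<iota> (unit_section G L h) * \<iota> f = \<iota> f"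
      using K(2) by (intro unit_section_acts_trivially[OF f h(1)]) blast
    then show ?thesis using h unfolding local_units_def by blast
  qed
  then have "\<iota> ` Gamma_c L \<subseteq> {x. \<exists>u\<in>local_units. u * x = x}" by blast
  from closure_mono[OF this] show ?thesis by (simp add: closure_\<iota> top.extremum_unique)
qed

text \<open>By directedness some \<open>w\<close> satisfies \<open>w * u = u\<close>, so
  \<open>u\<close> itself has a left unit.\<close>

lemma local_units_subset_Ped: "u \<in> local_units \<Longrightarrow> u \<in> Ped"
  using local_units_directed local_unit_in_Ped by blast

end

section \<open>Measures and traces\<close>

lemma Cc_add: "f \<in> Cc X \<Longrightarrow> h \<in> Cc X \<Longrightarrow> (\<lambda>x. f x + h x) \<in> Cc X"
proof -
  assume f: "f \<in> Cc X" and h: "h \<in> Cc X"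
  then obtain K K' where "compact K" "K \<subseteq> X" "\<And>x. x \<notin> K \<Longrightarrow> f x = 0"
    "compact K'" "K' \<subseteq> X" "\<And>x. x \<notin> K' \<Longrightarrow> h x = 0" unfolding Cc_def by blast
  then show ?thesis using f h unfolding Cc_def
    by (auto intro!: continuous_on_add exI[of _ "K \<union> K'"])
qed

lemma Cc_scale: "f \<in> Cc X \<Longrightarrow> (\<lambda>x. c * f x) \<in> Cc X"
  unfolding Cc_def by (auto intro!: continuous_on_mult_left)

lemma Cc_zero: "(\<lambda>x. 0) \<in> Cc X"
  unfolding Cc_def by (auto intro: exI[of _ "{}"])

lemma Cc_sum:
  fixes F :: "'i \<Rightarrow> 'g::topological_space \<Rightarrow> complex"
  assumes "\<And>i. i \<in> I \<Longrightarrow> F i \<in> Cc X"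
  shows "(\<lambda>x. \<Sum>i\<in>I. F i x) \<in> Cc X"
  using assms by (induction I rule: infinite_finite_induct) (auto simp: Cc_zero Cc_add)

lemma real_radon_measure_add:
    "real_radon_measure X \<mu> \<Longrightarrow> f \<in> Cc X \<Longrightarrow> h \<in> Cc X \<Longrightarrow> \<mu> (\<lambda>x. f x + h x) = \<mu> f + \<mu> h"
  and real_radon_measure_scale:
    "real_radon_measure X \<mu> \<Longrightarrow> f \<in> Cc X \<Longrightarrow> \<mu> (\<lambda>x. c * f x) = c * \<mu> f"
  and real_radon_measure_bounded:
    "real_radon_measure X \<mu> \<Longrightarrow> compact K \<Longrightarrow> K \<subseteq> X \<Longrightarrow>
      \<exists>C. \<forall>f\<in>Cc X. (\<forall>x. x \<notin> K \<longrightarrow> f x = 0) \<longrightarrow> cmod (\<mu> f) \<le> C * (SUP x. cmod (f x))"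
  unfolding real_radon_measure_def by simp_all

lemma real_radon_measure_zero: "real_radon_measure X \<mu> \<Longrightarrow> \<mu> (\<lambda>x. 0) = 0"
  using real_radon_measure_scale[of X \<mu> "\<lambda>x. 0" 0] by (simp add: Cc_zero)

lemma real_radon_measure_sum:
  assumes "real_radon_measure X \<mu>" and "\<And>i. i \<in> I \<Longrightarrow> F i \<in> Cc X"
  shows "\<mu> (\<lambda>x. \<Sum>i\<in>I. F i x) = (\<Sum>i\<in>I. \<mu> (F i))"
  using assms(2)
proof (induction I rule: infinite_finite_induct)
  case (insert i I)
  have "\<mu> (\<lambda>x. F i x + (\<Sum>i\<in>I. F i x)) = \<mu> (F i) + \<mu> (\<lambda>x. \<Sum>i\<in>I. F i x)"
    using insert.prems by (intro real_radon_measure_add[OF assms(1)] Cc_sum) auto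
  then show ?case using insert by simp
qed (simp_all add: real_radon_measure_zero[OF assms(1)])

text \<open>Uniform convergence alone is too weak for a Radon measure; the common compact support
  \<open>K\<close> supplies one constant for all differences.\<close>

lemma real_radon_measure_tendsto:
  fixes r :: "nat \<Rightarrow> 'g::topological_space \<Rightarrow> complex"
  assumes \<mu>: "real_radon_measure X \<mu>" and r: "\<And>n. r n \<in> Cc X" and F: "F \<in> Cc X"
    and K: "compact K" "K \<subseteq> X" "\<And>n x. x \<notin> K \<Longrightarrow> r n x = 0" "\<And>x. x \<notin> K \<Longrightarrow> F x = 0"
    and lim: "uniform_limit UNIV r F sequentially"
  shows "(\<lambda>n. \<mu> (r n)) \<longlonglongrightarrow> \<mu> F"
proof -
  obtain C where C: "\<And>f. f \<in> Cc X \<Longrightarrow> (\<forall>x. x \<notin> K \<longrightarrow> f x = 0) \<Longrightarrow> cmod (\<mu> f) \<le> C * (SUP x. cmod (f x))"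
    using real_radon_measure_bounded[OF \<mu> K(1,2)] by metis
  show ?thesis
  proof (rule metric_LIMSEQ_I)
    fix e :: real assume e: "0 < e"
    \<comment> \<open>The constant \<open>C\<close> may be negative or zero.\<close>
    define d where "d = e / (\<bar>C\<bar> + 1)"
    have d: "0 < d" using e by (simp add: d_def add_nonneg_pos)
    obtain N where N: "\<And>n x. N \<le> n \<Longrightarrow> dist (r n x) (F x) < d"
      using lim d unfolding uniform_limit_iff eventually_sequentially by blast
    have "dist (\<mu> (r n)) (\<mu> F) < e" if n: "N \<le> n" for n
    proof -
      let ?D = "\<lambda>x. r n x + (- 1) * F x"
      have D: "?D \<in> Cc X" using r F by (intro Cc_add Cc_scale)
      have bound: "cmod (?D x) \<le> d" for x using N[OF n, of x] by (simp add: dist_norm)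
      have "bdd_above (range (\<lambda>x. cmod (?D x)))" by (rule bdd_aboveI2) (rule bound)
      then have "cmod (?D undefined) \<le> (SUP x. cmod (?D x))" by (rule cSUP_upper[OF UNIV_I])
      then have "0 \<le> (SUP x. cmod (?D x))" using norm_ge_zero order_trans by blast
      moreover have "(SUP x. cmod (?D x)) \<le> d" by (rule cSUP_least) (use bound in auto)
      ultimately have "C * (SUP x. cmod (?D x)) \<le> \<bar>C\<bar> * d" by (intro mult_mono) auto
      moreover have "cmod (\<mu> ?D) \<le> C * (SUP x. cmod (?D x))" by (rule C[OF D]) (use K in auto)
      moreover have "\<bar>C\<bar> * d < e" using e by (simp add: d_def field_simps)
      moreover have "\<mu> ?D = \<mu> (r n) + (- 1) * \<mu> F"
        by (subst real_radon_measure_add[OF \<mu> r Cc_scale[OF F]])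
          (simp only: real_radon_measure_scale[OF \<mu> F])
      ultimately show ?thesis by (simp add: dist_norm)
    qed
    then show "\<exists>N. \<forall>n\<ge>N. dist (\<mu> (r n)) (\<mu> F) < e" by blast
  qed
qed

context completed_groupoid_algebra
begin

text \<open>The elements on which a local unit acts trivially from both sides form a C*-algebra inside the
  Pedersen ideal, so that \<open>\<tau>\<close> is norm continuous there.\<close>

lemma trace_tendsto:
  assumes \<tau>: "ped_functional \<tau>" "ped_continuous \<tau>" and w: "w \<in> local_units"
    and x: "\<And>n. w * x n = x n" "\<And>n. x n * w = x n" and lim: "x \<longlonglongrightarrow> y"
  shows "(\<lambda>n. \<tau> (x n)) \<longlonglongrightarrow> \<tau> y"
proof -
  define B where "B = {b. w * b = b \<and> b * w = b}"
  have sw: "star w = w" using w by (rule star_local_unit)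
  have closed_B: "closed B"
  proof -
    have "B = {b. w * b = b} \<inter> {b. b * w = b}" by (auto simp: B_def)
    then show ?thesis by (auto intro!: closed_Int closed_Collect_eq continuous_intros)
  qed
  have sub: "cstar_subalgebra B"
    unfolding cstar_subalgebra_def complex_subspace_def
  proof (intro conjI ballI allI)
    show "x * y \<in> B" if "x \<in> B" "y \<in> B" for x y
      using that unfolding B_def by (metis (mono_tags, lifting) mem_Collect_eq mult.assoc)
    show "star b \<in> B" if "b \<in> B" for b
      using that sw unfolding B_def by (metis (mono_tags, lifting) mem_Collect_eq star_mult)
  qed (use closed_B in \<open>auto simp: B_def distrib_left distrib_right scaleC_mult_left scaleC_mult_right\<close>)
  have B_Ped: "B \<subseteq> Ped"
    using Ped_mult_right[OF local_units_subset_Ped[OF w]] by (auto simp: B_def) (metis)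
  obtain C where C: "\<And>b. b \<in> B \<Longrightarrow> cmod (\<tau> b) \<le> C * norm b"
    using \<tau>(2) sub B_Ped unfolding ped_continuous_def by blast
  have xB: "x n \<in> B" for n using x by (simp add: B_def)
  then have yB: "y \<in> B" using closed_B lim closed_sequentially by blast
  have "norm (\<tau> (x n) - \<tau> y) \<le> C * norm (x n - y)" for n
  proof -
    have eq: "x n - y = x n + scaleC (- 1) y" by (simp add: scaleC_minus_one)
    then have "x n - y \<in> B"
      using xB[of n] yB sub unfolding cstar_subalgebra_def complex_subspace_def by metis
    moreover have "\<tau> (x n - y) = \<tau> (x n) + (- 1) * \<tau> y"
      unfolding eq using \<tau>(1) xB[of n] yB B_Ped Ped_scaleC unfolding ped_functional_def by (metis subsetD)
    ultimately show ?thesis using C[of "x n - y"] by simp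
  qed
  moreover have "(\<lambda>n. C * norm (x n - y)) \<longlonglongrightarrow> C * norm (y - y)" by (intro tendsto_intros lim)
  ultimately have "(\<lambda>n. \<tau> (x n) - \<tau> y) \<longlonglongrightarrow> 0"
    by (intro Lim_null_comparison[of "\<lambda>n. \<tau> (x n) - \<tau> y"]) auto
  then show ?thesis by (simp add: LIM_zero_iff)
qed

text \<open>\<open>F\<close> is the conditional expectation of \<open>z z\<^sup>*\<close>; it exists because the regular representation
  is weakly contained in \<open>\<pi>\<close>.\<close>

lemma trace_mult_star:
  assumes u: "u \<in> local_units" and uz: "u * z = z"
  obtains F where "F \<in> Cc (unit_space G)" and "\<And>x. F x \<in> \<real>\<^sub>\<ge>\<^sub>0"
    and "\<And>\<mu> \<tau>. real_radon_measure (unit_space G) \<mu> \<Longrightarrow> is_trace_of_measure G L \<iota> \<mu> \<tau> \<Longrightarrow> \<tau> (z * star z) = \<mu> F"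
proof -
  obtain h where h: "u = \<iota> (unit_section G L h)" "h \<in> Cc (unit_space G)"
    using u unfolding local_units_def by blast
  obtain K where K: "compact K" "K \<subseteq> unit_space G" "\<And>x. x \<notin> K \<Longrightarrow> h x = 0"
    using h(2) unfolding Cc_def by blast
  obtain y where y: "\<And>n. y n \<in> Gamma_c L" "(\<lambda>n. \<iota> (y n)) \<longlonglongrightarrow> z" using dense_sequence by blast
  \<comment> \<open>Multiplication by \<open>u\<close> keeps the limit, as \<open>u * z = z\<close>,
    and gives all approximants one compact range set and one left unit.\<close>
  define k where "k n = convolution G L (unit_section G L h) (y n)" for n
  define f where "f n = convolution G L (k n) (section_star G L (k n))" for n
  have k: "k n \<in> Gamma_c L" and \<iota>_k: "\<iota> (k n) = u * \<iota> (y n)" for n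
    using y h by (simp_all add: k_def convolution_Gamma_c unit_section_Gamma_c \<iota>_mult)
  have f: "f n \<in> Gamma_c L" and \<iota>_f: "\<iota> (f n) = \<iota> (k n) * star (\<iota> (k n))" for n
    using k by (simp_all add: f_def convolution_Gamma_c section_star_Gamma_c \<iota>_mult \<iota>_star)
  have lim_k: "(\<lambda>n. \<iota> (k n)) \<longlonglongrightarrow> z"
    using tendsto_mult[OF tendsto_const[of u] y(2)] by (simp add: \<iota>_k uz)
  then have lim_f: "(\<lambda>n. \<iota> (f n)) \<longlonglongrightarrow> z * star z"
    unfolding \<iota>_f by (intro tendsto_mult tendsto_star)
  define r where "r n = unit_restriction G L (f n)" for n
  have r_Cc: "r n \<in> Cc (unit_space G)" for n unfolding r_def by (rule unit_restriction_Cc[OF f])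
  have r_nonneg: "r n x \<in> \<real>\<^sub>\<ge>\<^sub>0" for n x
    unfolding r_def f_def by (rule unit_restriction_mult_star_nonneg) (rule Gamma_cD(1)[OF k])
  have r_0: "r n x = 0" if x: "x \<notin> K" for n x
  proof (cases "x \<in> unit_space G")
    case xu: True
    \<comment> \<open>The sum runs over arrows with range \<open>x\<close>, and there
      \<open>k n\<close> carries the factor \<open>h x = 0\<close>.\<close>
    have "f n x = finprod (fibre_group L x)
        (\<lambda>\<gamma>. lmul L (k n \<gamma>) (section_star G L (k n) (gmul G (ginv G \<gamma>) x))) {}"
      unfolding f_def
    proof (rule convolution_eq)
      fix \<gamma> assume \<gamma>: "rng G \<gamma> = rng G x"
      then have "k n \<gamma> = lzero L \<gamma>"
        using x xu K(3)[OF x] Gamma_cD(1)[OF y(1)]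
        by (simp add: k_def convolution_unit_section lscale_zero_left)
      then show "lmul L (k n \<gamma>) (section_star G L (k n) (gmul G (ginv G \<gamma>) x)) = lzero L x"
        using \<gamma> Gamma_cD(1)[OF section_star_Gamma_c[OF k]]
        by (simp add: rng_ginv_gmul gmul_ginv_cancel_left')
    qed (use Gamma_cD(1)[OF k] Gamma_cD(1)[OF section_star_Gamma_c[OF k]] in auto)
    also have "\<dots> = lzero L x"
      by (simp add: comm_monoid.finprod_empty[OF comm_monoid_fibre_group]) (simp add: fibre_group_def)
    finally show ?thesis using xu by (simp add: r_def unit_restriction_def)
  qed (simp add: r_def unit_restriction_def)
  have "uniformly_Cauchy_on UNIV r"
  proof (rule uniformly_Cauchy_onI)
    fix e :: real assume "0 < e"
    then obtain M where "\<forall>m\<ge>M. \<forall>n\<ge>M. dist (\<iota> (f m)) (\<iota> (f n)) < e"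
      using LIMSEQ_imp_Cauchy[OF lim_f] unfolding Cauchy_def by blast
    then show "\<exists>M. \<forall>x\<in>UNIV. \<forall>m\<ge>M. \<forall>n\<ge>M. dist (r m x) (r n x) < e"
      using unit_restriction_diff_le[OF f f] unfolding r_def dist_norm by (meson le_less_trans)
  qed
  then have "uniformly_convergent_on UNIV r" by (rule Cauchy_uniformly_convergent)
  then obtain F where F: "uniform_limit UNIV r F sequentially"
    by (auto simp: uniformly_convergent_on_def)
  have lim_r: "(\<lambda>n. r n x) \<longlonglongrightarrow> F x" for x using tendsto_uniform_limitI[OF F] by simp
  have F_0: "F x = 0" if "x \<notin> K" for x using lim_r[of x] r_0[OF that] by (simp add: LIMSEQ_const_iff)
  have "continuous_on (unit_space G) F"
  proof (rule uniform_limit_theorem)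
    show "uniform_limit (unit_space G) r F sequentially" using F by (rule uniform_limit_on_subset) simp
  qed (use r_Cc in \<open>auto simp: Cc_def\<close>)
  then have F_Cc: "F \<in> Cc (unit_space G)" using K F_0 by (auto simp: Cc_def)
  show ?thesis
  proof (rule that[OF F_Cc])
    show "F x \<in> \<real>\<^sub>\<ge>\<^sub>0" for x
      by (rule closed_sequentially[OF closed_nonneg_Reals_complex r_nonneg lim_r])
  next
    fix \<mu> \<tau> assume \<mu>: "real_radon_measure (unit_space G) \<mu>" and \<tau>: "is_trace_of_measure G L \<iota> \<mu> \<tau>"
    \<comment> \<open>The approximants \<open>u * \<iota> (y n)\<close> need not be fixed by
      \<open>u\<close>, which is not idempotent in general; a larger unit fixes them all.\<close>
    obtain w where w: "w \<in> local_units" "w * u = u" using local_units_directed[OF u u] by blast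
    have wk: "w * \<iota> (k n) = \<iota> (k n)" for n unfolding \<iota>_k by (simp add: w flip: mult.assoc)
    then have kw: "star (\<iota> (k n)) * w = star (\<iota> (k n))" for n
      by (metis star_local_unit star_mult w(1))
    have "(\<lambda>n. \<tau> (\<iota> (f n))) \<longlonglongrightarrow> \<tau> (z * star z)"
    proof (rule trace_tendsto[OF _ _ w(1) _ _ lim_f])
      show "w * \<iota> (f n) = \<iota> (f n)" for n unfolding \<iota>_f by (simp add: wk flip: mult.assoc)
      show "\<iota> (f n) * w = \<iota> (f n)" for n unfolding \<iota>_f by (simp add: kw mult.assoc)
    qed (use \<tau> in \<open>simp_all add: is_trace_of_measure_def\<close>)
    moreover have "(\<lambda>n. \<mu> (r n)) \<longlonglongrightarrow> \<mu> F"
      by (rule real_radon_measure_tendsto[OF \<mu> r_Cc F_Cc K(1,2) r_0 F_0 F])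
    moreover have "\<tau> (\<iota> (f n)) = \<mu> (r n)" for n
      using \<tau> f by (simp add: is_trace_of_measure_def r_def)
    ultimately show "\<tau> (z * star z) = \<mu> F" using LIMSEQ_unique by simp
  qed
qed

lemma trace_of_positive:
  assumes a: "a \<in> Ped" "cstar_positive a"
  shows "\<exists>f\<in>Cc (unit_space G). (\<forall>x. f x \<in> \<real>\<^sub>\<ge>\<^sub>0) \<and>
    (\<forall>\<mu> \<tau>. real_radon_measure (unit_space G) \<mu> \<and> is_trace_of_measure G L \<iota> \<mu> \<tau> \<longrightarrow> \<tau> a = \<mu> f)"
proof (rule extension.Ped_positive_decomposition[OF star_local_unit local_units_directed local_units_dense a])
  fix u z and m :: nat
  assume u: "u \<in> local_units" and uz: "\<And>i. i < m \<Longrightarrow> u * z i = z i"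
    and a_eq: "a = (\<Sum>i<m. star (z i) * z i)"
  have "\<exists>F. F \<in> Cc (unit_space G) \<and> (\<forall>x. F x \<in> \<real>\<^sub>\<ge>\<^sub>0) \<and>
    (\<forall>\<mu> \<tau>. real_radon_measure (unit_space G) \<mu> \<longrightarrow> is_trace_of_measure G L \<iota> \<mu> \<tau> \<longrightarrow>
      \<tau> (z i * star (z i)) = \<mu> F)" if "i < m" for i
    using trace_mult_star[OF u uz[OF that]] by metis
  then obtain F where F: "\<And>i. i < m \<Longrightarrow> F i \<in> Cc (unit_space G)" "\<And>i x. i < m \<Longrightarrow> F i x \<in> \<real>\<^sub>\<ge>\<^sub>0"
    "\<And>i \<mu> \<tau>. i < m \<Longrightarrow> real_radon_measure (unit_space G) \<mu> \<Longrightarrow> is_trace_of_measure G L \<iota> \<mu> \<tau> \<Longrightarrow>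
      \<tau> (z i * star (z i)) = \<mu> (F i)"
    by metis
  \<comment> \<open>The trace property is available only for pairs in \<open>Ped\<close>. Both
    factors lie there because each is a product with the local unit \<open>u\<close>.\<close>
  have z_Ped: "z i \<in> Ped" "star (z i) \<in> Ped" if "i < m" for i
  proof -
    show "z i \<in> Ped" using Ped_mult_right[OF local_units_subset_Ped[OF u], of "z i"] uz[OF that] by simp
    have "star (z i) * u = star (z i)" using uz[OF that] star_local_unit[OF u] by (metis star_mult)
    then show "star (z i) \<in> Ped" using Ped_mult_left[OF local_units_subset_Ped[OF u], of "star (z i)"] by simp
  qed
  show ?thesis
  proof (intro bexI[of _ "\<lambda>x. \<Sum>i<m. F i x"] conjI allI impI)
    show "(\<lambda>x. \<Sum>i<m. F i x) \<in> Cc (unit_space G)" by (rule Cc_sum) (use F in auto)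
    show "(\<Sum>i<m. F i x) \<in> \<real>\<^sub>\<ge>\<^sub>0" for x
      using F(2) by (induction m) (auto intro: nonneg_Reals_add_I)
  next
    fix \<mu> \<tau> assume "real_radon_measure (unit_space G) \<mu> \<and> is_trace_of_measure G L \<iota> \<mu> \<tau>"
    then have \<mu>: "real_radon_measure (unit_space G) \<mu>" and \<tau>: "is_trace_of_measure G L \<iota> \<mu> \<tau>" by auto
    have fn: "ped_functional \<tau>" and tr: "ped_tracial \<tau>" using \<tau> by (simp_all add: is_trace_of_measure_def)
    have "\<tau> 0 = 0" using fn Ped_zero scaleC_zero unfolding ped_functional_def by (metis mult_zero_left)
    have "\<tau> (\<Sum>i\<in>I. star (z i) * z i) = (\<Sum>i\<in>I. \<tau> (star (z i) * z i))" if "finite I" "I \<subseteq> {..<m}" for I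
      using that
    proof (induction I rule: finite_induct)
      case (insert i I)
      then have "\<tau> (star (z i) * z i + (\<Sum>i\<in>I. star (z i) * z i))
          = \<tau> (star (z i) * z i) + \<tau> (\<Sum>i\<in>I. star (z i) * z i)"
        using fn z_Ped unfolding ped_functional_def
        by (blast intro: Ped_sum Ped_mult_right)
      with insert show ?case by simp
    qed (simp add: \<open>\<tau> 0 = 0\<close>)
    then have "\<tau> a = (\<Sum>i<m. \<tau> (star (z i) * z i))" by (simp add: a_eq)
    also have "\<dots> = (\<Sum>i<m. \<mu> (F i))"
    proof (rule sum.cong[OF refl])
      fix i assume "i \<in> {..<m}"
      then have i: "i < m" by simp
      have "\<tau> (star (z i) * z i) = \<tau> (z i * star (z i))"
        using tr z_Ped[OF i] by (simp add: ped_tracial_def)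
      then show "\<tau> (star (z i) * z i) = \<mu> (F i)" using F(3)[OF i \<mu> \<tau>] by simp
    qed
    also have "\<dots> = \<mu> (\<lambda>x. \<Sum>i<m. F i x)"
      by (rule real_radon_measure_sum[symmetric, OF \<mu>]) (use F in auto)
    finally show "\<tau> a = \<mu> (\<lambda>x. \<Sum>i<m. F i x)" .
  qed
qed

end

theorem lemma7p8:
  fixes G :: "'g::t2_space groupoid"
    and L :: "('g, 'l::topological_space) fell_bundle"
    and \<pi> :: "('g \<Rightarrow> 'l) \<Rightarrow> 'h::complex_hilbert_space \<Rightarrow> 'h"
    and \<iota> :: "('g \<Rightarrow> 'l) \<Rightarrow> 'a::cstar_algebra"
    and a :: 'a
  assumes "twisted_etale_groupoid G L"
    and "star_representation G L \<pi>"
    and "weakly_contains_regular G L \<pi>"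
    and "cstar_completion G L \<pi> \<iota>"
    and "a \<in> Ped" and "cstar_positive a"
  shows "\<exists>f\<in>Cc (unit_space G). (\<forall>x. f x \<in> \<real>\<^sub>\<ge>\<^sub>0) \<and>
    (\<forall>\<mu>. real_radon_measure (unit_space G) \<mu> \<and> invariant_measure G \<mu> \<longrightarrow>
      (\<forall>\<tau>. is_trace_of_measure G L \<iota> \<mu> \<tau> \<longrightarrow> \<tau> a = \<mu> f))"
proof -
  interpret twisted_etale_groupoid G L by fact
  interpret completed_groupoid_algebra G L \<pi> \<iota> by unfold_locales fact+
  show ?thesis using trace_of_positive[OF assms(5,6)] by blast
qed

end
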